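(* For $h_0\in\mathbb C^*$, the assignment $$e_j\mapsto x^j\partial,\quad f_j\mapsto-\partial^{-1}x^j,\quad\psi_j\mapsto(x-h_0)^j-x^j-(-h_0)^jc_{\mathfrak D}\qquad(j\ge0)$$ induces an isomorphism of $\mathbb C$-algebras $\vartheta:\ddot Y_{h_0}(\mathfrak{gl}_1)\to U(\bar{\mathfrak D}_{h_0})$.
   Context: $\mathbb Z_+=\{0,1,2,\dots\}$. For $h_0\in\mathbb C$, $\ddot Y_{h_0}(\mathfrak{gl}_1)$ is the unital associative $\mathbb C$-algebra generated by $e_j,f_j,\psi_j$ ($j\in\mathbb Z_+$) subject to the relations ($i,j,i_1,i_2,i_3\in\mathbb Z_+$; $\mathrm{Sym}_{\mathfrak S_3}$ is the sum over permutations of $i_1,i_2,i_3$): - $[\psi_i,\psi_j]=0$, $[e_i,f_j]=\psi_{i+j}$; - $[e_{i+3},e_j]-3[e_{i+2},e_{j+1}]+3[e_{i+1},e_{j+2}]-[e_i,e_{j+3}]-h_0^2([e_{i+1},e_j]-[e_i,e_{j+1}])=0$; - $[f_{i+3},f_j]-3[f_{i+2},f_{j+1}]+3[f_{i+1},f_{j+2}]-[f_i,f_{j+3}]-h_0^2([f_{i+1},f_j]-[f_i,f_{j+1}])=0$; - $[\psi_{i+3},e_j]-3[\psi_{i+2},e_{j+1}]+3[\psi_{i+1},e_{j+2}]-[\psi_i,e_{j+3}]-h_0^2([\psi_{i+1},e_j]-[\psi_i,e_{j+1}])=0$; - $[\psi_{i+3},f_j]-3[\psi_{i+2},f_{j+1}]+3[\psi_{i+1},f_{j+2}]-[\psi_i,f_{j+3}]-h_0^2([\psi_{i+1},f_j]-[\psi_i,f_{j+1}])=0$;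 - $[\psi_0,e_j]=[\psi_1,e_j]=0$, $[\psi_2,e_j]=2h_0^2e_j$; $[\psi_0,f_j]=[\psi_1,f_j]=0$, $[\psi_2,f_j]=-2h_0^2f_j$; - $\mathrm{Sym}_{\mathfrak S_3}[e_{i_1},[e_{i_2},e_{i_3+1}]]=0$, $\mathrm{Sym}_{\mathfrak S_3}[f_{i_1},[f_{i_2},f_{i_3+1}]]=0$. $\mathfrak D_{h_0}$ is the unital associative $\mathbb C$-algebra generated by $x,\partial^{\pm1}$ with $\partial\partial^{-1}=\partial^{-1}\partial=1$, $\partial x=(x+h_0)\partial$, viewed as a Lie algebra with the commutator bracket; $\bar{\mathfrak D}_{h_0}=\mathfrak D_{h_0}\oplus\mathbb Cc_{\mathfrak D}$ is its central extension by the 2-cocycle $$\phi_{\mathfrak D}(f(x)\partial^r,g(x)\partial^{-s})=\begin{cases}\sum_{l=-r}^{-1}f(lh_0)g((l+r)h_0)&r=s>0\\-\sum_{l=r}^{-1}g(lh_0)f((l-r)h_0)&r=s<0\\0&\text{otherwise.}\end{cases}$$ $U(\cdot)$ denotes the universal enveloping algebra. *)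

theory Defs
  imports "HOL-Algebra.QuotRing" "HOL-Algebra.Module" "HOL-Library.Poly_Mapping"
    "HOL-Computational_Algebra.Polynomial"
begin

section \<open>Complex unital associative algebras given by generators and relations\<close>

text \<open>
  The locales \<open>module\<close> and \<open>algebra\<close> are not used for the records below, because
  \<open>algebra\<close> is about commutative algebras only.
\<close>

datatype 'g word = Word (letters: "'g list")

instantiation word :: (type) monoid_add
begin
definition zero_word :: "'a word" where "0 = Word []"
definition plus_word :: "'a word \<Rightarrow> 'a word \<Rightarrow> 'a word"
  where "v + w = Word (letters v @ letters w)"
instance by standard (auto simp: zero_word_def plus_word_def)
end

text \<open>
  Noncommutative polynomials are finitely supported functions on words; the library's product on
  \<open>\<Rightarrow>\<^sub>0\<close> is convolution along the concatenation of words, so this is the monoid algebra of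
  the free monoid.
\<close>

type_synonym 'g ncpoly = "'g word \<Rightarrow>\<^sub>0 complex"

definition const :: "complex \<Rightarrow> 'g ncpoly" where
  "const c = Poly_Mapping.single 0 c"

definition gen :: "'g \<Rightarrow> 'g ncpoly" where
  "gen g = Poly_Mapping.single (Word [g]) 1"

definition free_alg :: "'g set \<Rightarrow> (complex, 'g ncpoly) module" where
  "free_alg S =
    \<lparr>carrier = {p. \<forall>w\<in>Poly_Mapping.keys p. set (letters w) \<subseteq> S},
     monoid.mult = (*), one = 1, zero = 0, add = (+), module.smult = (\<lambda>c p. const c * p)\<rparr>"

definition quot_alg :: "(complex, 'a) module \<Rightarrow> 'a set \<Rightarrow> (complex, 'a set) module" where
  "quot_alg A I = ring.extend (A Quot I)
     (module.fields (\<lambda>c X. \<Union>a\<in>X. I +>\<^bsub>A\<^esub> (c \<odot>\<^bsub>A\<^esub> a)))"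

text \<open>
  The locale \<open>ideal\<close> is about two-sided ideals, so \<open>Idl\<close> is the two-sided ideal generated by a set.
\<close>

definition pres_alg :: "'g set \<Rightarrow> 'g ncpoly set \<Rightarrow> (complex, 'g ncpoly set) module" where
  "pres_alg S R = quot_alg (free_alg S) (Idl\<^bsub>free_alg S\<^esub> R)"

definition pres_class :: "'g set \<Rightarrow> 'g ncpoly set \<Rightarrow> 'g ncpoly \<Rightarrow> 'g ncpoly set" where
  "pres_class S R p = (Idl\<^bsub>free_alg S\<^esub> R) +>\<^bsub>free_alg S\<^esub> p"

definition alg_iso :: "(complex, 'a) module \<Rightarrow> (complex, 'b) module \<Rightarrow> ('a \<Rightarrow> 'b) set" where
  "alg_iso A B =
     {h \<in> ring_iso A B. \<forall>c. \<forall>a\<in>carrier A. h (c \<odot>\<^bsub>A\<^esub> a) = c \<odot>\<^bsub>B\<^esub> h a}"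

definition comm :: "'a::ring \<Rightarrow> 'a \<Rightarrow> 'a" where
  "comm a b = a * b - b * a"


section \<open>The affine Yangian of \<open>gl\<^sub>1\<close> specialised at \<open>h\<^sub>0\<close>\<close>

datatype ygen = E nat | F nat | Psi nat

abbreviation y_e :: "nat \<Rightarrow> ygen ncpoly" where "y_e j \<equiv> gen (E j)"
abbreviation y_f :: "nat \<Rightarrow> ygen ncpoly" where "y_f j \<equiv> gen (F j)"
abbreviation y_psi :: "nat \<Rightarrow> ygen ncpoly" where "y_psi j \<equiv> gen (Psi j)"

definition cubic_rel ::
  "complex \<Rightarrow> (nat \<Rightarrow> 'g ncpoly) \<Rightarrow> (nat \<Rightarrow> 'g ncpoly) \<Rightarrow> nat \<Rightarrow> nat \<Rightarrow> 'g ncpoly" where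
  "cubic_rel h0 a b i j =
     comm (a (i + 3)) (b j) - 3 * comm (a (i + 2)) (b (j + 1))
     + 3 * comm (a (i + 1)) (b (j + 2)) - comm (a i) (b (j + 3))
     - const (h0\<^sup>2) * (comm (a (i + 1)) (b j) - comm (a i) (b (j + 1)))"

definition serre_rel :: "(nat \<Rightarrow> 'g ncpoly) \<Rightarrow> nat \<Rightarrow> nat \<Rightarrow> nat \<Rightarrow> 'g ncpoly" where
  "serre_rel a i\<^sub>1 i\<^sub>2 i\<^sub>3 =
     (let t = (\<lambda>i j k. comm (a i) (comm (a j) (a (k + 1))))
      in t i\<^sub>1 i\<^sub>2 i\<^sub>3 + t i\<^sub>1 i\<^sub>3 i\<^sub>2 + t i\<^sub>2 i\<^sub>1 i\<^sub>3 + t i\<^sub>2 i\<^sub>3 i\<^sub>1 + t i\<^sub>3 i\<^sub>1 i\<^sub>2 + t i\<^sub>3 i\<^sub>2 i\<^sub>1)"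

definition yangian_rels :: "complex \<Rightarrow> ygen ncpoly set" where
  "yangian_rels h0 =
     {comm (y_psi i) (y_psi j) | i j. True}
   \<union> {comm (y_e i) (y_f j) - y_psi (i + j) | i j. True}
   \<union> {cubic_rel h0 y_e y_e i j | i j. True}
   \<union> {cubic_rel h0 y_f y_f i j | i j. True}
   \<union> {cubic_rel h0 y_psi y_e i j | i j. True}
   \<union> {cubic_rel h0 y_psi y_f i j | i j. True}
   \<union> {comm (y_psi 0) (y_e j) | j. True}
   \<union> {comm (y_psi 1) (y_e j) | j. True}
   \<union> {comm (y_psi 2) (y_e j) - const (2 * h0\<^sup>2) * y_e j | j. True}
   \<union> {comm (y_psi 0) (y_f j) | j. True}
   \<union> {comm (y_psi 1) (y_f j) | j. True}
   \<union> {comm (y_psi 2) (y_f j) + const (2 * h0\<^sup>2) * y_f j | j. True}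
   \<union> {serre_rel y_e i\<^sub>1 i\<^sub>2 i\<^sub>3 | i\<^sub>1 i\<^sub>2 i\<^sub>3. True}
   \<union> {serre_rel y_f i\<^sub>1 i\<^sub>2 i\<^sub>3 | i\<^sub>1 i\<^sub>2 i\<^sub>3. True}"

definition yangian :: "complex \<Rightarrow> (complex, ygen ncpoly set) module" where
  "yangian h0 = pres_alg UNIV (yangian_rels h0)"

definition yangian_class :: "complex \<Rightarrow> ygen ncpoly \<Rightarrow> ygen ncpoly set" where
  "yangian_class h0 = pres_class UNIV (yangian_rels h0)"


section \<open>The algebra of difference operators\<close>

datatype dgen = X | Del | DelInv

abbreviation d_x :: "dgen ncpoly" where "d_x \<equiv> gen X"
abbreviation d_del :: "dgen ncpoly" where "d_del \<equiv> gen Del"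
abbreviation d_delinv :: "dgen ncpoly" where "d_delinv \<equiv> gen DelInv"

definition diff_rels :: "complex \<Rightarrow> dgen ncpoly set" where
  "diff_rels h0 =
     {d_del * d_delinv - 1, d_delinv * d_del - 1, d_del * d_x - (d_x + const h0) * d_del}"

definition diff_alg :: "complex \<Rightarrow> (complex, dgen ncpoly set) module" where
  "diff_alg h0 = pres_alg UNIV (diff_rels h0)"

definition diff_class :: "complex \<Rightarrow> dgen ncpoly \<Rightarrow> dgen ncpoly set" where
  "diff_class h0 = pres_class UNIV (diff_rels h0)"

definition poly_del :: "complex poly \<Rightarrow> int \<Rightarrow> dgen ncpoly"  \<comment> \<open>\<open>f(x) \<partial>\<^sup>r\<close>\<close> where
  "poly_del f r = (\<Sum>k\<le>degree f. const (coeff f k) * d_x ^ k) *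
     (if 0 \<le> r then d_del ^ nat r else d_delinv ^ nat (- r))"

definition cocycle_value ::
  "complex \<Rightarrow> complex poly \<Rightarrow> int \<Rightarrow> complex poly \<Rightarrow> int \<Rightarrow> complex" where
  "cocycle_value h0 f r g s =
     (if r = s \<and> s > 0 then
        \<Sum>l = -r .. -1. poly f (of_int l * h0) * poly g (of_int (l + r) * h0)
      else if r = s \<and> s < 0 then
        - (\<Sum>l = r .. -1. poly g (of_int l * h0) * poly f (of_int (l - r) * h0))
      else 0)"

definition is_diff_cocycle ::
  "complex \<Rightarrow> (dgen ncpoly set \<Rightarrow> dgen ncpoly set \<Rightarrow> complex) \<Rightarrow> bool" where
  "is_diff_cocycle h0 \<phi> \<longleftrightarrow>
     (let D = diff_alg h0 in
       (\<forall>a\<in>carrier D. \<forall>b\<in>carrier D. \<forall>c\<in>carrier D.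
          \<phi> (a \<oplus>\<^bsub>D\<^esub> b) c = \<phi> a c + \<phi> b c \<and> \<phi> c (a \<oplus>\<^bsub>D\<^esub> b) = \<phi> c a + \<phi> c b) \<and>
       (\<forall>z. \<forall>a\<in>carrier D. \<forall>b\<in>carrier D.
          \<phi> (z \<odot>\<^bsub>D\<^esub> a) b = z * \<phi> a b \<and> \<phi> a (z \<odot>\<^bsub>D\<^esub> b) = z * \<phi> a b) \<and>
       (\<forall>f g r s.
          \<phi> (diff_class h0 (poly_del f r)) (diff_class h0 (poly_del g (- s)))
            = cocycle_value h0 f r g s))"

text \<open>
  The elements \<open>f(x) \<partial>\<^sup>r\<close> span the algebra, so a bilinear form with the prescribed values is
  unique on the carrier. Lemma \<open>is_diff_cocycle_diff_cocycle\<close> below shows that it exists.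
\<close>

definition diff_cocycle ::
  "complex \<Rightarrow> dgen ncpoly set \<Rightarrow> dgen ncpoly set \<Rightarrow> complex" where
  "diff_cocycle h0 = (SOME \<phi>. is_diff_cocycle h0 \<phi>)"


section \<open>Lie algebras, the central extension and the universal enveloping algebra\<close>

record 'a lie_algebra = "'a partial_object" +
  lie_add :: "'a \<Rightarrow> 'a \<Rightarrow> 'a"
  lie_smult :: "complex \<Rightarrow> 'a \<Rightarrow> 'a"
  lie_bracket :: "'a \<Rightarrow> 'a \<Rightarrow> 'a"

text \<open>The pair \<open>(a, z)\<close> stands for \<open>a + z c\<close> with \<open>c\<close> the central element.\<close>

definition diff_lie :: "complex \<Rightarrow> (dgen ncpoly set \<times> complex) lie_algebra" where
  "diff_lie h0 = (let D = diff_alg h0 in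
    \<lparr>carrier = carrier D \<times> UNIV,
     lie_add = (\<lambda>(a, z) (b, w). (a \<oplus>\<^bsub>D\<^esub> b, z + w)),
     lie_smult = (\<lambda>c (a, z). (c \<odot>\<^bsub>D\<^esub> a, c * z)),
     lie_bracket = (\<lambda>(a, z) (b, w).
       ((a \<otimes>\<^bsub>D\<^esub> b) \<ominus>\<^bsub>D\<^esub> (b \<otimes>\<^bsub>D\<^esub> a), diff_cocycle h0 a b))\<rparr>)"

text \<open>
  Imposing linearity of \<open>gen\<close> on the free algebra over the underlying set of a Lie algebra gives
  its tensor algebra; the last family of relations is the usual one.
\<close>

definition env_rels :: "'a lie_algebra \<Rightarrow> 'a ncpoly set" where
  "env_rels L =
     {gen (lie_add L a b) - (gen a + gen b) | a b. a \<in> carrier L \<and> b \<in> carrier L}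
   \<union> {gen (lie_smult L c a) - const c * gen a | c a. a \<in> carrier L}
   \<union> {comm (gen a) (gen b) - gen (lie_bracket L a b) | a b. a \<in> carrier L \<and> b \<in> carrier L}"

definition env_alg :: "'a lie_algebra \<Rightarrow> (complex, 'a ncpoly set) module" where
  "env_alg L = pres_alg (carrier L) (env_rels L)"

definition env_incl :: "'a lie_algebra \<Rightarrow> 'a \<Rightarrow> 'a ncpoly set" where
  "env_incl L a = pres_class (carrier L) (env_rels L) (gen a)"


section \<open>Existence of the bilinear form defining the cocycle\<close>

text \<open>
  The free algebra acts on functions from the integers to polynomials, the value at \<open>r\<close> being the
  coefficient of \<open>\<partial>\<^sup>r\<close>, by the rules for left multiplication by \<open>x\<close> and \<open>\<partial>\<^sup>\<plusminus>\<^sup>1\<close>. Applying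
  an operator to \<open>1\<close> reads off its normal form, which depends only on its class modulo the relations.
\<close>


lemma pm_induct [case_names single add]:
  fixes p :: "'g ncpoly"
  assumes "\<And>w c. P (Poly_Mapping.single w c)" "\<And>p q. P p \<Longrightarrow> P q \<Longrightarrow> P (p + q)"
  shows "P p"
proof (induct p rule: update_induct)
  case const
  then show ?case using assms(1)[of 0 0] by simp
next
  case (update f a b)
  have "Poly_Mapping.update a b f = f + Poly_Mapping.single a b"
    using update(1) by (intro poly_mapping_eqI)
      (auto simp: lookup_add lookup_single Poly_Mapping.lookup_update when_def in_keys_iff)
  then show ?case using update assms by simp
qed

fun act_letter :: "complex \<Rightarrow> dgen \<Rightarrow> (int \<Rightarrow> complex poly) \<Rightarrow> int \<Rightarrow> complex poly" where
  "act_letter h0 X v = (\<lambda>r. [:0, 1:] * v r)"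
| "act_letter h0 Del v = (\<lambda>r. pcompose (v (r - 1)) [:h0, 1:])"
| "act_letter h0 DelInv v = (\<lambda>r. pcompose (v (r + 1)) [:- h0, 1:])"

definition act_word :: "complex \<Rightarrow> dgen word \<Rightarrow> (int \<Rightarrow> complex poly) \<Rightarrow> int \<Rightarrow> complex poly" where
  "act_word h0 w v = foldr (act_letter h0) (letters w) v"

definition act :: "complex \<Rightarrow> dgen ncpoly \<Rightarrow> (int \<Rightarrow> complex poly) \<Rightarrow> int \<Rightarrow> complex poly" where
  "act h0 p v r = (\<Sum>w\<in>Poly_Mapping.keys p. Polynomial.smult (Poly_Mapping.lookup p w) (act_word h0 w v r))"

lemma act_letter_lin:
  "act_letter h0 g (\<lambda>r. u r + v r) = (\<lambda>r. act_letter h0 g u r + act_letter h0 g v r)"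
  "act_letter h0 g (\<lambda>r. Polynomial.smult c (u r)) = (\<lambda>r. Polynomial.smult c (act_letter h0 g u r))"
  by (cases g; simp add: fun_eq_iff algebra_simps pcompose_add pcompose_smult)+

lemma act_word_lin:
  "act_word h0 w (\<lambda>r. u r + v r) = (\<lambda>r. act_word h0 w u r + act_word h0 w v r)"
  "act_word h0 w (\<lambda>r. Polynomial.smult c (u r)) = (\<lambda>r. Polynomial.smult c (act_word h0 w u r))"
proof -
  have "foldr (act_letter h0) xs (\<lambda>r. u r + v r) =
     (\<lambda>r. foldr (act_letter h0) xs u r + foldr (act_letter h0) xs v r)" for xs
    by (induct xs) (simp_all add: act_letter_lin)
  then show "act_word h0 w (\<lambda>r. u r + v r) = (\<lambda>r. act_word h0 w u r + act_word h0 w v r)"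
    by (simp add: act_word_def)
  have "foldr (act_letter h0) xs (\<lambda>r. Polynomial.smult c (u r)) =
     (\<lambda>r. Polynomial.smult c (foldr (act_letter h0) xs u r))" for xs
    by (induct xs) (simp_all add: act_letter_lin)
  then show "act_word h0 w (\<lambda>r. Polynomial.smult c (u r)) = (\<lambda>r. Polynomial.smult c (act_word h0 w u r))"
    by (simp add: act_word_def)
qed

lemma act_superset:
  assumes "finite S" "Poly_Mapping.keys p \<subseteq> S"
  shows "act h0 p v r = (\<Sum>w\<in>S. Polynomial.smult (Poly_Mapping.lookup p w) (act_word h0 w v r))"
  unfolding act_def using assms by (intro sum.mono_neutral_left) (auto simp: in_keys_iff)

lemma act_add: "act h0 (p + q) v = (\<lambda>r. act h0 p v r + act h0 q v r)"
proof
  fix r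
  let ?S = "Poly_Mapping.keys p \<union> Poly_Mapping.keys q"
  have S: "finite ?S" "Poly_Mapping.keys (p + q) \<subseteq> ?S" "Poly_Mapping.keys p \<subseteq> ?S" "Poly_Mapping.keys q \<subseteq> ?S"
    using Poly_Mapping.keys_add[of p q] by auto
  show "act h0 (p + q) v r = act h0 p v r + act h0 q v r"
    by (simp add: act_superset[OF S(1,2)] act_superset[OF S(1,3)] act_superset[OF S(1,4)]
        lookup_add smult_add_left sum.distrib)
qed

lemma act_single: "act h0 (Poly_Mapping.single w c) v = (\<lambda>r. Polynomial.smult c (act_word h0 w v r))"
  by (simp add: act_def fun_eq_iff)

lemma act_zero: "act h0 0 v = (\<lambda>_. 0)"
  by (simp add: act_def fun_eq_iff)

lemma act_uminus: "act h0 (- p) v = (\<lambda>r. - act h0 p v r)"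
  using act_add[of h0 p "-p" v] by (auto simp: act_zero fun_eq_iff eq_neg_iff_add_eq_0 add.commute)

lemma act_diff: "act h0 (p - q) v = (\<lambda>r. act h0 p v r - act h0 q v r)"
  using act_add[of h0 p "-q" v] by (simp add: act_uminus)

lemma smult_sum_right: "Polynomial.smult c (sum f S) = (\<Sum>x\<in>S. Polynomial.smult c (f x))"
  by (induct S rule: infinite_finite_induct) (auto simp: smult_add_right)

lemma act_lin:
  "act h0 p (\<lambda>r. u r + v r) = (\<lambda>r. act h0 p u r + act h0 p v r)"
  "act h0 p (\<lambda>r. Polynomial.smult c (u r)) = (\<lambda>r. Polynomial.smult c (act h0 p u r))"
  by (simp_all add: act_def act_word_lin fun_eq_iff smult_add_right sum.distrib smult_sum_right mult.commute)

lemma act_lin0: "act h0 p (\<lambda>r. 0) = (\<lambda>r. 0)"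
  using act_lin(2)[of h0 p 0 "\<lambda>r. 0"] by simp

lemma act_mult: "act h0 (p * q) v = act h0 p (act h0 q v)"
proof (induct p rule: pm_induct)
  case (single w c)
  show ?case
  proof (induct q rule: pm_induct)
    case (single w' c')
    show ?case
      by (simp add: mult_single act_single act_word_lin act_word_def plus_word_def)
  next
    case (add p q)
    then show ?case by (simp add: distrib_left act_add act_lin)
  qed
next
  case (add p q)
  then show ?case by (simp add: distrib_right act_add)
qed

lemma act_const: "act h0 (const c) v = (\<lambda>r. Polynomial.smult c (v r))"
  by (simp add: const_def act_single act_word_def zero_word_def)

lemma act_one: "act h0 1 v = v"
  using act_const[of h0 1 v] by (simp add: const_def)

lemma act_gen: "act h0 (gen g) v = act_letter h0 g v"
  by (simp add: gen_def act_single act_word_def)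

lemma act_rels: "p \<in> diff_rels h0 \<Longrightarrow> act h0 p v = (\<lambda>_. 0)"
  unfolding diff_rels_def
  by (auto simp del: diff_eq_eq eq_diff_eq simp: act_diff act_add act_mult act_gen act_const act_one fun_eq_iff
      pcompose_assoc[symmetric] pcompose_pCons pcompose_mult) (simp_all add: algebra_simps)?

lemma free_alg_simps [simp]:
  "carrier (free_alg UNIV) = UNIV"
  "x \<otimes>\<^bsub>free_alg S\<^esub> y = x * y" "x \<oplus>\<^bsub>free_alg S\<^esub> y = x + y"
  "\<one>\<^bsub>free_alg S\<^esub> = 1" "\<zero>\<^bsub>free_alg S\<^esub> = 0" "c \<odot>\<^bsub>free_alg S\<^esub> x = const c * x"
  by (simp_all add: free_alg_def)

lemma carrier_free_alg:
  "p \<in> carrier (free_alg S) \<longleftrightarrow> (\<forall>w\<in>Poly_Mapping.keys p. set (letters w) \<subseteq> S)"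
  by (simp add: free_alg_def)

lemma ring_free_alg: "ring (free_alg S)"
proof (rule ringI)
  show "abelian_group (free_alg S)"
  proof (rule abelian_groupI)
    fix x y assume "x \<in> carrier (free_alg S)" "y \<in> carrier (free_alg S)"
    then show "x \<oplus>\<^bsub>free_alg S\<^esub> y \<in> carrier (free_alg S)"
      using Poly_Mapping.keys_add[of x y] by (auto simp: carrier_free_alg)
  next
    fix x assume "x \<in> carrier (free_alg S)"
    then show "\<exists>y\<in>carrier (free_alg S). y \<oplus>\<^bsub>free_alg S\<^esub> x = \<zero>\<^bsub>free_alg S\<^esub>"
      by (intro bexI[of _ "- x"]) (auto simp: carrier_free_alg)
  qed (auto simp: carrier_free_alg algebra_simps)
  show "Group.monoid (free_alg S)"
  proof (rule monoidI)
    fix x y assume xy: "x \<in> carrier (free_alg S)" "y \<in> carrier (free_alg S)"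
    show "x \<otimes>\<^bsub>free_alg S\<^esub> y \<in> carrier (free_alg S)"
      using xy keys_mult[of x y] by (fastforce simp: carrier_free_alg plus_word_def)
  qed (auto simp: carrier_free_alg zero_word_def algebra_simps)
qed (simp_all add: algebra_simps)

lemma diff_ideal_act:
  assumes "p \<in> Idl\<^bsub>free_alg UNIV\<^esub> (diff_rels h0)"
  shows "act h0 p v = (\<lambda>_. 0)"
proof -
  interpret R: ring "free_alg UNIV :: (complex, dgen ncpoly) module" by (rule ring_free_alg)
  let ?K = "{p. \<forall>v. act h0 p v = (\<lambda>_. 0)}"
  have inv: "inv\<^bsub>add_monoid (free_alg UNIV)\<^esub> x = - x" for x :: "dgen ncpoly"
    using R.minus_equality[of "- x" x] by (simp add: a_inv_def)
  have "subgroup ?K (add_monoid (free_alg UNIV))"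
  proof (rule subgroup.intro)
    fix x assume "x \<in> ?K"
    then show "inv\<^bsub>add_monoid (free_alg UNIV)\<^esub> x \<in> ?K"
      unfolding inv by (simp add: act_uminus)
  qed (simp_all add: act_add act_zero)
  then have "ideal ?K (free_alg UNIV)"
    by (rule idealI[OF R.ring_axioms]) (simp_all add: act_mult act_lin0)
  moreover have "diff_rels h0 \<subseteq> ?K" using act_rels by auto
  ultimately have "Idl\<^bsub>free_alg UNIV\<^esub> (diff_rels h0) \<subseteq> ?K"
    by (rule R.genideal_minimal)
  then show ?thesis using assms by auto
qed

definition vac :: "int \<Rightarrow> complex poly" where "vac r = (if r = 0 then 1 else 0)"

definition nf :: "complex \<Rightarrow> dgen ncpoly set \<Rightarrow> int \<Rightarrow> complex poly" where
  "nf h0 A = act h0 (SOME p. p \<in> A) vac"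

lemma diff_ideal: "ideal (Idl\<^bsub>free_alg UNIV\<^esub> (diff_rels h0)) (free_alg UNIV)"
  by (rule ring.genideal_ideal[OF ring_free_alg]) simp

lemma diff_class_eq:
  "diff_class h0 p = {i + p | i. i \<in> Idl\<^bsub>free_alg UNIV\<^esub> (diff_rels h0)}"
  by (auto simp: diff_class_def pres_class_def a_r_coset_def' )

lemma nf_class: "nf h0 (diff_class h0 p) = act h0 p vac"
proof -
  have "p \<in> diff_class h0 p"
    using additive_subgroup.zero_closed[OF ideal.axioms(1)[OF diff_ideal[of h0]]]
    by (auto simp: diff_class_eq intro!: exI[of _ 0])
  then have "(SOME q. q \<in> diff_class h0 p) \<in> diff_class h0 p" by (rule someI)
  then obtain i where i0: "i \<in> Idl\<^bsub>free_alg UNIV\<^esub> (diff_rels h0)"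
    and i: "(SOME q. q \<in> diff_class h0 p) = i + p"
    unfolding diff_class_eq[of h0 p] by blast
  then show ?thesis
    unfolding nf_def i act_add diff_ideal_act[OF i0] by simp
qed

lemma quot_alg_sel:
  "carrier (quot_alg A I) = a_rcosets\<^bsub>A\<^esub> I"
  "x \<oplus>\<^bsub>quot_alg A I\<^esub> y = x <+>\<^bsub>A\<^esub> y"
  "c \<odot>\<^bsub>quot_alg A I\<^esub> x = (\<Union>a\<in>x. I +>\<^bsub>A\<^esub> (c \<odot>\<^bsub>A\<^esub> a))"
  by (simp_all add: quot_alg_def ring.extend_def module.fields_def FactRing_def)

lemma carrier_diff: "a \<in> carrier (diff_alg h0) \<longleftrightarrow> (\<exists>p. a = diff_class h0 p)"
  by (auto simp: diff_alg_def pres_alg_def quot_alg_sel A_RCOSETS_def' diff_class_def pres_class_def)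

lemma add_diff: "diff_class h0 p \<oplus>\<^bsub>diff_alg h0\<^esub> diff_class h0 q = diff_class h0 (p + q)"
proof -
  interpret I: ideal "Idl\<^bsub>free_alg UNIV\<^esub> (diff_rels h0)" "free_alg UNIV" by (rule diff_ideal)
  show ?thesis
    using I.a_rcos_sum[of p q]
    by (simp add: diff_alg_def pres_alg_def quot_alg_sel diff_class_def pres_class_def)
qed

lemma smult_diff: "c \<odot>\<^bsub>diff_alg h0\<^esub> diff_class h0 p = diff_class h0 (const c * p)"
proof -
  let ?I = "Idl\<^bsub>free_alg UNIV\<^esub> (diff_rels h0)"
  interpret I: ideal ?I "free_alg UNIV" by (rule diff_ideal)
  have *: "diff_class h0 (const c * (i + p)) = diff_class h0 (const c * p)" if "i \<in> ?I" for i
  proof -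
    have "const c * i \<in> ?I" using I.I_l_closed[OF that, of "const c"] by simp
    then have "const c * (i + p) \<in> diff_class h0 (const c * p)"
      by (auto simp: diff_class_eq distrib_left)
    then show ?thesis
      unfolding diff_class_def pres_class_def by (intro I.a_repr_independence'[symmetric]) simp_all
  qed
  have ne: "diff_class h0 p \<noteq> {}"
    unfolding diff_class_eq using I.a_subgroup subgroup.one_closed by blast
  have "\<forall>a\<in>diff_class h0 p. diff_class h0 (const c * a) = diff_class h0 (const c * p)"
    using * by (subst diff_class_eq) blast
  then have "(\<Union>a\<in>diff_class h0 p. diff_class h0 (const c * a)) = diff_class h0 (const c * p)"
    using ne by (simp cong: SUP_cong)
  then show ?thesis
    by (simp add: diff_alg_def pres_alg_def quot_alg_sel diff_class_def pres_class_def)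
qed

lemma act_sum: "act h0 (\<Sum>k\<in>S. p k) v r = (\<Sum>k\<in>S. act h0 (p k) v r)"
  by (induct S rule: infinite_finite_induct) (auto simp: act_zero act_add)

lemma act_xpow: "act h0 (d_x ^ k) v = (\<lambda>r. [:0, 1:] ^ k * v r)"
  by (induct k arbitrary: v) (auto simp: act_one act_mult act_gen fun_eq_iff)

lemma act_del_pow: "act h0 (d_del ^ k) vac = (\<lambda>s. if s = int k then 1 else 0)"
  by (induct k) (auto simp: act_one act_mult act_gen fun_eq_iff vac_def pcompose_1)

lemma act_delinv_pow: "act h0 (d_delinv ^ k) vac = (\<lambda>s. if s = - int k then 1 else 0)"
  by (induct k) (auto simp: act_one act_mult act_gen fun_eq_iff vac_def pcompose_1)

lemma act_poly_del: "act h0 (poly_del f r) vac = (\<lambda>s. if s = r then f else 0)"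
proof
  fix s
  let ?d = "if 0 \<le> r then d_del ^ nat r else d_delinv ^ nat (- r)"
  have d: "act h0 ?d vac = (\<lambda>s. if s = r then 1 else 0)"
    by (auto simp: act_del_pow act_delinv_pow)
  have "act h0 (poly_del f r) vac s
     = (\<Sum>k\<le>degree f. monom (poly.coeff f k) k) * (if s = r then 1 else 0)"
    unfolding poly_del_def act_mult d
    by (simp add: act_sum act_mult act_const act_xpow sum_distrib_right monom_altdef)
  then show "act h0 (poly_del f r) vac s = (if s = r then f else 0)"
    by (simp add: poly_as_sum_of_monoms)
qed

lemma finite_nf: "finite {r. act h0 p vac r \<noteq> 0}"
proof (induct p rule: pm_induct)
  case (single w c)
  have "finite {r. foldr (act_letter h0) xs vac r \<noteq> 0}" for xs
  proof (induct xs)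
    case Nil
    then show ?case by (simp add: vac_def)
  next
    case (Cons g xs)
    let ?v = "foldr (act_letter h0) xs vac"
    have "?v r \<noteq> 0 \<or> ?v (r - 1) \<noteq> 0 \<or> ?v (r + 1) \<noteq> 0" if "act_letter h0 g ?v r \<noteq> 0" for r
      using that by (cases g) auto
    moreover have "r \<in> (\<lambda>r. r + 1) ` {r. ?v r \<noteq> 0}" if "?v (r - 1) \<noteq> 0" for r
      using that by (intro image_eqI[of _ _ "r - 1"]) auto
    moreover have "r \<in> (\<lambda>r. r - 1) ` {r. ?v r \<noteq> 0}" if "?v (r + 1) \<noteq> 0" for r
      using that by (intro image_eqI[of _ _ "r + 1"]) auto
    ultimately have "{r. act_letter h0 g ?v r \<noteq> 0} \<subseteq> {r. ?v r \<noteq> 0} \<union> (\<lambda>r. r + 1) ` {r. ?v r \<noteq> 0}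
       \<union> (\<lambda>r. r - 1) ` {r. ?v r \<noteq> 0}"
      by blast
    then show ?case using Cons by (auto intro: finite_subset)
  qed
  then have "finite {r. act_word h0 w vac r \<noteq> 0}" by (simp add: act_word_def)
  then show ?case by (auto simp: act_single)
next
  case (add p q)
  have "{r. act h0 (p + q) vac r \<noteq> 0} \<subseteq> {r. act h0 p vac r \<noteq> 0} \<union> {r. act h0 q vac r \<noteq> 0}"
    by (auto simp: act_add)
  then show ?case using add by (auto intro: finite_subset)
qed

lemma cocycle_value_lin:
  "cocycle_value h0 (f + f') r g s = cocycle_value h0 f r g s + cocycle_value h0 f' r g s"
  "cocycle_value h0 f r (g + g') s = cocycle_value h0 f r g s + cocycle_value h0 f r g' s"
  "cocycle_value h0 (Polynomial.smult z f) r g s = z * cocycle_value h0 f r g s"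
  "cocycle_value h0 f r (Polynomial.smult z g) s = z * cocycle_value h0 f r g s"
  "cocycle_value h0 0 r g s = 0" "cocycle_value h0 f r 0 s = 0"
  by (auto simp: cocycle_value_def algebra_simps sum.distrib sum_distrib_left sum_negf)

lemma is_diff_cocycle_diff_cocycle: "is_diff_cocycle h0 (diff_cocycle h0)"
proof -
  let ?n = "\<lambda>p. act h0 p vac"
  define B where "B u v = (\<Sum>r | u r \<noteq> 0. cocycle_value h0 (u r) r (v (- r)) r)"
    for u v :: "int \<Rightarrow> complex poly"
  have B: "B (?n p) v = (\<Sum>r\<in>S. cocycle_value h0 (?n p r) r (v (- r)) r)"
    if "finite S" "{r. ?n p r \<noteq> 0} \<subseteq> S" for p v S
    unfolding B_def using that by (intro sum.mono_neutral_left) (auto simp: cocycle_value_lin)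
  have B_lin: "B (?n (p + q)) v = B (?n p) v + B (?n q) v"
    "B (?n (const z * p)) v = z * B (?n p) v" for p q v z
  proof -
    let ?S = "{r. ?n p r \<noteq> 0} \<union> {r. ?n q r \<noteq> 0}"
    have S: "finite ?S" by (simp add: finite_nf)
    show "B (?n (p + q)) v = B (?n p) v + B (?n q) v"
      by (subst (1 2 3) B[OF S]) (auto simp: act_add cocycle_value_lin sum.distrib)
    show "B (?n (const z * p)) v = z * B (?n p) v"
      by (subst (1 2) B[OF S])
        (auto simp: act_mult act_const cocycle_value_lin sum_distrib_left)
  qed
  have B_lin': "B u (?n (p + q)) = B u (?n p) + B u (?n q)"
    "B u (?n (const z * p)) = z * B u (?n p)" for p q u z
    by (simp_all add: B_def act_add act_mult act_const cocycle_value_lin sum.distrib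
        sum_distrib_left)
  have val: "B (?n (poly_del f r)) (?n (poly_del g (- s))) = cocycle_value h0 f r g s" for f g r s
  proof -
    have "B (?n (poly_del f r)) (?n (poly_del g (- s))) =
      (\<Sum>t\<in>{r}. cocycle_value h0 (?n (poly_del f r) t) t (?n (poly_del g (- s)) (- t)) t)"
      by (rule B) (auto simp: act_poly_del split: if_splits)
    then show ?thesis
      by (auto simp: act_poly_del cocycle_value_lin) (auto simp: cocycle_value_def)
  qed
  have "is_diff_cocycle h0 (\<lambda>a b. B (nf h0 a) (nf h0 b))"
    unfolding is_diff_cocycle_def Let_def
    by (auto simp: carrier_diff add_diff smult_diff nf_class B_lin B_lin' val)
  then show ?thesis unfolding diff_cocycle_def by (rule someI[where P = "is_diff_cocycle h0"])
qed

end

theory Submission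
  imports Defs
begin

text \<open>
  Both algebras are given by generators and relations, so an isomorphism amounts to maps of generators
  in both directions that respect the relations and are mutually inverse on generators. In one direction
  the relations of the Yangian have to be checked for \<open>x\<^sup>j \<partial>\<close>, \<open>- \<partial>\<^sup>-\<^sup>1 x\<^sup>j\<close> and
  \<open>(x - h\<^sub>0)\<^sup>j - x\<^sup>j - (- h\<^sub>0)\<^sup>j c\<close>; brackets of such elements are explicit, and each relation becomes an
  identity between polynomials (\<open>yangian_rels_hold\<close>).

  The other direction is the substance. One needs elements \<open>H r f\<close> of the Yangian that stand for
  \<open>f(x) \<partial>\<^sup>r\<close> and satisfy the bracket relations of the centrally extended Lie algebra. For \<open>r > 0\<close> they are
  defined by a recursion on \<open>r\<close> out of brackets with the \<open>e\<^sub>j\<close>, and the point is to prove the rule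
  \<open>[p \<partial>, q \<partial>\<^sup>r] = (p(x) q(x + h) - q(x) p(x + r h)) \<partial>\<^sup>r\<^sup>+\<^sup>1\<close> (\<open>bracket_e_W\<close>). Extend the left side bilinearly
  to polynomials \<open>K(x, y)\<close>. The rule says that the extension vanishes on every \<open>K\<close> with the same values at
  \<open>(x, x + h)\<close> and \<open>(x + r h, x)\<close>. With \<open>u = x - y\<close>, such \<open>K\<close> are sums of a multiple of
  \<open>(u + h) (u - r h)\<close> and a polynomial in \<open>x + r y\<close> (\<open>bracket_ruleI\<close>).

  The relations provide these \<open>K\<close> as follows. For \<open>r = 1\<close> antisymmetry gives the symmetric ones, and the
  cubic relation the multiples of \<open>u (u\<^sup>2 - h\<^sup>2)\<close>. For \<open>r = 2\<close> the Serre relations give exactly the functions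
  \<open>S(x, y, y + h)\<close> with \<open>S\<close> symmetric in three variables. For \<open>r \<ge> 3\<close> the Jacobi identity for two \<open>e\<close>'s and
  degree \<open>r - 1\<close>, together with the rules in lower degree, gives two families of multiples of
  \<open>(u + h) (u - r h)\<close>, with cofactors \<open>u (u - h)\<close> and \<open>(u - (r - 1) h) (u - (r - 2) h)\<close>. These are coprime for
  \<open>r \<ge> 4\<close>. For \<open>r = 3\<close> they share the root \<open>u = h\<close>, and the antisymmetry of the bracket in degree two
  supplies what is missing.

  The \<open>f\<^sub>j\<close> satisfy the same relations, and the same argument with \<open>- h\<^sub>0\<close> in place of \<open>h\<^sub>0\<close> applies to
  them. Degree zero consists of the \<open>\<psi>\<^sub>j\<close>, whose action on the \<open>e\<^sub>j\<close> and \<open>f\<^sub>j\<close> is a recursion contained in the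
  relations. All remaining brackets follow from these by the Jacobi identity (\<open>rule_holds_all\<close>). This uses
  the Jacobi identity of the extended Lie algebra as well, hence the cocycle property of the central term,
  which is evident once the cocycle is written as a trace (\<open>coc_trace\<close>, \<open>coc_cyclic\<close>).
\<close>

section \<open>Maps out of the free algebra\<close>

lemma const_hom:
  "const 0 = 0" "const 1 = 1" "const (a + b) = const a + const b"
  "const (a * b) = const a * const b" "const (- a) = - const a"
  "const (a - b) = const a - const b"
  by (simp_all add: const_def single_add mult_single single_uminus single_diff)

lemma const_mult_commute: "const c * p = p * const c"
  by (induct p rule: pm_induct)
    (simp_all add: const_def mult_single distrib_left distrib_right mult.commute plus_word_def zero_word_def)

lemma const_numeral: "const (numeral n) = numeral n"
proof -
  have "const (of_nat m) = of_nat m" for m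
    by (induct m) (simp_all add: const_hom)
  from this[of "numeral n"] show ?thesis by simp
qed

lemma comm_linear:
  fixes a b c :: "'g ncpoly"
  shows "comm (a + b) c = comm a c + comm b c" "comm c (a + b) = comm c a + comm c b"
  "comm (a - b) c = comm a c - comm b c" "comm c (a - b) = comm c a - comm c b"
  "comm (- a) c = - comm a c" "comm c (- a) = - comm c a"
  "comm (const k * a) c = const k * comm a c" "comm c (const k * a) = const k * comm c a"
  "comm 0 c = 0" "comm c 0 = 0" "comm a a = 0"
proof -
  show "comm c (const k * a) = const k * comm c a"
    by (simp add: comm_def algebra_simps) (metis const_mult_commute mult.assoc)
  show "comm (const k * a) c = const k * comm a c"
    by (simp add: comm_def algebra_simps) (metis const_mult_commute mult.assoc)
qed (simp_all add: comm_def algebra_simps)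

lemma comm_const: "comm (const k) a = 0" "comm a (const k) = 0"
  by (simp_all add: comm_def const_mult_commute)

lemma comm_swap: "comm b a = - comm a b" for a b :: "'a::ring"
  by (simp add: comm_def)

lemma comm_jacobi: "comm (comm a b) c = comm a (comm b c) - comm b (comm a c)" for a b c :: "'a::ring"
  by (simp add: comm_def algebra_simps)

lemma single_word_Cons: "Poly_Mapping.single (Word (g # gs)) c = gen g * Poly_Mapping.single (Word gs) c"
  by (simp add: gen_def mult_single plus_word_def)

lemma single_word_Nil: "Poly_Mapping.single (Word []) c = const c"
  by (simp add: const_def zero_word_def)

lemma free_alg_induct [consumes 1, case_names const gen add mult]:
  assumes p: "p \<in> carrier (free_alg S)"
    and c: "\<And>c. P (const c)" and g: "\<And>g. g \<in> S \<Longrightarrow> P (gen g)"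
    and a: "\<And>p q. P p \<Longrightarrow> P q \<Longrightarrow> P (p + q)"
    and m: "\<And>p q. P p \<Longrightarrow> P q \<Longrightarrow> P (p * q)"
  shows "P p"
proof -
  have word: "P (Poly_Mapping.single (Word gs) c)" if "set gs \<subseteq> S" for gs c
    using that by (induct gs) (auto simp: single_word_Nil single_word_Cons intro: c g m)
  have "P (\<Sum>w\<in>A. Poly_Mapping.single w (Poly_Mapping.lookup p w))" if "A \<subseteq> Poly_Mapping.keys p" for A
    using finite_subset[OF that finite_keys] that
  proof (induct A)
    case empty
    then show ?case using c[of 0] by (simp add: const_hom)
  next
    case (insert w A)
    have "P (Poly_Mapping.single w (Poly_Mapping.lookup p w))"
      using insert(4) p word[of "letters w"] by (auto simp: carrier_free_alg)
    then show ?case using insert by (auto intro: a)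
  qed
  moreover have "(\<Sum>w\<in>Poly_Mapping.keys p. Poly_Mapping.single w (Poly_Mapping.lookup p w)) = p"
    by (rule poly_mapping_eqI)
      (auto simp: lookup_sum lookup_single when_def in_keys_iff sum.delta[OF finite_keys])
  ultimately show ?thesis by (metis order_refl)
qed

lemma const_closed: "const c \<in> carrier (free_alg S)"
  by (auto simp: carrier_free_alg const_def zero_word_def)

lemma gen_closed: "g \<in> S \<Longrightarrow> gen g \<in> carrier (free_alg S)"
  by (auto simp: carrier_free_alg gen_def)

definition subst_word :: "('g \<Rightarrow> 'k ncpoly) \<Rightarrow> 'g word \<Rightarrow> 'k ncpoly" where
  "subst_word \<phi> w = prod_list (map \<phi> (letters w))"

definition subst :: "('g \<Rightarrow> 'k ncpoly) \<Rightarrow> 'g ncpoly \<Rightarrow> 'k ncpoly" where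
  "subst \<phi> p = (\<Sum>w\<in>Poly_Mapping.keys p. const (Poly_Mapping.lookup p w) * subst_word \<phi> w)"

lemma subst_superset:
  assumes "finite A" "Poly_Mapping.keys p \<subseteq> A"
  shows "subst \<phi> p = (\<Sum>w\<in>A. const (Poly_Mapping.lookup p w) * subst_word \<phi> w)"
  unfolding subst_def using assms by (intro sum.mono_neutral_left) (auto simp: in_keys_iff const_hom)

lemma subst_add: "subst \<phi> (p + q) = subst \<phi> p + subst \<phi> q"
proof -
  let ?A = "Poly_Mapping.keys p \<union> Poly_Mapping.keys q"
  have A: "finite ?A" "Poly_Mapping.keys (p + q) \<subseteq> ?A" "Poly_Mapping.keys p \<subseteq> ?A" "Poly_Mapping.keys q \<subseteq> ?A"
    using Poly_Mapping.keys_add[of p q] by auto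
  show ?thesis
    by (simp add: subst_superset[OF A(1,2)] subst_superset[OF A(1,3)] subst_superset[OF A(1,4)]
        lookup_add const_hom distrib_right sum.distrib)
qed

lemma subst_single: "subst \<phi> (Poly_Mapping.single w c) = const c * subst_word \<phi> w"
  by (simp add: subst_def const_hom)

lemma subst_mult: "subst \<phi> (p * q) = subst \<phi> p * subst \<phi> q"
proof (induct p rule: pm_induct)
  case (single w c)
  show ?case
  proof (induct q rule: pm_induct)
    case (single w' c')
    have "const c * (const c' * (subst_word \<phi> w * subst_word \<phi> w'))
        = const c * (subst_word \<phi> w * (const c' * subst_word \<phi> w'))"
      by (metis const_mult_commute mult.assoc)
    then show ?case
      by (simp add: mult_single subst_single subst_word_def plus_word_def const_hom mult.assoc)
  qed (simp add: distrib_left subst_add)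
qed (simp add: distrib_right subst_add)

lemma subst_const: "subst \<phi> (const c) = const c"
  using subst_single[of \<phi> 0 c] by (simp add: subst_word_def zero_word_def flip: const_def)
    (simp add: const_def zero_word_def)

lemma subst_gen: "subst \<phi> (gen g) = \<phi> g"
  by (simp add: gen_def subst_single subst_word_def const_hom)

lemma subst_one: "subst \<phi> 1 = 1"
  using subst_const[of \<phi> 1] by (simp add: const_hom)

lemma subst_zero: "subst \<phi> 0 = 0"
  using subst_const[of \<phi> 0] by (simp add: const_hom)

lemma subst_uminus: "subst \<phi> (- p) = - subst \<phi> p"
  using subst_add[of \<phi> p "- p"] by (simp add: subst_zero eq_neg_iff_add_eq_0 add.commute)

lemma subst_diff: "subst \<phi> (p - q) = subst \<phi> p - subst \<phi> q"
  using subst_add[of \<phi> p "- q"] by (simp add: subst_uminus)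

lemma subst_comm: "subst \<phi> (comm p q) = comm (subst \<phi> p) (subst \<phi> q)"
  by (simp add: comm_def subst_diff subst_mult)

lemma subst_numeral: "subst \<phi> (numeral n) = numeral n"
  using subst_const[of \<phi> "numeral n"] by (simp add: const_numeral)

lemmas subst_simps = subst_add subst_mult subst_const subst_gen subst_one subst_zero subst_uminus
  subst_diff subst_comm subst_numeral

lemma subst_closed:
  assumes "p \<in> carrier (free_alg S)" "\<And>g. g \<in> S \<Longrightarrow> \<phi> g \<in> carrier (free_alg S')"
  shows "subst \<phi> p \<in> carrier (free_alg S')"
proof -
  interpret A: ring "free_alg S'" by (rule ring_free_alg)
  show ?thesis
    using assms(1)
    by (induct p rule: free_alg_induct)
      (use assms(2) A.add.m_closed A.m_closed in \<open>auto simp: subst_simps const_closed\<close>)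
qed

section \<open>Ideals of relations and isomorphisms of presented algebras\<close>

text \<open>Calculations in a presented algebra are carried out as congruences between noncommutative
  polynomials, which form a ring in the sense of the type class, unlike the cosets.\<close>

locale two_sided =
  fixes I :: "'g ncpoly set"
  assumes zero: "0 \<in> I" and add: "\<And>a b. a \<in> I \<Longrightarrow> b \<in> I \<Longrightarrow> a + b \<in> I"
    and left: "\<And>a r. a \<in> I \<Longrightarrow> r * a \<in> I" and right: "\<And>a r. a \<in> I \<Longrightarrow> a * r \<in> I"
begin

definition cong (infix \<open>\<approx>\<close> 50) where "a \<approx> b \<longleftrightarrow> a - b \<in> I"

lemma uminus: "a \<in> I \<Longrightarrow> - a \<in> I"
  using left[of a "-1"] by simp

lemma diff: "a \<in> I \<Longrightarrow> b \<in> I \<Longrightarrow> a - b \<in> I"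
  using add[of a "- b"] uminus[of b] by simp

lemma cong_refl [simp]: "a \<approx> a"
  by (simp add: cong_def zero)

lemma cong_sym: "a \<approx> b \<Longrightarrow> b \<approx> a"
  unfolding cong_def using uminus by fastforce

lemma cong_trans [trans]: "a \<approx> b \<Longrightarrow> b \<approx> c \<Longrightarrow> a \<approx> c"
  unfolding cong_def using add by fastforce

lemma cong_add: "a \<approx> b \<Longrightarrow> c \<approx> d \<Longrightarrow> a + c \<approx> b + d"
  unfolding cong_def using add[of "a - b" "c - d"] by (simp add: algebra_simps)

lemma cong_diff: "a \<approx> b \<Longrightarrow> c \<approx> d \<Longrightarrow> a - c \<approx> b - d"
  unfolding cong_def using diff[of "a - b" "c - d"] by (simp add: algebra_simps)

lemma cong_uminus: "a \<approx> b \<Longrightarrow> - a \<approx> - b"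
  using cong_diff[of 0 0 a b] by simp

lemma cong_mult: "a \<approx> b \<Longrightarrow> c \<approx> d \<Longrightarrow> a * c \<approx> b * d"
  unfolding cong_def using add[OF right[of "a - b" c] left[of "c - d" b]] by (simp add: algebra_simps)

lemma cong_comm: "a \<approx> b \<Longrightarrow> c \<approx> d \<Longrightarrow> comm a c \<approx> comm b d"
  unfolding comm_def by (intro cong_diff cong_mult)

lemma cong_scale: "a \<approx> b \<Longrightarrow> const c * a \<approx> const c * b"
  by (rule cong_mult[OF cong_refl])

lemma cong_0: "a \<approx> 0 \<longleftrightarrow> a \<in> I"
  by (simp add: cong_def)

lemma cong_mem: "a \<approx> b \<Longrightarrow> a \<in> I \<longleftrightarrow> b \<in> I"
  using cong_trans cong_sym cong_0 by blast

lemma cong_sum: "(\<And>x. x \<in> A \<Longrightarrow> f x \<approx> g x) \<Longrightarrow> sum f A \<approx> sum g A"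
  by (induct A rule: infinite_finite_induct) (auto intro: cong_add)

end

lemma rels_ideal: "R \<subseteq> carrier (free_alg S) \<Longrightarrow> ideal (Idl\<^bsub>free_alg S\<^esub> R) (free_alg S)"
  by (rule ring.genideal_ideal[OF ring_free_alg])

lemma uminus_free_alg:
  assumes "x \<in> carrier (free_alg S)" shows "\<ominus>\<^bsub>free_alg S\<^esub> x = - x"
proof -
  interpret A: ring "free_alg S" by (rule ring_free_alg)
  have "- x \<in> carrier (free_alg S)" using assms by (simp add: carrier_free_alg)
  then show ?thesis using A.minus_equality[of "- x" x] assms by simp
qed

lemma ideal_free_alg_closed:
  assumes "ideal J (free_alg S)"
  shows "0 \<in> J" "a \<in> J \<Longrightarrow> b \<in> J \<Longrightarrow> a + b \<in> J" "a \<in> J \<Longrightarrow> - a \<in> J"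
    "a \<in> J \<Longrightarrow> b \<in> J \<Longrightarrow> a - b \<in> J"
    "a \<in> J \<Longrightarrow> r \<in> carrier (free_alg S) \<Longrightarrow> r * a \<in> J"
    "a \<in> J \<Longrightarrow> r \<in> carrier (free_alg S) \<Longrightarrow> a * r \<in> J"
    "a \<in> J \<Longrightarrow> a \<in> carrier (free_alg S)"
proof -
  interpret J: ideal J "free_alg S" by (rule assms)
  show z: "0 \<in> J" and a: "a \<in> J \<Longrightarrow> b \<in> J \<Longrightarrow> a + b \<in> J" for a b
    using additive_subgroup.zero_closed[OF J.additive_subgroup_axioms]
      additive_subgroup.a_closed[OF J.additive_subgroup_axioms] by simp_all
  show l: "a \<in> J \<Longrightarrow> r \<in> carrier (free_alg S) \<Longrightarrow> r * a \<in> J" for a r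
    using J.I_l_closed by simp
  show "a \<in> J \<Longrightarrow> r \<in> carrier (free_alg S) \<Longrightarrow> a * r \<in> J"
    using J.I_r_closed by simp
  have u: "- a \<in> J" if "a \<in> J" for a
    using l[OF that const_closed[of "-1"]] by (simp add: const_hom)
  then show "a \<in> J \<Longrightarrow> - a \<in> J" .
  show "a \<in> J \<Longrightarrow> b \<in> J \<Longrightarrow> a - b \<in> J" using a[of a "- b"] u[of b] by simp
  show "a \<in> J \<Longrightarrow> a \<in> carrier (free_alg S)" using J.a_subset by auto
qed

lemma two_sided_Idl: "two_sided (Idl\<^bsub>free_alg UNIV\<^esub> R)"
  using ideal_free_alg_closed[OF rels_ideal, of R UNIV] by unfold_locales auto

text \<open>The enveloping algebra is a quotient of the free algebra on the generators from a given set \<open>S\<close>.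
  Pulling its ideal back along the substitution that kills all other generators gives an ideal of the free
  algebra on all generators that agrees with the original one on the smaller algebra.\<close>

lemma two_sided_preimage:
  assumes J: "ideal J (free_alg S)" and \<phi>: "\<And>g. \<phi> g \<in> carrier (free_alg S)"
  shows "two_sided {p. subst \<phi> p \<in> J}"
proof -
  note J = ideal_free_alg_closed[OF J]
  have "subst \<phi> p \<in> carrier (free_alg S)" for p
    by (rule subst_closed[of _ UNIV]) (simp_all add: \<phi>)
  then show ?thesis by unfold_locales (auto simp: subst_simps intro: J)
qed

lemma subst_ideal:
  assumes J: "ideal J (free_alg S')" and \<phi>: "\<And>g. g \<in> S \<Longrightarrow> \<phi> g \<in> carrier (free_alg S')"
    and R: "R \<subseteq> carrier (free_alg S)" "\<And>p. p \<in> R \<Longrightarrow> subst \<phi> p \<in> J"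
    and p: "p \<in> Idl\<^bsub>free_alg S\<^esub> R"
  shows "subst \<phi> p \<in> J"
proof -
  interpret A: ring "free_alg S" by (rule ring_free_alg)
  note J = ideal_free_alg_closed[OF J]
  let ?K = "{p \<in> carrier (free_alg S). subst \<phi> p \<in> J}"
  have cl: "p \<in> carrier (free_alg S) \<Longrightarrow> subst \<phi> p \<in> carrier (free_alg S')" for p
    using subst_closed \<phi> by blast
  have inv: "inv\<^bsub>add_monoid (free_alg S)\<^esub> x = - x" if "x \<in> carrier (free_alg S)" for x
    using uminus_free_alg[OF that] by (simp add: a_inv_def)
  have "subgroup ?K (add_monoid (free_alg S))"
  proof (rule subgroup.intro)
    fix x assume x: "x \<in> ?K"
    then show "inv\<^bsub>add_monoid (free_alg S)\<^esub> x \<in> ?K"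
      using A.a_inv_closed[of x] by (subst inv) (auto simp: uminus_free_alg subst_simps intro: J)
  next
    fix x y assume "x \<in> ?K" "y \<in> ?K"
    then show "x \<otimes>\<^bsub>add_monoid (free_alg S)\<^esub> y \<in> ?K"
      using A.a_closed[of x y] by (simp add: subst_simps J)
  qed (use A.zero_closed in \<open>auto simp: subst_simps J\<close>)
  then have "ideal ?K (free_alg S)"
  proof (rule idealI[OF A.ring_axioms])
    fix a x assume a: "a \<in> ?K" and x: "x \<in> carrier (free_alg S)"
    show "x \<otimes>\<^bsub>free_alg S\<^esub> a \<in> ?K"
      using a x A.m_closed[of x a] J(5)[OF _ cl[OF x], of "subst \<phi> a"] by (simp add: subst_simps)
    show "a \<otimes>\<^bsub>free_alg S\<^esub> x \<in> ?K"
      using a x A.m_closed[of a x] J(6)[OF _ cl[OF x], of "subst \<phi> a"] by (simp add: subst_simps)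
  qed
  then have "Idl\<^bsub>free_alg S\<^esub> R \<subseteq> ?K"
    by (rule A.genideal_minimal) (use R in auto)
  then show ?thesis using p by auto
qed

context
  fixes S :: "'g set" and R :: "'g ncpoly set"
  assumes R: "R \<subseteq> carrier (free_alg S)"
begin

interpretation I: ideal "Idl\<^bsub>free_alg S\<^esub> R" "free_alg S" by (rule rels_ideal[OF R])

lemma pres_class_eq_iff:
  assumes p: "p \<in> carrier (free_alg S)" and q: "q \<in> carrier (free_alg S)"
  shows "pres_class S R p = pres_class S R q \<longleftrightarrow> p - q \<in> Idl\<^bsub>free_alg S\<^esub> R"
  using I.quotient_eq_iff_same_a_r_cos[OF rels_ideal[OF R] p q] uminus_free_alg[OF q]
  by (simp add: pres_class_def a_minus_def)

lemma carrier_pres: "carrier (pres_alg S R) = pres_class S R ` carrier (free_alg S)"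
  by (auto simp: pres_alg_def quot_alg_sel A_RCOSETS_def' pres_class_def)

lemma pres_class_self: "p \<in> carrier (free_alg S) \<Longrightarrow> p \<in> pres_class S R p"
  unfolding pres_class_def by (rule I.a_rcos_self)

lemma pres_class_mem:
  assumes "p \<in> carrier (free_alg S)" "q \<in> pres_class S R p"
  shows "q \<in> carrier (free_alg S)" "pres_class S R q = pres_class S R p"
  using assms I.a_repr_independence'[of q p] I.a_elemrcos_carrier[of p q]
  unfolding pres_class_def by auto

lemma pres_class_ops:
  assumes p: "p \<in> carrier (free_alg S)" and q: "q \<in> carrier (free_alg S)"
  shows "pres_class S R p \<otimes>\<^bsub>pres_alg S R\<^esub> pres_class S R q = pres_class S R (p * q)"
    "pres_class S R p \<oplus>\<^bsub>pres_alg S R\<^esub> pres_class S R q = pres_class S R (p + q)"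
proof -
  show "pres_class S R p \<otimes>\<^bsub>pres_alg S R\<^esub> pres_class S R q = pres_class S R (p * q)"
    using I.rcoset_mult_add[OF p q]
    by (simp add: pres_alg_def quot_alg_def ring.extend_def module.fields_def FactRing_def pres_class_def)
  show "pres_class S R p \<oplus>\<^bsub>pres_alg S R\<^esub> pres_class S R q = pres_class S R (p + q)"
    using I.a_rcos_sum[OF p q] by (simp add: pres_alg_def quot_alg_sel pres_class_def)
qed

lemma pres_class_one: "\<one>\<^bsub>pres_alg S R\<^esub> = pres_class S R 1"
  by (simp add: pres_alg_def quot_alg_def ring.extend_def module.fields_def FactRing_def pres_class_def)

lemma pres_class_smult:
  assumes p: "p \<in> carrier (free_alg S)"
  shows "c \<odot>\<^bsub>pres_alg S R\<^esub> pres_class S R p = pres_class S R (const c * p)"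
proof -
  have "pres_class S R (const c * a) = pres_class S R (const c * p)" if a: "a \<in> pres_class S R p" for a
  proof -
    note a' = pres_class_mem[OF p a]
    then have "a - p \<in> Idl\<^bsub>free_alg S\<^esub> R" using pres_class_eq_iff[OF a'(1) p] by simp
    then have "const c * (a - p) \<in> Idl\<^bsub>free_alg S\<^esub> R"
      using ideal_free_alg_closed(5)[OF I.ideal_axioms _ const_closed] by blast
    moreover have "const c * a \<in> carrier (free_alg S)" "const c * p \<in> carrier (free_alg S)"
      using I.m_closed[OF const_closed] a' p by auto
    ultimately show ?thesis by (simp add: pres_class_eq_iff right_diff_distrib)
  qed
  then have "(\<Union>a\<in>pres_class S R p. pres_class S R (const c * a)) = pres_class S R (const c * p)"
    using pres_class_self[OF p] by (intro SUP_eq_const) blast+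
  then show "c \<odot>\<^bsub>pres_alg S R\<^esub> pres_class S R p = pres_class S R (const c * p)"
    by (simp add: pres_alg_def quot_alg_sel pres_class_def)
qed

end

text \<open>Substitutions that respect the relations induce homomorphisms of the presented algebras, and two
  homomorphisms agree as soon as they agree on generators. So bijectivity is checked by computing the two
  composites on generators.\<close>

theorem pres_alg_iso:
  assumes R: "R \<subseteq> carrier (free_alg S)" and R': "R' \<subseteq> carrier (free_alg S')"
    and \<phi>: "\<And>g. g \<in> S \<Longrightarrow> \<phi> g \<in> carrier (free_alg S')"
    and \<psi>: "\<And>k. k \<in> S' \<Longrightarrow> \<psi> k \<in> carrier (free_alg S)"
    and R\<phi>: "\<And>p. p \<in> R \<Longrightarrow> subst \<phi> p \<in> Idl\<^bsub>free_alg S'\<^esub> R'"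
    and R\<psi>: "\<And>p. p \<in> R' \<Longrightarrow> subst \<psi> p \<in> Idl\<^bsub>free_alg S\<^esub> R"
    and \<psi>\<phi>: "\<And>g. g \<in> S \<Longrightarrow> subst \<psi> (\<phi> g) - gen g \<in> Idl\<^bsub>free_alg S\<^esub> R"
    and \<phi>\<psi>: "\<And>k. k \<in> S' \<Longrightarrow> subst \<phi> (\<psi> k) - gen k \<in> Idl\<^bsub>free_alg S'\<^esub> R'"
  shows "\<exists>\<theta>\<in>alg_iso (pres_alg S R) (pres_alg S' R').
    \<forall>p\<in>carrier (free_alg S). \<theta> (pres_class S R p) = pres_class S' R' (subst \<phi> p)"
proof -
  \<comment> \<open>a statement symmetric in the two presentations, to be used in both directions\<close>
  have half: "subst \<phi> p \<in> carrier (free_alg S')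
      \<and> (q \<in> carrier (free_alg S) \<longrightarrow> pres_class S R p = pres_class S R q \<longrightarrow>
         pres_class S' R' (subst \<phi> p) = pres_class S' R' (subst \<phi> q))
      \<and> pres_class S R (subst \<psi> (subst \<phi> p)) = pres_class S R p"
    if R: "R \<subseteq> carrier (free_alg S)" and R': "R' \<subseteq> carrier (free_alg S')"
      and \<phi>: "\<And>g. g \<in> S \<Longrightarrow> \<phi> g \<in> carrier (free_alg S')"
      and \<psi>: "\<And>k. k \<in> S' \<Longrightarrow> \<psi> k \<in> carrier (free_alg S)"
      and R\<phi>: "\<And>p. p \<in> R \<Longrightarrow> subst \<phi> p \<in> Idl\<^bsub>free_alg S'\<^esub> R'"
      and \<psi>\<phi>: "\<And>g. g \<in> S \<Longrightarrow> subst \<psi> (\<phi> g) - gen g \<in> Idl\<^bsub>free_alg S\<^esub> R"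
      and p: "p \<in> carrier (free_alg S)"
    for S :: "'x set" and R and S' :: "'y set" and R' \<phi> \<psi> p q
  proof (intro conjI impI)
    note I = ideal_free_alg_closed[OF rels_ideal[OF R]]
    have cl: "subst \<phi> p \<in> carrier (free_alg S')" if "p \<in> carrier (free_alg S)" for p
      using subst_closed \<phi> that by blast
    then show "subst \<phi> p \<in> carrier (free_alg S')" using p by blast
    show "pres_class S' R' (subst \<phi> p) = pres_class S' R' (subst \<phi> q)"
      if q: "q \<in> carrier (free_alg S)" and eq: "pres_class S R p = pres_class S R q"
      using eq subst_ideal[OF rels_ideal[OF R'] \<phi> R R\<phi>, of "p - q"]
      by (simp add: pres_class_eq_iff[OF R p q] pres_class_eq_iff[OF R' cl[OF p] cl[OF q]] subst_simps)
    have cl': "subst \<psi> p \<in> carrier (free_alg S)" if "p \<in> carrier (free_alg S')" for p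
      using subst_closed \<psi> that by blast
    have "subst \<psi> (subst \<phi> p) - p \<in> Idl\<^bsub>free_alg S\<^esub> R \<and> p \<in> carrier (free_alg S)"
      using p
    proof (induct p rule: free_alg_induct)
      case (const c)
      then show ?case by (simp add: subst_simps I const_closed)
    next
      case (gen g)
      then show ?case by (simp add: subst_simps \<psi>\<phi> gen_closed)
    next
      case (add p q)
      then show ?case
        using I(2)[of "subst \<psi> (subst \<phi> p) - p" "subst \<psi> (subst \<phi> q) - q"]
          ring.ring_simprules(1)[OF ring_free_alg, of p S q]
        by (simp add: subst_simps algebra_simps)
    next
      case (mult p q)
      let ?p = "subst \<psi> (subst \<phi> p)" and ?q = "subst \<psi> (subst \<phi> q)"
      have "(?p - p) * ?q + p * (?q - q) \<in> Idl\<^bsub>free_alg S\<^esub> R"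
        using mult by (intro I(2) I(5)[of "?q - q"] I(6)[of "?p - p"] cl' cl) simp_all
      then show ?case
        using mult ring.ring_simprules(5)[OF ring_free_alg, of p S q]
        by (simp add: subst_simps algebra_simps)
    qed
    then show "pres_class S R (subst \<psi> (subst \<phi> p)) = pres_class S R p"
      using pres_class_eq_iff[OF R cl'[OF cl[OF p]] p] by simp
  qed
  have A: "subst \<phi> p \<in> carrier (free_alg S')
      \<and> (q \<in> carrier (free_alg S) \<longrightarrow> pres_class S R p = pres_class S R q \<longrightarrow>
         pres_class S' R' (subst \<phi> p) = pres_class S' R' (subst \<phi> q))
      \<and> pres_class S R (subst \<psi> (subst \<phi> p)) = pres_class S R p"
    if "p \<in> carrier (free_alg S)" for p q
    by (rule half) (fact R R' \<phi> \<psi> R\<phi> \<psi>\<phi> that)+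
  have B: "subst \<psi> p \<in> carrier (free_alg S)
      \<and> (q \<in> carrier (free_alg S') \<longrightarrow> pres_class S' R' p = pres_class S' R' q \<longrightarrow>
         pres_class S R (subst \<psi> p) = pres_class S R (subst \<psi> q))
      \<and> pres_class S' R' (subst \<phi> (subst \<psi> p)) = pres_class S' R' p"
    if "p \<in> carrier (free_alg S')" for p q
    by (rule half) (fact R R' \<phi> \<psi> R\<psi> \<phi>\<psi> that)+
  define \<theta> where "\<theta> X = pres_class S' R' (subst \<phi> (SOME p. p \<in> X))" for X
  have \<theta>: "\<theta> (pres_class S R p) = pres_class S' R' (subst \<phi> p)" if p: "p \<in> carrier (free_alg S)" for p
  proof -
    have "(SOME q. q \<in> pres_class S R p) \<in> pres_class S R p"
      using pres_class_self[OF R p] by (rule someI)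
    from pres_class_mem[OF R p this] show ?thesis
      unfolding \<theta>_def using A p by blast
  qed
  interpret F: ring "free_alg S" by (rule ring_free_alg)
  have cl: "p * q \<in> carrier (free_alg S)" "p + q \<in> carrier (free_alg S)" "const c * p \<in> carrier (free_alg S)"
    if "p \<in> carrier (free_alg S)" "q \<in> carrier (free_alg S)" for p q c
    using F.m_closed[of p q] F.m_closed[OF const_closed, of p] F.add.m_closed[of p q] that by auto
  have one: "(1 :: 'a ncpoly) \<in> carrier (free_alg S)" using F.one_closed by simp
  have im: "subst \<phi> p \<in> carrier (free_alg S')" if "p \<in> carrier (free_alg S)" for p
    using A[OF that] by blast
  have "\<theta> \<in> ring_hom (pres_alg S R) (pres_alg S' R')"
  proof (rule ring_hom_memI)
    fix x y assume "x \<in> carrier (pres_alg S R)" "y \<in> carrier (pres_alg S R)"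
    then obtain p q where p: "p \<in> carrier (free_alg S)" "x = pres_class S R p"
      and q: "q \<in> carrier (free_alg S)" "y = pres_class S R q"
      by (auto simp: carrier_pres[OF R])
    show "\<theta> (x \<otimes>\<^bsub>pres_alg S R\<^esub> y) = \<theta> x \<otimes>\<^bsub>pres_alg S' R'\<^esub> \<theta> y"
      by (simp add: p q pres_class_ops(1)[OF R p(1) q(1)] \<theta> cl
          pres_class_ops(1)[OF R' im[OF p(1)] im[OF q(1)]] subst_mult)
    show "\<theta> (x \<oplus>\<^bsub>pres_alg S R\<^esub> y) = \<theta> x \<oplus>\<^bsub>pres_alg S' R'\<^esub> \<theta> y"
      by (simp add: p q pres_class_ops(2)[OF R p(1) q(1)] \<theta> cl
          pres_class_ops(2)[OF R' im[OF p(1)] im[OF q(1)]] subst_add)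
    show "\<theta> x \<in> carrier (pres_alg S' R')"
      using im[OF p(1)] by (simp add: p \<theta> carrier_pres[OF R'])
  next
    show "\<theta> \<one>\<^bsub>pres_alg S R\<^esub> = \<one>\<^bsub>pres_alg S' R'\<^esub>"
      by (simp add: pres_class_one[OF R] pres_class_one[OF R']
          \<theta>[OF one] subst_one)
  qed
  moreover have "bij_betw \<theta> (carrier (pres_alg S R)) (carrier (pres_alg S' R'))"
    unfolding bij_betw_def
  proof
    show "inj_on \<theta> (carrier (pres_alg S R))"
    proof (rule inj_onI)
      fix x y assume "x \<in> carrier (pres_alg S R)" "y \<in> carrier (pres_alg S R)" and eq: "\<theta> x = \<theta> y"
      then obtain p q where p: "p \<in> carrier (free_alg S)" "x = pres_class S R p"
        and q: "q \<in> carrier (free_alg S)" "y = pres_class S R q"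
        by (auto simp: carrier_pres[OF R])
      have "pres_class S R (subst \<psi> (subst \<phi> p)) = pres_class S R (subst \<psi> (subst \<phi> q))"
        using B[OF im[OF p(1)], of "subst \<phi> q"] im[OF q(1)] eq \<theta> p q by simp
      then show "x = y" using A[OF p(1)] A[OF q(1)] p q by simp
    qed
    have "pres_class S' R' k = \<theta> (pres_class S R (subst \<psi> k)) \<and> subst \<psi> k \<in> carrier (free_alg S)"
      if "k \<in> carrier (free_alg S')" for k
      using B[OF that] \<theta>[of "subst \<psi> k"] by simp
    then have "carrier (pres_alg S' R') \<subseteq> \<theta> ` carrier (pres_alg S R)"
      unfolding carrier_pres[OF R] carrier_pres[OF R'] by blast
    moreover have "\<theta> ` carrier (pres_alg S R) \<subseteq> carrier (pres_alg S' R')"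
      unfolding carrier_pres[OF R] carrier_pres[OF R'] by (auto simp: \<theta> im)
    ultimately show "\<theta> ` carrier (pres_alg S R) = carrier (pres_alg S' R')" by blast
  qed
  ultimately have "\<theta> \<in> alg_iso (pres_alg S R) (pres_alg S' R')"
    by (auto simp: alg_iso_def ring_iso_def carrier_pres[OF R] pres_class_smult[OF R]
        pres_class_smult[OF R'] \<theta> cl im subst_mult subst_const)
  then show ?thesis using \<theta> by blast
qed

section \<open>Polynomial functions and extension of bilinear maps\<close>

definition linear_map :: "(complex poly \<Rightarrow> 'g ncpoly) \<Rightarrow> bool" where
  "linear_map f \<longleftrightarrow> (\<forall>p q. f (p + q) = f p + f q) \<and> (\<forall>c p. f (Polynomial.smult c p) = const c * f p)"

lemma linear_mapI:
  "(\<And>p q. f (p + q) = f p + f q) \<Longrightarrow> (\<And>c p. f (Polynomial.smult c p) = const c * f p) \<Longrightarrow> linear_map f"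
  by (simp add: linear_map_def)

context
  fixes f :: "complex poly \<Rightarrow> 'g ncpoly"
  assumes f: "linear_map f"
begin

lemma linear_map_add: "f (p + q) = f p + f q"
  and linear_map_smult: "f (Polynomial.smult c p) = const c * f p"
  using f by (auto simp: linear_map_def)

lemma linear_map_zero: "f 0 = 0"
  using linear_map_add[of 0 0] by simp

lemma linear_map_uminus: "f (- p) = - f p"
  using linear_map_add[of p "- p"] by (simp add: linear_map_zero eq_neg_iff_add_eq_0 add.commute)

lemma linear_map_diff: "f (p - q) = f p - f q"
  using linear_map_add[of p "- q"] by (simp add: linear_map_uminus)

lemma linear_map_sum: "f (sum g A) = (\<Sum>x\<in>A. f (g x))"
  by (induct A rule: infinite_finite_induct) (simp_all add: linear_map_zero linear_map_add)

lemma linear_map_monoms: "f p = (\<Sum>k\<le>degree p. const (coeff p k) * f (monom 1 k))"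
proof -
  have "f p = f (\<Sum>k\<le>degree p. monom (coeff p k) k)" by (simp add: poly_as_sum_of_monoms)
  also have "\<dots> = (\<Sum>k\<le>degree p. f (Polynomial.smult (coeff p k) (monom 1 k)))"
    by (simp add: linear_map_sum smult_monom)
  finally show ?thesis by (simp add: linear_map_smult)
qed

lemmas linear_map_simps = linear_map_add linear_map_smult linear_map_zero linear_map_uminus linear_map_diff

end

definition lin :: "(nat \<Rightarrow> 'g ncpoly) \<Rightarrow> complex poly \<Rightarrow> 'g ncpoly" where
  "lin a p = (\<Sum>k\<le>degree p. const (coeff p k) * a k)"

lemma lin_superset: "degree p \<le> n \<Longrightarrow> lin a p = (\<Sum>k\<le>n. const (coeff p k) * a k)"
  unfolding lin_def by (intro sum.mono_neutral_left) (auto simp: coeff_eq_0 const_hom)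

lemma linear_lin: "linear_map (lin a)"
proof (rule linear_mapI)
  fix p q :: "complex poly" and c
  let ?n = "max (degree p) (degree q)"
  show "lin a (p + q) = lin a p + lin a q"
    by (subst (1 2 3) lin_superset[of _ ?n]) (auto simp: degree_add_le const_hom distrib_right sum.distrib)
  show "lin a (Polynomial.smult c p) = const c * lin a p"
    by (subst (1 2) lin_superset[of _ "degree p"])
      (auto simp: degree_smult_le const_hom sum_distrib_left mult.assoc)
qed

lemma lin_monom: "lin a (monom c k) = const c * a k"
proof -
  have "lin a (monom c k) = (\<Sum>j\<le>k. const (coeff (monom c k) j) * a j)"
    by (rule lin_superset) (rule degree_monom_le)
  also have "\<dots> = (\<Sum>j\<in>{k}. const (coeff (monom c k) j) * a j)"
    by (rule sum.mono_neutral_right) (auto simp: const_hom)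
  finally show ?thesis by simp
qed

definition shift :: "complex \<Rightarrow> complex poly \<Rightarrow> complex poly" where
  "shift c p = pcompose p [:c, 1:]"

lemma poly_shift [simp]: "poly (shift c p) x = poly p (x + c)"
  by (simp add: shift_def poly_pcompose add.commute)

lemma polyI: "(\<And>x. poly p x = poly q x) \<Longrightarrow> p = q" for p q :: "complex poly"
  by (simp add: poly_eq_poly_eq_iff[symmetric] fun_eq_iff)

lemma shift_linear: "shift c (p + q) = shift c p + shift c q" "shift c (p - q) = shift c p - shift c q"
  "shift c (Polynomial.smult k p) = Polynomial.smult k (shift c p)" "shift c (- p) = - shift c p"
  "shift c 0 = 0" "shift 0 p = p"
  by (rule polyI; simp)+

definition bilinear_map :: "(complex poly \<Rightarrow> complex poly \<Rightarrow> 'g ncpoly) \<Rightarrow> bool" where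
  "bilinear_map \<beta> \<longleftrightarrow> (\<forall>q. linear_map (\<lambda>p. \<beta> p q)) \<and> (\<forall>p. linear_map (\<beta> p))"

lemma bilinear_comm: "linear_map f \<Longrightarrow> linear_map g \<Longrightarrow> bilinear_map (\<lambda>p q. comm (f p) (g q))"
  unfolding bilinear_map_def by (auto intro!: linear_mapI simp: comm_linear linear_map_simps)

text \<open>Polynomial functions of two and of three variables, as sums of products of functions of one
  variable. Functions rather than formal polynomials are used because substitutions and
  polynomial identities are then evident.\<close>

inductive poly2 :: "(complex \<Rightarrow> complex \<Rightarrow> complex) \<Rightarrow> bool" where
  poly2_prod: "poly2 (\<lambda>x y. poly p x * poly q y)"
| poly2_add: "poly2 K \<Longrightarrow> poly2 G \<Longrightarrow> poly2 (\<lambda>x y. K x y + G x y)"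

inductive poly3 :: "(complex \<Rightarrow> complex \<Rightarrow> complex \<Rightarrow> complex) \<Rightarrow> bool" where
  poly3_prod: "poly3 (\<lambda>x y z. poly p x * poly q y * poly s z)"
| poly3_add: "poly3 K \<Longrightarrow> poly3 G \<Longrightarrow> poly3 (\<lambda>x y z. K x y z + G x y z)"

lemma poly2_basic: "poly2 (\<lambda>x y. c)" "poly2 (\<lambda>x y. x)" "poly2 (\<lambda>x y. y)"
  using poly2_prod[of "[:c:]" 1] poly2_prod[of "[:0, 1:]" 1] poly2_prod[of 1 "[:0, 1:]"] by simp_all

lemma poly3_basic: "poly3 (\<lambda>x y z. c)" "poly3 (\<lambda>x y z. x)" "poly3 (\<lambda>x y z. y)" "poly3 (\<lambda>x y z. z)"
  using poly3_prod[of "[:c:]" 1 1] poly3_prod[of "[:0, 1:]" 1 1] poly3_prod[of 1 "[:0, 1:]" 1]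
    poly3_prod[of 1 1 "[:0, 1:]"] by simp_all

lemma poly2_mult: "poly2 K \<Longrightarrow> poly2 G \<Longrightarrow> poly2 (\<lambda>x y. K x y * G x y)"
proof (induct K rule: poly2.induct)
  case (poly2_prod p q)
  from this show ?case
  proof (induct G rule: poly2.induct)
    case (poly2_prod p' q')
    have "(\<lambda>x y. poly p x * poly q y * (poly p' x * poly q' y)) = (\<lambda>x y. poly (p * p') x * poly (q * q') y)"
      by (simp add: fun_eq_iff mult.assoc mult.left_commute)
    then show ?case using poly2.poly2_prod[of "p * p'" "q * q'"] by (simp only:)
  next
    case (poly2_add K G)
    then show ?case using poly2.poly2_add[OF poly2_add(2,4)] by (simp add: distrib_left)
  qed
next
  case (poly2_add K K')
  then show ?case using poly2.poly2_add[OF poly2_add(2,4)] by (simp add: distrib_right)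
qed

lemma poly3_mult: "poly3 K \<Longrightarrow> poly3 G \<Longrightarrow> poly3 (\<lambda>x y z. K x y z * G x y z)"
proof (induct K rule: poly3.induct)
  case (poly3_prod p q s)
  from this show ?case
  proof (induct G rule: poly3.induct)
    case (poly3_prod p' q' s')
    have "(\<lambda>x y z. poly p x * poly q y * poly s z * (poly p' x * poly q' y * poly s' z))
        = (\<lambda>x y z. poly (p * p') x * poly (q * q') y * poly (s * s') z)"
      by (simp add: fun_eq_iff mult.assoc mult.left_commute)
    then show ?case using poly3.poly3_prod[of "p * p'" "q * q'" "s * s'"] by (simp only:)
  next
    case (poly3_add K G)
    then show ?case using poly3.poly3_add[OF poly3_add(2,4)] by (simp add: distrib_left)
  qed
next
  case (poly3_add K K')
  then show ?case using poly3.poly3_add[OF poly3_add(2,4)] by (simp add: distrib_right)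
qed

lemma poly2_diff: "poly2 K \<Longrightarrow> poly2 G \<Longrightarrow> poly2 (\<lambda>x y. K x y - G x y)"
  using poly2_add[OF _ poly2_mult[OF poly2_basic(1)[of "-1"]], of K G] by simp

lemma poly3_diff: "poly3 K \<Longrightarrow> poly3 G \<Longrightarrow> poly3 (\<lambda>x y z. K x y z - G x y z)"
  using poly3_add[OF _ poly3_mult[OF poly3_basic(1)[of "-1"]], of K G] by simp

lemma poly2_poly: "poly2 K \<Longrightarrow> poly2 (\<lambda>x y. poly s (K x y))"
  by (induct s) (auto intro!: poly2_basic poly2_add poly2_mult)

lemma poly3_poly: "poly3 K \<Longrightarrow> poly3 (\<lambda>x y z. poly s (K x y z))"
  by (induct s) (auto intro!: poly3_basic poly3_add poly3_mult)

lemma poly2_divide: "poly2 K \<Longrightarrow> poly2 (\<lambda>x y. K x y / c)"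
  using poly2_mult[of K "\<lambda>_ _. 1 / c"] by (simp add: poly2_basic)

lemma poly2_power: "poly2 K \<Longrightarrow> poly2 (\<lambda>x y. K x y ^ n)"
  by (induct n) (auto intro: poly2_basic poly2_mult)

lemma poly3_power: "poly3 K \<Longrightarrow> poly3 (\<lambda>x y z. K x y z ^ n)"
  by (induct n) (auto intro: poly3_basic poly3_mult)

lemmas poly2_intros = poly2_basic poly2_add poly2_diff poly2_mult poly2_poly poly2_divide poly2_power
lemmas poly3_intros = poly3_basic poly3_add poly3_diff poly3_mult poly3_poly poly3_power

lemma poly2_of_poly3:
  "poly3 K \<Longrightarrow> poly2 A \<Longrightarrow> poly2 B \<Longrightarrow> poly2 C \<Longrightarrow> poly2 (\<lambda>x y. K (A x y) (B x y) (C x y))"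
  by (induct K rule: poly3.induct) (auto intro!: poly2_intros)

lemma poly3_of_poly2: "poly2 K \<Longrightarrow> poly3 A \<Longrightarrow> poly3 B \<Longrightarrow> poly3 (\<lambda>x y z. K (A x y z) (B x y z))"
  by (induct K rule: poly2.induct) (auto intro!: poly3_intros)

lemma poly2_of_poly2: "poly2 K \<Longrightarrow> poly2 A \<Longrightarrow> poly2 B \<Longrightarrow> poly2 (\<lambda>x y. K (A x y) (B x y))"
  by (induct K rule: poly2.induct) (auto intro!: poly2_intros)

lemma poly2_ring_induct [consumes 1, case_names const fst snd add mult]:
  assumes "poly2 K" and c: "\<And>c. P (\<lambda>x y. c)" and x: "P (\<lambda>x y. x)" and y: "P (\<lambda>x y. y)"
    and a: "\<And>K G. P K \<Longrightarrow> P G \<Longrightarrow> P (\<lambda>x y. K x y + G x y)"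
    and m: "\<And>K G. P K \<Longrightarrow> P G \<Longrightarrow> P (\<lambda>x y. K x y * G x y)"
  shows "P K"
  using assms(1)
proof (induct K rule: poly2.induct)
  case (poly2_prod p q)
  have "P (\<lambda>x y. poly p x)" by (induct p) (simp_all add: c a m x)
  moreover have "P (\<lambda>x y. poly q y)" by (induct q) (simp_all add: c a m y)
  ultimately show ?case by (rule m)
qed (rule a)

text \<open>\<open>K\<close> is represented by a unique polynomial in \<open>y\<close> whose coefficients are polynomials in \<open>x\<close>
  (\<open>poly2_function_unique\<close>), so on polynomial functions the choice is harmless; on other functions the
  value is arbitrary.\<close>

definition bext :: "(complex poly \<Rightarrow> complex poly \<Rightarrow> 'g ncpoly) \<Rightarrow> (complex \<Rightarrow> complex \<Rightarrow> complex) \<Rightarrow> 'g ncpoly"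
  where "bext \<beta> K =
    (let G = (SOME G. \<forall>x y. K x y = poly (poly G [:y:]) x) in \<Sum>j\<le>degree G. \<beta> (coeff G j) (monom 1 j))"

lemma poly2_function_unique:
  fixes G G' :: "complex poly poly"
  assumes "\<And>x y. poly (poly G [:y:]) x = poly (poly G' [:y:]) x"
  shows "G = G'"
proof (rule ccontr)
  assume "G \<noteq> G'"
  then have "finite {z. poly (G - G') z = 0}" by (intro poly_roots_finite) simp
  moreover have "range (\<lambda>y. [:y:]) \<subseteq> {z. poly (G - G') z = 0}"
    using assms by (auto intro: polyI)
  ultimately have "finite (range (\<lambda>y :: complex. [:y:]))" by (rule rev_finite_subset)
  then have "finite (UNIV :: complex set)" by (rule finite_imageD) (simp add: inj_def)
  then show False using infinite_UNIV_char_0 by blast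
qed

lemma bext_eq:
  assumes K: "\<And>x y. K x y = poly (poly G [:y:]) x" and n: "degree G \<le> n" and \<beta>: "bilinear_map \<beta>"
  shows "bext \<beta> K = (\<Sum>j\<le>n. \<beta> (coeff G j) (monom 1 j))"
proof -
  have "(SOME G. \<forall>x y. K x y = poly (poly G [:y:]) x) = G"
    using K poly2_function_unique by (intro some_equality) auto
  then have "bext \<beta> K = (\<Sum>j\<le>degree G. \<beta> (coeff G j) (monom 1 j))" by (simp add: bext_def)
  also have "\<dots> = (\<Sum>j\<le>n. \<beta> (coeff G j) (monom 1 j))"
    using n \<beta> linear_map_zero[of "\<lambda>p. \<beta> p _"]
    by (intro sum.mono_neutral_left) (auto simp: coeff_eq_0 bilinear_map_def)
  finally show ?thesis .
qed

lemma poly_map_poly_const: "poly (map_poly (\<lambda>c. [:c:]) q) [:y:] = [:poly q y:]" for y :: complex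
  by (induct q) (simp_all add: map_poly_pCons)

lemma poly2_repr: "poly2 K \<Longrightarrow> \<exists>G. \<forall>x y. K x y = poly (poly G [:y:]) x"
proof (induct K rule: poly2.induct)
  case (poly2_prod p q)
  then show ?case
    by (intro exI[of _ "Polynomial.smult p (map_poly (\<lambda>c. [:c:]) q)"]) (simp add: poly_map_poly_const)
next
  case (poly2_add K K')
  then obtain G G' where "\<forall>x y. K x y = poly (poly G [:y:]) x" "\<forall>x y. K' x y = poly (poly G' [:y:]) x"
    by blast
  then show ?case by (intro exI[of _ "G + G'"]) simp
qed

context
  fixes \<beta> :: "complex poly \<Rightarrow> complex poly \<Rightarrow> 'g ncpoly"
  assumes \<beta>: "bilinear_map \<beta>"
begin

lemma bilinear_add_left: "\<beta> (p + p') q = \<beta> p q + \<beta> p' q"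
  using \<beta> linear_map_add[of "\<lambda>p. \<beta> p q" p p'] by (simp add: bilinear_map_def)

lemma bilinear_smult_left: "\<beta> (Polynomial.smult c p) q = const c * \<beta> p q"
  using \<beta> linear_map_smult[of "\<lambda>p. \<beta> p q" c p] by (simp add: bilinear_map_def)

lemma bext_prod: "bext \<beta> (\<lambda>x y. poly p x * poly q y) = \<beta> p q"
proof -
  have l: "linear_map (\<lambda>p. \<beta> p q)" "linear_map (\<beta> p)" for p q using \<beta> by (auto simp: bilinear_map_def)
  let ?G = "Polynomial.smult p (map_poly (\<lambda>c. [:c:]) q)"
  have "degree ?G \<le> degree q"
    by (rule order_trans[OF degree_smult_le]) (simp add: map_poly_degree_leq)
  then have "bext \<beta> (\<lambda>x y. poly p x * poly q y) = (\<Sum>j\<le>degree q. \<beta> (coeff ?G j) (monom 1 j))"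
    by (intro bext_eq \<beta>) (simp_all add: poly_map_poly_const)
  also have "\<dots> = (\<Sum>j\<le>degree q. const (coeff q j) * \<beta> p (monom 1 j))"
    by (simp add: coeff_map_poly linear_map_smult[OF l(1)])
  also have "\<dots> = \<beta> p q" by (rule linear_map_monoms[OF l(2), symmetric])
  finally show ?thesis .
qed

lemma bext_add:
  assumes "poly2 K" "poly2 K'"
  shows "bext \<beta> (\<lambda>x y. K x y + K' x y) = bext \<beta> K + bext \<beta> K'"
proof -
  obtain G G' where G: "\<And>x y. K x y = poly (poly G [:y:]) x" "\<And>x y. K' x y = poly (poly G' [:y:]) x"
    using assms poly2_repr by metis
  let ?n = "max (degree G) (degree G')"
  have "bext \<beta> (\<lambda>x y. K x y + K' x y) = (\<Sum>j\<le>?n. \<beta> (coeff (G + G') j) (monom 1 j))"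
    by (rule bext_eq[OF _ _ \<beta>]) (auto simp: G degree_add_le)
  also have "\<dots> = (\<Sum>j\<le>?n. \<beta> (coeff G j) (monom 1 j) + \<beta> (coeff G' j) (monom 1 j))"
    by (simp add: bilinear_add_left)
  also have "\<dots> = bext \<beta> K + bext \<beta> K'"
    using bext_eq[OF G(1) max.cobounded1[of _ "degree G'"] \<beta>]
      bext_eq[OF G(2) max.cobounded2[of _ "degree G"] \<beta>] by (simp add: sum.distrib)
  finally show ?thesis .
qed

lemma bext_scale: "poly2 K \<Longrightarrow> bext \<beta> (\<lambda>x y. c * K x y) = const c * bext \<beta> K"
proof (induct K rule: poly2.induct)
  case (poly2_prod p q)
  have "(\<lambda>x y. c * (poly p x * poly q y)) = (\<lambda>x y. poly (Polynomial.smult c p) x * poly q y)"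
    by (simp add: mult.assoc)
  then have "bext \<beta> (\<lambda>x y. c * (poly p x * poly q y)) = \<beta> (Polynomial.smult c p) q"
    by (simp only: bext_prod)
  then show ?case by (simp add: bext_prod bilinear_smult_left)
next
  case (poly2_add K G)
  then show ?case
    by (simp add: distrib_left bext_add poly2_intros)
qed

lemma bext_diff:
  assumes "poly2 K" "poly2 K'"
  shows "bext \<beta> (\<lambda>x y. K x y - K' x y) = bext \<beta> K - bext \<beta> K'"
  using bext_add[OF assms(1) poly2_mult[OF poly2_basic(1)[of "-1"] assms(2)]]
    bext_scale[OF assms(2), of "-1"] by (simp add: const_hom)

end

text \<open>The coordinates \<open>v = x + r y + d\<close> and \<open>u = x - y\<close> generate all polynomials, and modulo a monic
  quadratic polynomial in \<open>u\<close> the powers \<open>1\<close> and \<open>u\<close> suffice.\<close>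

lemma poly2_mod_quadratic:
  fixes r d h :: complex
  assumes K: "poly2 K" and r: "r + 1 \<noteq> 0"
  shows "\<exists>s t G. poly2 G \<and> (\<forall>x y. K x y = poly s (x + r * y + d) + (x - y) * poly t (x + r * y + d)
      + (x - y + h) * (x - y - r * h) * G x y)"
proof -
  obtain k where k: "k * (r + 1) = 1" using r by (metis nonzero_eq_divide_eq)
  let ?form = "\<lambda>K s t G. \<forall>x y. K x y = poly s (x + r * y + d) + (x - y) * poly t (x + r * y + d)
    + (x - y + h) * (x - y - r * h) * G x y"
  show ?thesis using K
  proof (induct K rule: poly2_ring_induct)
    case (const c)
    show ?case by (rule exI[of _ "[:c:]"], rule exI[of _ 0], rule exI[of _ "\<lambda>_ _. 0"]) (simp add: poly2_basic)
  next
    case fst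
    have e: "x = - d * k + (x + r * y + d) * k + (x - y) * (r * k)" for x y
      using arg_cong[OF k, of "(*) x"] by (simp add: algebra_simps)
    show ?case
      by (rule exI[of _ "[:- d * k, k:]"], rule exI[of _ "[:r * k:]"], rule exI[of _ "\<lambda>_ _. 0"])
        (use e in \<open>simp add: poly2_basic\<close>)
  next
    case snd
    have e: "y = - d * k + (x + r * y + d) * k + (x - y) * (- k)" for x y
      using arg_cong[OF k, of "(*) y"] by (simp add: algebra_simps)
    show ?case
      by (rule exI[of _ "[:- d * k, k:]"], rule exI[of _ "[:- k:]"], rule exI[of _ "\<lambda>_ _. 0"])
        (use e in \<open>simp add: poly2_basic\<close>)
  next
    case (add K K')
    then obtain s t G s' t' G' where G: "poly2 G" "poly2 G'" and K: "?form K s t G" "?form K' s' t' G'"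
      by blast
    show ?case
      by (rule exI[of _ "s + s'"], rule exI[of _ "t + t'"], intro exI[of _ "\<lambda>x y. G x y + G' x y"] conjI allI)
        (intro poly2_intros G, unfold K[rule_format] poly_add, simp add: algebra_simps)
  next
    case (mult K K')
    then obtain s t G s' t' G' where G: "poly2 G" "poly2 G'" and K: "?form K s t G" "?form K' s' t' G'"
      by blast
    let ?v = "\<lambda>x y. x + r * y + d"
    let ?G = "\<lambda>x y. (poly s (?v x y) + (x - y) * poly t (?v x y)) * G' x y
       + G x y * (poly s' (?v x y) + (x - y) * poly t' (?v x y))
       + (x - y + h) * (x - y - r * h) * G x y * G' x y + poly t (?v x y) * poly t' (?v x y)"
    have alg: "(a + u * b + (u + h) * (u - r * h) * g) * (a' + u * b' + (u + h) * (u - r * h) * g')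
        = (a * a' + r * h\<^sup>2 * (b * b')) + u * (a * b' + a' * b + (r - 1) * h * (b * b'))
         + (u + h) * (u - r * h) * ((a + u * b) * g' + g * (a' + u * b') + (u + h) * (u - r * h) * g * g' + b * b')"
      for a b g a' b' g' u :: complex by (simp add: algebra_simps power2_eq_square)
    have e: "poly2 ?G" by (intro poly2_intros G)
    show ?case
      by (rule exI[of _ "s * s' + Polynomial.smult (r * h\<^sup>2) (t * t')"],
          rule exI[of _ "s * t' + s' * t + Polynomial.smult ((r - 1) * h) (t * t')"], intro exI[of _ ?G] conjI allI)
        (use e in \<open>simp_all only: K poly_add poly_mult poly_smult alg\<close>)
  qed
qed

text \<open>The same with a linear polynomial in \<open>u\<close>, for which the power \<open>1\<close> suffices.\<close>

lemma poly2_mod_linear: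
  fixes r a d :: complex
  assumes K: "poly2 K" and r: "r + 1 \<noteq> 0"
  shows "\<exists>s G. poly2 G \<and> (\<forall>x y. K x y = poly s (x + r * y + d) + (x - y - a) * G x y)"
proof -
  obtain k where k: "k * (r + 1) = 1" using r by (metis nonzero_eq_divide_eq)
  show ?thesis using K
  proof (induct K rule: poly2_ring_induct)
    case (const c)
    show ?case by (rule exI[of _ "[:c:]"], rule exI[of _ "\<lambda>_ _. 0"]) (simp add: poly2_basic)
  next
    case fst
    have "x = (r * a - d) * k + (x + r * y + d) * k + (x - y - a) * (r * k)" for x y
      using arg_cong[OF k, of "(*) x"] by (simp add: algebra_simps)
    then show ?case
      by (intro exI[of _ "[:(r * a - d) * k, k:]"] exI[of _ "\<lambda>_ _. r * k"]) (simp add: poly2_basic)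
  next
    case snd
    have "y = (- a - d) * k + (x + r * y + d) * k + (x - y - a) * (- k)" for x y
      using arg_cong[OF k, of "(*) y"] by (simp add: algebra_simps)
    then show ?case
      by (intro exI[of _ "[:(- a - d) * k, k:]"] exI[of _ "\<lambda>_ _. - k"]) (simp add: poly2_basic)
  next
    case (add K K')
    then obtain s G s' G' where G: "poly2 G" "poly2 G'" and
      K: "\<forall>x y. K x y = poly s (x + r * y + d) + (x - y - a) * G x y"
      "\<forall>x y. K' x y = poly s' (x + r * y + d) + (x - y - a) * G' x y"
      by blast
    show ?case
      by (intro exI[of _ "s + s'"] exI[of _ "\<lambda>x y. G x y + G' x y"] conjI allI)
        (intro poly2_intros G, unfold K[rule_format] poly_add, simp add: algebra_simps)
  next
    case (mult K K')
    then obtain s G s' G' where G: "poly2 G" "poly2 G'" and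
      K: "\<forall>x y. K x y = poly s (x + r * y + d) + (x - y - a) * G x y"
      "\<forall>x y. K' x y = poly s' (x + r * y + d) + (x - y - a) * G' x y"
      by blast
    show ?case
      by (intro exI[of _ "s * s'"] exI[of _ "\<lambda>x y. poly s (x + r * y + d) * G' x y
          + G x y * poly s' (x + r * y + d) + (x - y - a) * G x y * G' x y"] conjI allI)
        (intro poly2_intros G, unfold K[rule_format] poly_mult, simp add: algebra_simps)
  qed
qed

text \<open>The antisymmetric function \<open>x - y\<close> has a symmetric square, so sums of this form are closed under
  products.\<close>

lemma poly2_symmetric_split:
  assumes K: "poly2 K"
  shows "\<exists>S S'. poly2 S \<and> poly2 S' \<and> (\<forall>x y. S x y = S y x) \<and> (\<forall>x y. S' x y = S' y x)
    \<and> (\<forall>x y. K x y = S x y + (x - y) * S' x y)"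
  using K
proof (induct K rule: poly2_ring_induct)
  case (const c)
  show ?case by (rule exI[of _ "\<lambda>_ _. c"], rule exI[of _ "\<lambda>_ _. 0"]) (simp add: poly2_basic)
next
  case fst
  show ?case
    by (rule exI[of _ "\<lambda>x y. (x + y) / 2"], rule exI[of _ "\<lambda>_ _. 1 / 2"])
      (simp add: poly2_intros field_simps)
next
  case snd
  show ?case
    by (rule exI[of _ "\<lambda>x y. (x + y) / 2"], rule exI[of _ "\<lambda>_ _. - 1 / 2"])
      (simp add: poly2_intros field_simps)
next
  case (add K K')
  then obtain S T S' T' where S: "poly2 S" "poly2 T" "\<And>x y. S x y = S y x" "\<And>x y. T x y = T y x"
    "\<forall>x y. K x y = S x y + (x - y) * T x y"
    "poly2 S'" "poly2 T'" "\<And>x y. S' x y = S' y x" "\<And>x y. T' x y = T' y x"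
    "\<forall>x y. K' x y = S' x y + (x - y) * T' x y"
    by metis
  let ?S = "\<lambda>x y. S x y + S' x y" and ?T = "\<lambda>x y. T x y + T' x y"
  have "?S x y = ?S y x" "?T x y = ?T y x" for x y
    using S(3)[of x y] S(4)[of x y] S(8)[of x y] S(9)[of x y] by simp_all
  moreover have "K x y + K' x y = ?S x y + (x - y) * ?T x y" for x y
    unfolding S(5)[rule_format] S(10)[rule_format] by (simp add: algebra_simps power2_eq_square)
  moreover have "poly2 ?S" "poly2 ?T" by (intro poly2_intros S)+
  ultimately show ?case by blast
next
  case (mult K K')
  then obtain S T S' T' where S: "poly2 S" "poly2 T" "poly2 S'" "poly2 T'"
    and sym: "\<And>x y. S x y = S y x" "\<And>x y. T x y = T y x" "\<And>x y. S' x y = S' y x" "\<And>x y. T' x y = T' y x"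
    and K: "\<forall>x y. K x y = S x y + (x - y) * T x y" "\<forall>x y. K' x y = S' x y + (x - y) * T' x y"
    by metis
  let ?S = "\<lambda>x y. S x y * S' x y + (x - y)\<^sup>2 * T x y * T' x y"
    and ?T = "\<lambda>x y. S x y * T' x y + T x y * S' x y"
  have "?S x y = ?S y x" "?T x y = ?T y x" for x y
    using sym(1)[of x y] sym(2)[of x y] sym(3)[of x y] sym(4)[of x y] by (simp_all add: power2_commute)
  moreover have "K x y * K' x y = ?S x y + (x - y) * ?T x y" for x y
    unfolding K(1)[rule_format] K(2)[rule_format] by (simp add: algebra_simps power2_eq_square)
  moreover have "poly2 ?S" "poly2 ?T" by (intro poly2_intros S)+
  ultimately show ?case by blast
qed

definition sym3 :: "(complex \<Rightarrow> complex \<Rightarrow> complex \<Rightarrow> complex) \<Rightarrow> bool" where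
  "sym3 S \<longleftrightarrow> (\<forall>x y z. S x y z = S y x z \<and> S x y z = S x z y)"

lemma sym3_ops: "sym3 (\<lambda>x y z. c)" "sym3 (\<lambda>x y z. x + y + z)"
  "sym3 (\<lambda>x y z. (x - y)\<^sup>2 + (y - z)\<^sup>2 + (x - z)\<^sup>2)"
  "sym3 (\<lambda>x y z. (2 * x - y - z) * (2 * y - x - z) * (2 * z - x - y))"
  "sym3 S \<Longrightarrow> sym3 T \<Longrightarrow> sym3 (\<lambda>x y z. S x y z + T x y z)"
  "sym3 S \<Longrightarrow> sym3 T \<Longrightarrow> sym3 (\<lambda>x y z. S x y z * T x y z)"
  unfolding sym3_def by (simp_all add: power2_commute algebra_simps)

text \<open>On triples \<open>(x, y, y + h)\<close> the function \<open>w = 2 (x - y) - h\<close> satisfies \<open>w\<^sup>2 = 2 q - 3 h\<^sup>2\<close>, where \<open>q\<close> is the sum of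
  the squared differences. Since \<open>q\<close> is symmetric, the functions \<open>S + w T\<close> with \<open>S\<close> and \<open>T\<close> symmetric are
  closed under products; and \<open>x\<close> and \<open>y\<close> are combinations of \<open>w\<close> and \<open>x + y + (y + h)\<close>.\<close>

lemma symmetric_restriction_split:
  assumes K: "poly2 K"
  shows "\<exists>S T. poly3 S \<and> poly3 T \<and> sym3 S \<and> sym3 T
    \<and> (\<forall>x y. K x y = S x y (y + h) + (2 * (x - y) - h) * T x y (y + h))"
  using K
proof (induct K rule: poly2_ring_induct)
  case (const c)
  show ?case
    by (rule exI[of _ "\<lambda>_ _ _. c"], rule exI[of _ "\<lambda>_ _ _. 0"]) (simp add: poly3_basic sym3_ops)
next
  case fst
  have e: "poly3 (\<lambda>x y z. (x + y + z) * (1 / 3))" "sym3 (\<lambda>x y z. (x + y + z) * (1 / 3))"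
    by (intro poly3_intros sym3_ops)+
  show ?case
    by (rule exI[of _ "\<lambda>x y z. (x + y + z) * (1 / 3)"], rule exI[of _ "\<lambda>_ _ _. 1 / 3"])
      (use e in \<open>simp add: poly3_basic sym3_ops field_simps\<close>)
next
  case snd
  have e: "poly3 (\<lambda>x y z. (x + y + z) * (1 / 3) + (- h / 2))" "sym3 (\<lambda>x y z. (x + y + z) * (1 / 3) + (- h / 2))"
    by (intro poly3_intros sym3_ops)+
  show ?case
    by (rule exI[of _ "\<lambda>x y z. (x + y + z) * (1 / 3) + (- h / 2)"], rule exI[of _ "\<lambda>_ _ _. - 1 / 6"])
      (use e in \<open>simp add: poly3_basic sym3_ops field_simps\<close>)
next
  case (add K K')
  then obtain S T S' T' where S: "poly3 S" "poly3 T" "sym3 S" "sym3 T" "poly3 S'" "poly3 T'" "sym3 S'" "sym3 T'"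
    and K: "\<forall>x y. K x y = S x y (y + h) + (2 * (x - y) - h) * T x y (y + h)"
      "\<forall>x y. K' x y = S' x y (y + h) + (2 * (x - y) - h) * T' x y (y + h)"
    by metis
  have e: "poly3 (\<lambda>x y z. S x y z + S' x y z)" "sym3 (\<lambda>x y z. S x y z + S' x y z)"
    "poly3 (\<lambda>x y z. T x y z + T' x y z)" "sym3 (\<lambda>x y z. T x y z + T' x y z)"
    by (intro poly3_intros sym3_ops S)+
  show ?case
    by (rule exI[of _ "\<lambda>x y z. S x y z + S' x y z"], rule exI[of _ "\<lambda>x y z. T x y z + T' x y z"])
      (use e in \<open>simp add: K algebra_simps\<close>)
next
  case (mult K K')
  then obtain S T S' T' where S: "poly3 S" "poly3 T" "sym3 S" "sym3 T" "poly3 S'" "poly3 T'" "sym3 S'" "sym3 T'"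
    and K: "\<forall>x y. K x y = S x y (y + h) + (2 * (x - y) - h) * T x y (y + h)"
      "\<forall>x y. K' x y = S' x y (y + h) + (2 * (x - y) - h) * T' x y (y + h)"
    by metis
  let ?q = "\<lambda>x y z. (x - y)\<^sup>2 + (y - z)\<^sup>2 + (x - z)\<^sup>2 :: complex"
  let ?S = "\<lambda>x y z. S x y z * S' x y z + (2 * ?q x y z + (- 3 * h\<^sup>2)) * (T x y z * T' x y z)"
  let ?T = "\<lambda>x y z. S x y z * T' x y z + T x y z * S' x y z"
  have "poly3 ?S" "sym3 ?S" "poly3 ?T" "sym3 ?T"
    by (intro poly3_intros sym3_ops S)+
  moreover have "K x y * K' x y = ?S x y (y + h) + (2 * (x - y) - h) * ?T x y (y + h)" for x y
    unfolding K(1)[rule_format] K(2)[rule_format] by (simp add: algebra_simps power2_eq_square)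
  ultimately show ?case by blast
qed

text \<open>Two of the triples \<open>(x, y, y + h)\<close> coincide up to order on the lines \<open>u = - h\<close> and \<open>u = 2 h\<close>, so only
  functions with matching values there can be restrictions of symmetric ones. Multiples of
  \<open>(u + h) (u - 2 h)\<close> pass this test, and they are restrictions: on the triples \<open>(u + h) (u - 2 h)\<close> is the
  symmetric function \<open>q / 2 - 3 h\<^sup>2\<close>, and its product with \<open>w\<close> is the symmetric product of the three
  functions \<open>2 a - b - c\<close>.\<close>

lemma symmetric_restriction_multiples:
  assumes K: "poly2 K"
  shows "\<exists>S. poly3 S \<and> sym3 S \<and> (\<forall>x y. (x - y + h) * (x - y - 2 * h) * K x y = S x y (y + h))"
proof -
  from symmetric_restriction_split[OF K] obtain S T
    where S: "poly3 S" "poly3 T" "sym3 S" "sym3 T"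
      and K: "\<forall>x y. K x y = S x y (y + h) + (2 * (x - y) - h) * T x y (y + h)" by blast
  let ?q = "\<lambda>x y z. (x - y)\<^sup>2 + (y - z)\<^sup>2 + (x - z)\<^sup>2 :: complex"
  let ?S = "\<lambda>x y z. ((1 / 2) * ?q x y z + (- 3 * h\<^sup>2)) * S x y z
     + (2 * x - y - z) * (2 * y - x - z) * (2 * z - x - y) * T x y z"
  have "poly3 ?S" "sym3 ?S" by (intro poly3_intros sym3_ops S)+
  moreover have "(x - y + h) * (x - y - 2 * h) * K x y = ?S x y (y + h)" for x y
  proof -
    have "(1 / 2) * ?q x y (y + h) + (- 3 * h\<^sup>2) = (x - y + h) * (x - y - 2 * h)"
      by (simp add: power2_eq_square field_simps)
    then show ?thesis unfolding K[rule_format] by (simp add: algebra_simps power2_eq_square)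
  qed
  ultimately show ?thesis by blast
qed

section \<open>The subalgebra generated by one family of currents\<close>

abbreviation px :: "complex poly" where "px \<equiv> [:0, 1:]"

text \<open>The coefficient of \<open>\<partial>\<^sup>r\<^sup>+\<^sup>1\<close> in the bracket \<open>[p \<partial>, q \<partial>\<^sup>r]\<close>.\<close>

definition twist :: "nat \<Rightarrow> complex \<Rightarrow> complex poly \<Rightarrow> complex poly \<Rightarrow> complex poly" where
  "twist r h p q = p * shift h q - q * shift (of_nat r * h) p"

lemma poly_twist [simp]:
  "poly (twist r h p q) x = poly p x * poly q (x + h) - poly q x * poly p (x + of_nat r * h)"
  by (simp add: twist_def)

text \<open>The bracket is antisymmetric.\<close>

lemma bext_symmetric:
  assumes f: "linear_map f" and S: "poly2 S" "\<And>x y. S x y = S y x"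
  shows "bext (\<lambda>p q. comm (f p) (f q)) S = 0"
proof -
  let ?\<beta> = "\<lambda>p q. comm (f p) (f q)"
  note \<beta> = bilinear_comm[OF f f]
  have sym: "poly2 K \<Longrightarrow> bext ?\<beta> (\<lambda>x y. K x y + K y x) = 0" for K
  proof (induct K rule: poly2.induct)
    case (poly2_prod p q)
    have "bext ?\<beta> (\<lambda>x y. poly p x * poly q y + poly q x * poly p y) = ?\<beta> p q + ?\<beta> q p"
      by (simp only: bext_add[OF \<beta>] poly2.poly2_prod bext_prod[OF \<beta>])
    then show ?case by (simp add: comm_swap[of "f q"] mult.commute)
  next
    case (poly2_add K G)
    have "bext ?\<beta> (\<lambda>x y. (K x y + K y x) + (G x y + G y x)) = 0"
      by (subst bext_add[OF \<beta>])
        (use poly2_add in \<open>auto intro!: poly2_intros poly2_of_poly2[of _ "\<lambda>x y. y" "\<lambda>x y. x"]\<close>)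
    then show ?case by (simp add: algebra_simps)
  qed
  have eq: "(\<lambda>x y. S x y + S y x) = (\<lambda>x y. 2 * S x y)" by (intro ext) (metis S(2) mult_2)
  have "bext ?\<beta> (\<lambda>x y. 2 * S x y) = 0" using sym[OF S(1)] unfolding eq .
  then have "const (1 / 2) * (const 2 * bext ?\<beta> S) = 0" by (simp add: bext_scale[OF \<beta> S(1)])
  then show ?thesis by (simp add: mult.assoc[symmetric] const_hom(4)[symmetric] const_hom(2))
qed

text \<open>\<open>e p\<close> stands for \<open>p(x) \<partial>\<close>. In \<open>serre\<close>, terms with the same outer factor are collected.\<close>

locale current_algebra = two_sided I for I :: "'g ncpoly set" +
  fixes e :: "complex poly \<Rightarrow> 'g ncpoly" and h :: complex
  assumes h: "h \<noteq> 0" and linear_e: "linear_map e"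
    and cubic: "\<And>p q. comm (e (px ^ 3 * p)) (e q) - 3 * comm (e (px ^ 2 * p)) (e (px * q))
        + 3 * comm (e (px * p)) (e (px ^ 2 * q)) - comm (e p) (e (px ^ 3 * q))
        - const (h\<^sup>2) * (comm (e (px * p)) (e q) - comm (e p) (e (px * q))) \<in> I"
    and serre: "\<And>p q s. comm (e p) (comm (e q) (e (px * s)) + comm (e s) (e (px * q)))
        + comm (e q) (comm (e p) (e (px * s)) + comm (e s) (e (px * p)))
        + comm (e s) (comm (e p) (e (px * q)) + comm (e q) (e (px * p))) \<in> I"
begin

text \<open>\<open>W r p\<close> stands for \<open>p(x) \<partial>\<^sup>r\<close>. The recursion uses that
  \<open>[(x - r h) g \<partial>, \<partial>\<^sup>r] - [g \<partial>, x \<partial>\<^sup>r] = - (r + 1) h g \<partial>\<^sup>r\<^sup>+\<^sup>1\<close>. The value at \<open>0\<close> is a default that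
  makes the index the degree.\<close>

fun W :: "nat \<Rightarrow> complex poly \<Rightarrow> 'g ncpoly" where
  "W 0 = (\<lambda>g. 0)"
| "W (Suc 0) = e"
| "W (Suc (Suc n)) = (\<lambda>g. const (- 1 / (of_nat (Suc (Suc n)) * h)) *
     (comm (e ((px - [:of_nat (Suc n) * h:]) * g)) (W (Suc n) 1) - comm (e g) (W (Suc n) px)))"

lemma linear_W: "linear_map (W r)"
proof (cases r rule: W.cases)
  case 1
  then show ?thesis by (auto intro!: linear_mapI)
next
  case 2
  then show ?thesis by (simp add: linear_e)
next
  case (3 n)
  have c: "const k * (const c * a) = const c * (const k * a)" for k c and a :: "'g ncpoly"
    by (simp only: mult.assoc[symmetric] const_hom(4)[symmetric] mult.commute[of k c])
  have e: "e (q * (p + p')) = e (q * p) + e (q * p')" "e (q * Polynomial.smult k p) = const k * e (q * p)" for q p p' k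
    by (simp_all add: distrib_left linear_map_simps[OF linear_e])
  show ?thesis unfolding 3
    by (rule linear_mapI)
      (simp_all only: W.simps e linear_map_simps[OF linear_e] comm_linear c right_diff_distrib distrib_left
        add_diff_add)
qed

text \<open>The bracket \<open>[p \<partial>, q \<partial>\<^sup>r]\<close> as a linear function of \<open>p(x) q(y)\<close>. A relation between these brackets
  is a polynomial function that \<open>B r\<close> sends into the ideal.\<close>

definition B :: "nat \<Rightarrow> (complex \<Rightarrow> complex \<Rightarrow> complex) \<Rightarrow> 'g ncpoly" where
  "B r = bext (\<lambda>p q. comm (e p) (W r q))"

lemma bilinear_B: "bilinear_map (\<lambda>p q. comm (e p) (W r q))"
  by (rule bilinear_comm[OF linear_e linear_W])

lemmas B_prod = bext_prod[OF bilinear_B, folded B_def]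
lemmas B_add = bext_add[OF bilinear_B, folded B_def]
lemmas B_diff = bext_diff[OF bilinear_B, folded B_def]
lemmas B_scale = bext_scale[OF bilinear_B, folded B_def]

definition kills :: "nat \<Rightarrow> (complex \<Rightarrow> complex \<Rightarrow> complex) \<Rightarrow> bool" where
  "kills r K \<longleftrightarrow> poly2 K \<and> B r K \<in> I"

lemma kills_add: "kills r K \<Longrightarrow> kills r K' \<Longrightarrow> kills r (\<lambda>x y. K x y + K' x y)"
  by (auto simp: kills_def B_add intro: poly2_intros add)

lemma kills_diff: "kills r K \<Longrightarrow> kills r K' \<Longrightarrow> kills r (\<lambda>x y. K x y - K' x y)"
  by (auto simp: kills_def B_diff intro: poly2_intros diff)

lemma kills_scale: "kills r K \<Longrightarrow> kills r (\<lambda>x y. c * K x y)"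
  by (auto simp: kills_def B_scale intro: poly2_intros left)

lemma kills_unscale: "kills r (\<lambda>x y. c * K x y) \<Longrightarrow> c \<noteq> 0 \<Longrightarrow> kills r K"
  using kills_scale[of r "\<lambda>x y. c * K x y" "1 / c"] by simp

lemma kills_eq: "kills r K \<Longrightarrow> (\<And>x y. K x y = K' x y) \<Longrightarrow> kills r K'"
  by (metis ext)

definition bracket_rule :: "nat \<Rightarrow> bool" where
  "bracket_rule r \<longleftrightarrow> (\<forall>p q. comm (e p) (W r q) \<approx> W (Suc r) (twist r h p q))"

text \<open>The functions that \<open>[p \<partial>, q \<partial>\<^sup>r] = twist r h p q \<partial>\<^sup>r\<^sup>+\<^sup>1\<close> forces \<open>B r\<close> to kill
  are those with equal restrictions to the two lines \<open>y = x + h\<close> and \<open>x = y + r h\<close>, where points with the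
  same value of \<open>x + r y\<close> are identified. Modulo the product of the equations of these lines they
  are the polynomials in \<open>x + r y\<close>, so these two families are enough.\<close>

lemma bracket_ruleI:
  assumes r: "0 < r"
    and quad: "\<And>G. poly2 G \<Longrightarrow> kills r (\<lambda>x y. (x - y + h) * (x - y - of_nat r * h) * G x y)"
    and diag: "\<And>s. kills r (\<lambda>x y. poly s (x + of_nat r * y + (of_nat r - 1) * h))"
  shows "bracket_rule r"
  unfolding bracket_rule_def
proof (intro allI)
  fix p q
  let ?r = "of_nat r :: complex"
  let ?g = "twist r h p q" and ?c = "- 1 / ((?r + 1) * h)"
  let ?v = "\<lambda>x y. x + ?r * y + (?r - 1) * h"
  obtain n where n: "r = Suc n" using r by (cases r) auto
  have r1: "?r + 1 \<noteq> 0" by (metis of_nat_Suc of_nat_neq_0 add.commute)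
  \<comment> \<open>the bracket \<open>[p \<partial>, q \<partial>\<^sup>r]\<close> minus the combination of brackets that defines \<open>W (Suc r) ?g\<close>\<close>
  define K where "K = (\<lambda>x y. poly p x * poly q y - ?c * (poly ((px - [:?r * h:]) * ?g) x * poly 1 y - poly ?g x * poly px y))"
  have P: "poly2 (\<lambda>x y. poly p x * poly q y)" "poly2 (\<lambda>x y. poly ((px - [:?r * h:]) * ?g) x * poly 1 y)"
    "poly2 (\<lambda>x y. poly ?g x * poly px y)" by (rule poly2_prod)+
  have K2: "poly2 K" unfolding K_def by (intro poly2_intros)
  have BK: "B r K = comm (e p) (W r q) - W (Suc r) ?g"
  proof -
    have "B r K = B r (\<lambda>x y. poly p x * poly q y)
      - const ?c * (B r (\<lambda>x y. poly ((px - [:?r * h:]) * ?g) x * poly 1 y) - B r (\<lambda>x y. poly ?g x * poly px y))"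
      unfolding K_def
      by (subst B_diff[OF P(1) poly2_mult[OF poly2_basic(1) poly2_diff[OF P(2,3)]]],
          subst B_scale[OF poly2_diff[OF P(2,3)]], subst B_diff[OF P(2,3)], rule refl)
    then show ?thesis unfolding B_prod by (simp add: n add.commute)
  qed
  have K_eq: "K x y = poly p x * poly q y - ?c * ((x - y - ?r * h) * poly ?g x)" for x y
    by (simp only: K_def poly_mult poly_diff poly_1 poly_pCons poly_0) (simp add: algebra_simps)
  have line1: "K x (x + h) = poly q x * poly p (x + ?r * h)" for x
  proof -
    have "x - (x + h) - ?r * h = - ((?r + 1) * h)" by (simp add: algebra_simps)
    then have "?c * (x - (x + h) - ?r * h) = 1" using r1 h by simp
    then have "?c * ((x - (x + h) - ?r * h) * poly ?g x) = poly ?g x" by (metis mult.assoc mult_1)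
    then show ?thesis unfolding K_eq by simp
  qed
  have line2: "K (x + ?r * h) x = poly q x * poly p (x + ?r * h)" for x
    unfolding K_eq by (simp add: mult.commute)
  obtain s t G where G: "poly2 G" and
    K: "\<And>x y. K x y = poly s (?v x y) + (x - y) * poly t (?v x y) + (x - y + h) * (x - y - ?r * h) * G x y"
    using poly2_mod_quadratic[OF K2 r1, of "(?r - 1) * h" h] by blast
  \<comment> \<open>the two lines are \<open>x - y = - h\<close> and \<open>x - y = r h\<close>, so equal restrictions force \<open>t = 0\<close>\<close>
  have "t = 0"
  proof (rule polyI)
    fix z
    define x where "x = (z - (2 * ?r - 1) * h) / (?r + 1)"
    have "(?r + 1) * x = z - (2 * ?r - 1) * h" using r1 by (simp add: x_def)
    then have v: "?v x (x + h) = z" "?v (x + ?r * h) x = z" by (simp_all add: algebra_simps)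
    have "K x (x + h) = poly s z - h * poly t z" "K (x + ?r * h) x = poly s z + ?r * h * poly t z"
      unfolding K[of x "x + h"] K[of "x + ?r * h" x] v by simp_all
    then have eq: "poly s z + ?r * h * poly t z = poly s z - h * poly t z"
      using line1[of x] line2[of x] by metis
    have "(?r + 1) * h * poly t z = poly s z + ?r * h * poly t z - (poly s z - h * poly t z)"
      by (simp add: algebra_simps)
    then have "(?r + 1) * h * poly t z = 0" by (simp only: eq diff_self)
    then show "poly t z = poly 0 z" using r1 h by simp
  qed
  then have "kills r K"
    using kills_eq[OF kills_add[OF diag[of s] quad[OF G]]] K by simp
  then have "comm (e p) (W r q) - W (Suc r) ?g \<in> I" by (simp add: kills_def BK)
  then show "comm (e p) (W r q) \<approx> W (Suc r) ?g" by (simp add: cong_def)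
qed

subsection \<open>Degree two\<close>

lemma kills1_symmetric:
  assumes "poly2 S" "\<And>x y. S x y = S y x"
  shows "kills 1 S"
  using bext_symmetric[OF linear_e assms] assms(1) by (simp add: kills_def B_def zero)

lemma kills1_cubic: "poly2 G \<Longrightarrow> kills 1 (\<lambda>x y. (x - y) * ((x - y)\<^sup>2 - h\<^sup>2) * G x y)"
proof (induct G rule: poly2.induct)
  case (poly2_prod p q)
  let ?b = "\<lambda>p q x y. poly p x * poly q y"
  have P: "poly2 (?b p q)" for p q by (rule poly2.poly2_prod)
  define K where "K = (\<lambda>x y. ?b (px ^ 3 * p) q x y - 3 * ?b (px ^ 2 * p) (px * q) x y
    + 3 * ?b (px * p) (px ^ 2 * q) x y - ?b p (px ^ 3 * q) x y
    - h\<^sup>2 * (?b (px * p) q x y - ?b p (px * q) x y))"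
  have "B 1 K = B 1 (?b (px ^ 3 * p) q) - const 3 * B 1 (?b (px ^ 2 * p) (px * q))
     + const 3 * B 1 (?b (px * p) (px ^ 2 * q)) - B 1 (?b p (px ^ 3 * q))
     - const (h\<^sup>2) * (B 1 (?b (px * p) q) - B 1 (?b p (px * q)))"
    unfolding K_def
    by (simp only: B_add B_diff B_scale poly2_intros P)
  then have "B 1 K \<in> I"
    using cubic[of p q] by (simp only: B_prod const_numeral W.simps One_nat_def)
  moreover have "poly2 K" unfolding K_def by (intro poly2_intros)
  ultimately have "kills 1 K" by (simp add: kills_def)
  then show ?case
    by (rule kills_eq) (simp add: K_def algebra_simps power2_eq_square power3_eq_cube)
next
  case (poly2_add K G)
  show ?case
    by (rule kills_eq[OF kills_add[OF poly2_add(2,4)]]) (simp add: algebra_simps)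
qed

text \<open>Let \<open>u = x - y\<close>. Antisymmetry takes care of the symmetric part of the cofactor of \<open>(u + h) (u - h)\<close>, and
  the cubic relation of the antisymmetric part.\<close>

lemma bracket_rule_1: "bracket_rule 1"
proof (rule bracket_ruleI)
  fix s :: "complex poly"
  show "kills 1 (\<lambda>x y. poly s (x + of_nat 1 * y + (of_nat 1 - 1) * h))"
    by (rule kills1_symmetric) (auto intro!: poly2_intros simp: add.commute)
next
  fix G assume "poly2 G"
  then obtain S T where S: "poly2 S" "poly2 T" "\<And>x y. S x y = S y x" "\<And>x y. T x y = T y x"
    and G: "\<And>x y. G x y = S x y + (x - y) * T x y"
    using poly2_symmetric_split by metis
  have "kills 1 (\<lambda>x y. ((x - y)\<^sup>2 - h\<^sup>2) * S x y)"
    by (rule kills1_symmetric) (intro poly2_intros S, metis S(3) power2_commute)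
  from kills_add[OF this kills1_cubic[OF S(2)]]
  show "kills 1 (\<lambda>x y. (x - y + h) * (x - y - of_nat 1 * h) * G x y)"
    by (rule kills_eq) (simp add: G algebra_simps power2_eq_square)
qed simp

subsection \<open>Degree three\<close>

text \<open>The extra factor \<open>x\<close> in the inner brackets leaves the difference \<open>h\<close> of the last two arguments, so
  a Serre relation becomes the restriction of a symmetric function to the triples \<open>(x, y, y + h)\<close>.\<close>

lemma kills2_serre:
  "poly3 S \<Longrightarrow> kills 2 (\<lambda>x y. h * (S x y (y + h) + S x (y + h) y + S y x (y + h) + S (y + h) x y
     + S y (y + h) x + S (y + h) y x))"
proof (induct S rule: poly3.induct)
  case (poly3_prod p q s)
  define m where "m a b = Polynomial.smult h (a * shift h b + b * shift h a)" for a b :: "complex poly"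
  have m: "B 2 (\<lambda>x y. poly c x * poly (m a b) y)
      \<approx> comm (e c) (comm (e a) (e (px * b)) + comm (e b) (e (px * a)))" for a b c
  proof -
    have "comm (e a) (e (px * b)) + comm (e b) (e (px * a))
       \<approx> W 2 (twist 1 h a (px * b)) + W 2 (twist 1 h b (px * a))"
      using bracket_rule_1 by (intro cong_add) (simp_all add: bracket_rule_def numeral_2_eq_2)
    also have "\<dots> = W 2 (m a b)"
      unfolding linear_map_add[OF linear_W, symmetric]
      by (rule arg_cong[of _ _ "W 2"], rule polyI) (simp add: m_def algebra_simps)
    finally have "W 2 (m a b) \<approx> comm (e a) (e (px * b)) + comm (e b) (e (px * a))" by (rule cong_sym)
    then show ?thesis unfolding B_prod by (rule cong_comm[OF cong_refl])
  qed
  let ?K = "\<lambda>x y. poly p x * poly (m q s) y + poly q x * poly (m p s) y + poly s x * poly (m p q) y"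
  have "B 2 ?K = B 2 (\<lambda>x y. poly p x * poly (m q s) y) + B 2 (\<lambda>x y. poly q x * poly (m p s) y)
     + B 2 (\<lambda>x y. poly s x * poly (m p q) y)"
    by (simp only: B_add poly2_intros poly2_prod)
  also have "\<dots> \<approx> comm (e p) (comm (e q) (e (px * s)) + comm (e s) (e (px * q)))
        + comm (e q) (comm (e p) (e (px * s)) + comm (e s) (e (px * p)))
        + comm (e s) (comm (e p) (e (px * q)) + comm (e q) (e (px * p)))"
    by (intro cong_add m)
  finally have "B 2 ?K \<in> I" using serre[of p q s] cong_mem by blast
  then have "kills 2 ?K" by (auto simp: kills_def intro!: poly2_intros)
  then show ?case by (rule kills_eq) (simp add: m_def algebra_simps)
next
  case (poly3_add K G)
  show ?case by (rule kills_eq[OF kills_add[OF poly3_add(2,4)]]) (simp add: algebra_simps)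
qed

lemma kills2_symmetric:
  assumes S: "poly3 S" "sym3 S"
  shows "kills 2 (\<lambda>x y. S x y (y + h))"
proof (rule kills_unscale[of _ "6 * h"])
  have s: "S y x z = S x y z" "S x z y = S x y z" for x y z using S(2) by (auto simp: sym3_def)
  have "S x (y + h) y = S x y (y + h)" "S y x (y + h) = S x y (y + h)"
    "S (y + h) x y = S x y (y + h)" "S y (y + h) x = S x y (y + h)" "S (y + h) y x = S x y (y + h)" for x y
    by (metis s)+
  then show "kills 2 (\<lambda>x y. 6 * h * S x y (y + h))"
    by (intro kills_eq[OF kills2_serre[OF S(1)]]) simp
qed (simp add: h)

lemma bracket_rule_2: "bracket_rule 2"
proof (rule bracket_ruleI)
  fix s :: "complex poly"
  have "kills 2 (\<lambda>x y. poly s (x + y + (y + h)))"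
    by (rule kills2_symmetric[of "\<lambda>x y z. poly s (x + y + z)"])
      (auto intro!: poly3_intros simp: sym3_def algebra_simps)
  then show "kills 2 (\<lambda>x y. poly s (x + of_nat 2 * y + (of_nat 2 - 1) * h))"
    by (rule kills_eq) (simp add: algebra_simps)
next
  fix G assume "poly2 G"
  then obtain S where S: "poly3 S" "sym3 S"
    and G: "\<And>x y. (x - y + h) * (x - y - 2 * h) * G x y = S x y (y + h)"
    using symmetric_restriction_multiples by blast
  show "kills 2 (\<lambda>x y. (x - y + h) * (x - y - of_nat 2 * h) * G x y)"
    by (rule kills_eq[OF kills2_symmetric[OF S]]) (simp add: G)
qed simp

subsection \<open>Higher degrees\<close>

definition B2 :: "nat \<Rightarrow> (complex \<Rightarrow> complex \<Rightarrow> complex) \<Rightarrow> 'g ncpoly" where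
  "B2 m = bext (\<lambda>p q. comm (W 2 p) (W m q))"

lemma bilinear_B2: "bilinear_map (\<lambda>p q. comm (W 2 p) (W m q))"
  by (rule bilinear_comm[OF linear_W linear_W])

lemmas B2_prod = bext_prod[OF bilinear_B2, folded B2_def]
lemmas B2_add = bext_add[OF bilinear_B2, folded B2_def]
lemmas B2_diff = bext_diff[OF bilinear_B2, folded B2_def]

lemma poly2_restrict:
  assumes "poly3 K"
  shows "poly2 (\<lambda>x y. K x y (y + c))" "poly2 (\<lambda>x y. K y x (y + c))" "poly2 (\<lambda>x y. K x (y + c) y)"
    "poly2 (\<lambda>x y. K (y + c) x y)" "poly2 (\<lambda>x y. K x (x + c) y)" "poly2 (\<lambda>x y. K (x + c) x y)"
  by (rule poly2_of_poly3[OF assms]; intro poly2_intros)+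

text \<open>The Jacobi identity for \<open>[e, [e, W m]]\<close>, read as a statement about \<open>B\<close>: each inner bracket
  evaluates a function of three variables on two lines.\<close>

lemma jacobi_restriction:
  assumes rule: "bracket_rule m"
  shows "poly3 K \<Longrightarrow> B (Suc m) (\<lambda>x y. (K x y (y + h) - K x (y + of_nat m * h) y)
      - (K y x (y + h) - K (y + of_nat m * h) x y))
    \<approx> B2 m (\<lambda>x y. K x (x + h) y - K (x + h) x y)"
proof (induct K rule: poly3.induct)
  case (poly3_prod p q s)
  have r: "W (Suc m) (twist m h a b) \<approx> comm (e a) (W m b)" for a b
    using rule cong_sym by (auto simp: bracket_rule_def)
  have "B (Suc m) (\<lambda>x y. poly p x * poly (twist m h q s) y - poly q x * poly (twist m h p s) y)
     = comm (e p) (W (Suc m) (twist m h q s)) - comm (e q) (W (Suc m) (twist m h p s))"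
    by (simp only: B_diff poly2_prod B_prod)
  also have "\<dots> \<approx> comm (e p) (comm (e q) (W m s)) - comm (e q) (comm (e p) (W m s))"
    by (rule cong_diff[OF cong_comm[OF cong_refl r] cong_comm[OF cong_refl r]])
  also have "\<dots> = comm (comm (e p) (e q)) (W m s)" by (simp add: comm_jacobi)
  also have "\<dots> \<approx> comm (W 2 (twist 1 h p q)) (W m s)"
    using bracket_rule_1 by (intro cong_comm[OF _ cong_refl]) (simp add: bracket_rule_def numeral_2_eq_2)
  also have "\<dots> = B2 m (\<lambda>x y. poly (twist 1 h p q) x * poly s y)" by (simp only: B2_prod)
  finally have "B (Suc m) (\<lambda>x y. poly p x * poly (twist m h q s) y - poly q x * poly (twist m h p s) y)
     \<approx> B2 m (\<lambda>x y. poly (twist 1 h p q) x * poly s y)" .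
  moreover have "poly p x * poly (twist m h q s) y - poly q x * poly (twist m h p s) y
     = poly p x * poly q y * poly s (y + h) - poly p x * poly q (y + of_nat m * h) * poly s y
       - (poly p y * poly q x * poly s (y + h) - poly p (y + of_nat m * h) * poly q x * poly s y)" for x y
    by (simp add: algebra_simps)
  moreover have "poly (twist 1 h p q) x * poly s y
     = poly p x * poly q (x + h) * poly s y - poly p (x + h) * poly q x * poly s y" for x y
    by (simp add: algebra_simps)
  ultimately show ?case by (simp only:)
next
  case (poly3_add K G)
  let ?L = "\<lambda>K x y. (K x y (y + h) - K x (y + of_nat m * h) y) - (K y x (y + h) - K (y + of_nat m * h) x y)"
    and ?M = "\<lambda>K x y. K x (x + h) y - K (x + h) x y"
  have P: "poly2 (?L K)" "poly2 (?L G)" "poly2 (?M K)" "poly2 (?M G)"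
    using poly2_restrict[OF poly3_add(1)] poly2_restrict[OF poly3_add(3)] by (auto intro!: poly2_diff)
  have "B (Suc m) (\<lambda>x y. ?L K x y + ?L G x y) \<approx> B2 m (\<lambda>x y. ?M K x y + ?M G x y)"
    unfolding B_add[OF P(1,2)] B2_add[OF P(3,4)] by (intro cong_add poly3_add)
  then show ?case by (simp add: algebra_simps)
qed

text \<open>A multiple of \<open>(x - y)\<^sup>2 - h\<^sup>2\<close>, with \<open>x\<close> and \<open>y\<close> the first two arguments, makes the right side of
  \<open>jacobi_restriction\<close> vanish. It may be taken antisymmetric in \<open>x\<close> and \<open>y\<close>, since only the antisymmetric
  part enters on the left side.\<close>

lemma kills_jacobi:
  assumes rule: "bracket_rule m" and S: "poly3 S" "\<And>x y z. S x y z = S y x z"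
  shows "kills (Suc m) (\<lambda>x y. (x - y) * ((x - y)\<^sup>2 - h\<^sup>2) * S x y (y + h)
    - (x - y - of_nat m * h) * ((x - y - of_nat m * h)\<^sup>2 - h\<^sup>2) * S x (y + of_nat m * h) y)" (is "kills _ ?K")
proof -
  define K where "K = (\<lambda>x y z. 1 / 2 * ((x - y) * ((x - y)\<^sup>2 - h\<^sup>2) * S x y z))"
  have K: "poly3 K" unfolding K_def by (intro poly3_intros S)
  have swap: "K y x z = - K x y z" for x y z
    using S(2)[of x y z] by (simp add: K_def power2_commute[of y x] algebra_simps)
  have M: "K x (x + h) y = 0" "K (x + h) x y = 0" for x y by (simp_all add: K_def)
  have "B2 m (\<lambda>x y. K x (x + h) y - K (x + h) x y) = 0"
    using B2_diff[OF poly2_basic(1)[of 0] poly2_basic(1)[of 0], of m] by (simp add: M)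
  then have "B (Suc m) (\<lambda>x y. (K x y (y + h) - K x (y + of_nat m * h) y)
      - (K y x (y + h) - K (y + of_nat m * h) x y)) \<in> I"
    using jacobi_restriction[OF rule K] by (simp add: cong_0)
  moreover have "(K x y (y + h) - K x (y + of_nat m * h) y) - (K y x (y + h) - K (y + of_nat m * h) x y)
     = ?K x y" for x y
    unfolding swap[of y x] swap[of "y + of_nat m * h" x] by (simp add: K_def algebra_simps)
  moreover have "poly2 ?K" by (intro poly2_diff poly2_mult[OF _ poly2_restrict(1)[OF S(1)]]
      poly2_mult[OF _ poly2_restrict(3)[OF S(1)]] poly2_intros)
  ultimately show ?thesis by (simp add: kills_def)
qed

text \<open>Choosing \<open>S\<close> to vanish on one of the two restrictions in \<open>kills_jacobi\<close> isolates the other.\<close>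

lemma kills_jacobi_factors:
  assumes rule: "bracket_rule m" and G: "poly2 G"
  defines "M \<equiv> of_nat m * h"
  shows "kills (Suc m) (\<lambda>x y. (x - y) * (x - y - h) * ((x - y + h) * (x - y - M - h) * G x y))"
    "kills (Suc m) (\<lambda>x y. (x - y - M) * (x - y - M + h) * ((x - y + h) * (x - y - M - h) * G x y))"
proof -
  have Mh: "M + h \<noteq> 0"
    unfolding M_def using h by (metis add.commute mult_eq_0_iff of_nat_Suc of_nat_neq_0 mult_1 distrib_right)
  let ?Q = "\<lambda>x y. (x - y + h) * (x - y - M - h) * G x y"
  let ?S = "\<lambda>x y z. (x - z - M) * (y - z - M) * G (x + y - z + h) (z - h)"
  have "poly3 ?S" by (intro poly3_intros poly3_of_poly2[OF G])
  moreover have "?S x y z = ?S y x z" for x y z by (simp add: add.commute)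
  ultimately have "kills (Suc m) (\<lambda>x y. (x - y) * ((x - y)\<^sup>2 - h\<^sup>2) * ?S x y (y + h)
    - (x - y - M) * ((x - y - M)\<^sup>2 - h\<^sup>2) * ?S x (y + M) y)"
    unfolding M_def by (rule kills_jacobi[OF rule])
  then have "kills (Suc m) (\<lambda>x y. - (M + h) * ((x - y) * (x - y - h) * ?Q x y))"
    by (rule kills_eq) (simp add: algebra_simps power2_eq_square)
  then show "kills (Suc m) (\<lambda>x y. (x - y) * (x - y - h) * ?Q x y)"
    by (rule kills_unscale) (use Mh in \<open>simp add: add_eq_0_iff\<close>)
  let ?S = "\<lambda>x y z. (x - z + h) * (y - z + h) * G (x + y - z - M) z"
  have "poly3 ?S" by (intro poly3_intros poly3_of_poly2[OF G])
  moreover have "?S x y z = ?S y x z" for x y z by (simp add: add.commute)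
  ultimately have "kills (Suc m) (\<lambda>x y. (x - y) * ((x - y)\<^sup>2 - h\<^sup>2) * ?S x y (y + h)
    - (x - y - M) * ((x - y - M)\<^sup>2 - h\<^sup>2) * ?S x (y + M) y)"
    unfolding M_def by (rule kills_jacobi[OF rule])
  then have "kills (Suc m) (\<lambda>x y. - (M + h) * ((x - y - M) * (x - y - M + h) * ?Q x y))"
    by (rule kills_eq) (simp add: algebra_simps power2_eq_square)
  then show "kills (Suc m) (\<lambda>x y. (x - y - M) * (x - y - M + h) * ?Q x y)"
    by (rule kills_unscale) (use Mh in \<open>simp add: add_eq_0_iff\<close>)
qed

text \<open>For \<open>S = s(x + y + m z)\<close> both restrictions in \<open>kills_jacobi\<close> are the same polynomial in \<open>x + (m + 1) y\<close>.
  Its coefficient, a difference of two cubic polynomials in \<open>x - y\<close>, is quadratic and takes the same value on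
  the two lines.\<close>

lemma kills_jacobi_diag:
  assumes rule: "bracket_rule m"
  defines "M \<equiv> of_nat m * h"
  shows "kills (Suc m) (\<lambda>x y. M * (3 * ((x - y + h) * (x - y - M - h)) + (M + h) * (M + 2 * h))
    * poly s (x + of_nat (Suc m) * y + M))"
proof -
  let ?S = "\<lambda>x y z. poly s (x + y + of_nat m * z)"
  have "poly3 ?S" by (intro poly3_intros)
  moreover have "?S x y z = ?S y x z" for x y z by (simp add: add.commute)
  ultimately have k: "kills (Suc m) (\<lambda>x y. (x - y) * ((x - y)\<^sup>2 - h\<^sup>2) * ?S x y (y + h)
    - (x - y - M) * ((x - y - M)\<^sup>2 - h\<^sup>2) * ?S x (y + M) y)"
    unfolding M_def by (rule kills_jacobi[OF rule])
  have v: "x + y + of_nat m * (y + h) = x + of_nat (Suc m) * y + M"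
    "x + (y + M) + of_nat m * y = x + of_nat (Suc m) * y + M" for x y
    by (simp_all add: M_def algebra_simps)
  show ?thesis
    by (rule kills_eq[OF k]) (simp only: v, simp add: algebra_simps power2_eq_square)
qed

text \<open>Let \<open>u = x - y\<close>. For \<open>m = 2\<close> the cofactors in \<open>kills_jacobi_factors\<close> have the common root \<open>u = h\<close>, so they give only
  the multiples of \<open>(u - h) (u + h) (u - 3 h)\<close>. The polynomials in \<open>x + 3 y\<close> come from the antisymmetry of
  \<open>[W 2, W 2]\<close>, and then \<open>kills_jacobi_diag\<close> yields \<open>(u + h) (u - 3 h)\<close> times these polynomials.\<close>

lemma bracket_rule_3: "bracket_rule 3"
proof (rule bracket_ruleI)
  note rule = bracket_rule_2
  have diag: "kills 3 (\<lambda>x y. poly s (x + 3 * y + 2 * h))" for s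
  proof -
    let ?K = "\<lambda>x y z. y * poly s (x + y + 2 * z)"
    have K: "poly3 ?K" by (intro poly3_intros)
    have v: "x + (x + h) + 2 * y = 2 * (x + y) + h" "x + h + x + 2 * y = 2 * (x + y) + h"
      "y + (y + h) + 2 * x = 2 * (x + y) + h" "y + h + y + 2 * x = 2 * (x + y) + h" for x y
      by simp_all
    let ?L = "\<lambda>x y. (?K x y (y + h) - ?K x (y + of_nat 2 * h) y) - (?K y x (y + h) - ?K (y + of_nat 2 * h) x y)"
    have "B2 2 (\<lambda>x y. ?K x (x + h) y - ?K (x + h) x y) = 0"
      unfolding B2_def
    proof (rule bext_symmetric[OF linear_W])
      show "poly2 (\<lambda>x y. ?K x (x + h) y - ?K (x + h) x y)" by (intro poly2_intros)
      show "?K x (x + h) y - ?K (x + h) x y = ?K y (y + h) x - ?K (y + h) y x" for x y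
        unfolding v by (simp add: algebra_simps)
    qed
    then have "B 3 ?L \<in> I"
      using jacobi_restriction[OF rule K] by (simp add: cong_0 numeral_3_eq_3 numeral_2_eq_2)
    moreover have "poly2 ?L" by (intro poly2_intros)
    ultimately have k: "kills 3 ?L" by (simp only: kills_def)
    \<comment> \<open>the Jacobi identity for \<open>y s(x + y + 2 z)\<close> relates a symmetric function to \<open>- 2 h s(x + 3 y + 2 h)\<close>\<close>
    have w: "x + y + 2 * (y + h) = x + 3 * y + 2 * h" "x + (y + of_nat 2 * h) + 2 * y = x + 3 * y + 2 * h"
      "y + x + 2 * (y + h) = x + 3 * y + 2 * h" "y + of_nat 2 * h + x + 2 * y = x + 3 * y + 2 * h" for x y
      by simp_all
    have "kills 3 (\<lambda>x y. - 2 * h * poly s (x + 3 * y + 2 * h))"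
      by (rule kills_eq[OF k]) (simp only: w, simp add: algebra_simps)
    then show ?thesis by (rule kills_unscale) (simp add: h)
  qed
  have cofactor: "kills 3 (\<lambda>x y. (x - y - h) * ((x - y + h) * (x - y - 3 * h) * G x y))" if "poly2 G" for G
  proof -
    have "kills 3 (\<lambda>x y. 2 * h * ((x - y - h) * ((x - y + h) * (x - y - 3 * h) * G x y)))"
      by (rule kills_eq[OF kills_diff[OF kills_jacobi_factors[OF rule that, folded eval_nat_numeral]]])
        (simp add: algebra_simps)
    then show ?thesis by (rule kills_unscale) (simp add: h)
  qed
  have qdiag: "kills 3 (\<lambda>x y. (x - y + h) * (x - y - 3 * h) * poly s (x + 3 * y + 2 * h))" for s
  proof -
    have "kills 3 (\<lambda>x y. 2 * h * (3 * ((x - y + h) * (x - y - 2 * h - h)) + (2 * h + h) * (2 * h + 2 * h))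
        * poly s (x + 3 * y + 2 * h))"
      using kills_jacobi_diag[OF rule, of s] by (simp add: numeral_3_eq_3)
    from kills_diff[OF this kills_scale[OF diag[of s], of "24 * h ^ 3"]]
    have "kills 3 (\<lambda>x y. 6 * h * ((x - y + h) * (x - y - 3 * h) * poly s (x + 3 * y + 2 * h)))"
      by (rule kills_eq) (simp add: algebra_simps power3_eq_cube)
    then show ?thesis by (rule kills_unscale) (simp add: h)
  qed
  show "kills 3 (\<lambda>x y. poly s (x + of_nat 3 * y + (of_nat 3 - 1) * h))" for s
    by (rule kills_eq[OF diag[of s]]) simp
  fix G assume G: "poly2 G"
  then obtain s G' where G': "poly2 G'"
    "\<And>x y. G x y = poly s (x + 3 * y + 2 * h) + (x - y - h) * G' x y"
    using poly2_mod_linear[OF G, of 3 "2 * h" h] by auto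
  show "kills 3 (\<lambda>x y. (x - y + h) * (x - y - of_nat 3 * h) * G x y)"
    by (rule kills_eq[OF kills_add[OF qdiag[of s] cofactor[OF G'(1)]]]) (simp add: G'(2) algebra_simps)
qed simp

text \<open>For \<open>m \<ge> 3\<close> the two cofactors in \<open>kills_jacobi_factors\<close> are coprime polynomials in \<open>u = x - y\<close>.\<close>

lemma bracket_rule_Suc:
  assumes m: "3 \<le> m" and rule: "bracket_rule m"
  shows "bracket_rule (Suc m)"
proof (rule bracket_ruleI)
  define M where "M = of_nat m * h"
  have nz: "M \<noteq> 0" "M - h \<noteq> 0" "M - 2 * h \<noteq> 0" "M + h \<noteq> 0" "M + 2 * h \<noteq> 0"
  proof -
    have "of_nat m + (k :: complex) \<noteq> 0" if "k = 0 \<or> k = -1 \<or> k = -2 \<or> k = 1 \<or> k = 2" for k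
    proof
      assume "of_nat m + k = 0"
      then have "of_nat m = (0 :: complex) \<or> of_nat m = (of_nat 1 :: complex) \<or> of_nat m = (of_nat 2 :: complex)
         \<or> of_nat (m + 1) = (0 :: complex) \<or> of_nat (m + 2) = (0 :: complex)"
        using that by (auto simp: add_eq_0_iff2)
      then show False using m by (simp only: of_nat_eq_iff of_nat_eq_0_iff) simp
    qed
    from this[of 0] this[of "-1"] this[of "-2"] this[of 1] this[of 2] h
    have "(of_nat m + 0) * h \<noteq> 0" "(of_nat m + (- 1)) * h \<noteq> 0" "(of_nat m + (- 2)) * h \<noteq> 0"
      "(of_nat m + 1) * h \<noteq> 0" "(of_nat m + 2) * h \<noteq> 0" by simp_all
    then show "M \<noteq> 0" "M - h \<noteq> 0" "M - 2 * h \<noteq> 0" "M + h \<noteq> 0" "M + 2 * h \<noteq> 0"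
      by (simp_all add: M_def algebra_simps)
  qed
  let ?Q = "\<lambda>x y. (x - y + h) * (x - y - M - h)"
  have quad: "kills (Suc m) (\<lambda>x y. ?Q x y * G x y)" if G: "poly2 G" for G
  proof -
    let ?f = "\<lambda>x y. (3 * M - 2 * h - 2 * (x - y)) * G x y" and ?g = "\<lambda>x y. (2 * (x - y) + M - 2 * h) * G x y"
    have P: "poly2 ?f" "poly2 ?g" by (intro poly2_intros G)+
    \<comment> \<open>a Bezout identity for \<open>u (u - h)\<close> and \<open>(u - M) (u - M + h)\<close>\<close>
    have bezout: "u * (u - h) * (q * ((3 * M - 2 * h - 2 * u) * g))
       + (u - M) * (u - M + h) * (q * ((2 * u + M - 2 * h) * g)) = M * (M - h) * (M - 2 * h) * (q * g)" for u q g
      by (simp add: algebra_simps)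
    have "kills (Suc m) (\<lambda>x y. M * (M - h) * (M - 2 * h) * (?Q x y * G x y))"
      by (rule kills_eq[OF kills_add[OF kills_jacobi_factors(1)[OF rule P(1), folded M_def]
            kills_jacobi_factors(2)[OF rule P(2), folded M_def]]]) (rule bezout)
    then show ?thesis by (rule kills_unscale) (use nz in simp)
  qed
  show "kills (Suc m) (\<lambda>x y. (x - y + h) * (x - y - of_nat (Suc m) * h) * G x y)" if "poly2 G" for G
    by (rule kills_eq[OF quad[OF that]]) (simp add: M_def algebra_simps)
  fix s
  let ?s = "\<lambda>x y. poly s (x + of_nat (Suc m) * y + M)"
  have "poly2 ?s" by (intro poly2_intros)
  from kills_diff[OF kills_jacobi_diag[OF rule, of s, folded M_def] kills_scale[OF quad[OF this], of "3 * M"]]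
  have "kills (Suc m) (\<lambda>x y. M * (M + h) * (M + 2 * h) * ?s x y)"
    by (rule kills_eq) (simp add: algebra_simps)
  then have "kills (Suc m) ?s" by (rule kills_unscale) (use nz in simp)
  then show "kills (Suc m) (\<lambda>x y. poly s (x + of_nat (Suc m) * y + (of_nat (Suc m) - 1) * h))"
    by (rule kills_eq) (simp add: M_def)
qed simp

theorem bracket_e_W: "0 < r \<Longrightarrow> comm (e p) (W r q) \<approx> W (Suc r) (twist r h p q)"
proof -
  have "bracket_rule (Suc n)" for n
  proof (induct n)
    case (Suc n)
    consider "n = 0" | "n = 1" | "3 \<le> Suc n" by linarith
    then show ?case
      using bracket_rule_2 bracket_rule_3 bracket_rule_Suc[OF _ Suc]
      by cases (simp_all add: numeral_2_eq_2 numeral_3_eq_3)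
  qed (use bracket_rule_1 in simp)
  then show "0 < r \<Longrightarrow> comm (e p) (W r q) \<approx> W (Suc r) (twist r h p q)"
    by (cases r) (auto simp: bracket_rule_def)
qed

end

section \<open>The graded Lie algebra of difference operators\<close>

text \<open>\<open>[f \<partial>\<^sup>r, g \<partial>\<^sup>s] = brk h r f s g \<partial>\<^sup>r\<^sup>+\<^sup>s + coc h r f s g c\<close>. The sign in \<open>coc\<close> is due to the convention for
  \<open>cocycle_value\<close>, whose last argument is the negative of the degree.\<close>

definition brk :: "complex \<Rightarrow> int \<Rightarrow> complex poly \<Rightarrow> int \<Rightarrow> complex poly \<Rightarrow> complex poly" where
  "brk h r f s g = f * shift (of_int r * h) g - g * shift (of_int s * h) f"

definition coc :: "complex \<Rightarrow> int \<Rightarrow> complex poly \<Rightarrow> int \<Rightarrow> complex poly \<Rightarrow> complex" where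
  "coc h r f s g = cocycle_value h f r g (- s)"

lemma poly_brk [simp]:
  "poly (brk h r f s g) x = poly f x * poly g (x + of_int r * h) - poly g x * poly f (x + of_int s * h)"
  by (simp add: brk_def)

lemma brk_linear:
  "brk h r (f + f') s g = brk h r f s g + brk h r f' s g" "brk h r f s (g + g') = brk h r f s g + brk h r f s g'"
  "brk h r (Polynomial.smult c f) s g = Polynomial.smult c (brk h r f s g)"
  "brk h r f s (Polynomial.smult c g) = Polynomial.smult c (brk h r f s g)"
  by (rule polyI; simp add: algebra_simps)+

lemma brk_swap: "brk h s g r f = - brk h r f s g"
  by (simp add: brk_def)

lemma brk_jacobi:
  "brk h (r + s) (brk h r f s g) t k = brk h r f (s + t) (brk h s g t k) - brk h s g (r + t) (brk h r f t k)"
  by (rule polyI) (simp add: algebra_simps)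

lemma coc_linear:
  "coc h r (f + f') s g = coc h r f s g + coc h r f' s g" "coc h r f s (g + g') = coc h r f s g + coc h r f s g'"
  "coc h r (Polynomial.smult c f) s g = c * coc h r f s g" "coc h r f s (Polynomial.smult c g) = c * coc h r f s g"
  "coc h r (f - f') s g = coc h r f s g - coc h r f' s g" "coc h r f s (g - g') = coc h r f s g - coc h r f s g'"
proof -
  show *: "coc h r (f + f') s g = coc h r f s g + coc h r f' s g"
    "coc h r f s (g + g') = coc h r f s g + coc h r f s g'"
    "coc h r (Polynomial.smult c f) s g = c * coc h r f s g" "coc h r f s (Polynomial.smult c g) = c * coc h r f s g"
    for f f' g g' c
    by (simp_all add: coc_def cocycle_value_lin)
  show "coc h r (f - f') s g = coc h r f s g - coc h r f' s g"
    using *(1)[of f "- f'"] *(3)[of "-1" f'] by simp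
  show "coc h r f s (g - g') = coc h r f s g - coc h r f s g'"
    using *(2)[of f g "- g'"] *(4)[of f "-1" g'] by simp
qed

text \<open>Let \<open>f \<partial>\<^sup>r\<close> act on sequences indexed by \<open>\<int>\<close>, with matrix entries \<open>f(l h)\<close> at \<open>(l, l + r)\<close>. The
  cocycle of \<open>a\<close> and \<open>b\<close> is the sum of \<open>(\<theta>(l) - \<theta>(m)) a\<^sub>l\<^sub>m b\<^sub>m\<^sub>l\<close>, where \<open>\<theta>\<close> is the indicator of
  the negative integers; formally it is the trace of \<open>[\<theta>, a] b\<close>. This form makes its cocycle
  property a cancellation of differences of \<open>\<theta>\<close>.\<close>

definition neg_ind :: "int \<Rightarrow> complex" where
  "neg_ind l = (if l < 0 then 1 else 0)"

lemma finite_neg_ind: "finite {l. (neg_ind (l + a) - neg_ind (l + b)) * z l \<noteq> 0}"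
proof (rule finite_subset)
  show "{l. (neg_ind (l + a) - neg_ind (l + b)) * z l \<noteq> 0} \<subseteq> {- \<bar>a\<bar> - \<bar>b\<bar> .. \<bar>a\<bar> + \<bar>b\<bar>}"
    by (auto simp: neg_ind_def split: if_splits)
qed simp

lemma Sum_any_shift: "Sum_any (\<lambda>l. z (l + r)) = Sum_any z" for z :: "int \<Rightarrow> complex" and r :: int
  unfolding Sum_any.expand_set
  by (rule sum.reindex_bij_witness[of _ "\<lambda>l. l - r" "\<lambda>l. l + r"]) auto

lemma coc_trace:
  assumes "s = - r"
  shows "coc h r f s g = Sum_any (\<lambda>l. (neg_ind l - neg_ind (l + r)) *
     (poly f (of_int l * h) * poly g (of_int (l + r) * h)))" (is "_ = Sum_any ?z")
proof -
  consider "r > 0" | "r < 0" | "r = 0" by linarith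
  then show ?thesis
  proof cases
    case 1
    have "Sum_any ?z = sum ?z {- r .. -1}"
      by (rule Sum_any.expand_superset) (use 1 in \<open>auto simp: neg_ind_def split: if_splits\<close>)
    also have "\<dots> = (\<Sum>l = - r .. -1. poly f (of_int l * h) * poly g (of_int (l + r) * h))"
      by (rule sum.cong) (auto simp: neg_ind_def)
    finally show ?thesis using 1 assms by (simp add: coc_def cocycle_value_def)
  next
    case 2
    have "Sum_any ?z = sum ?z {0 .. - r - 1}"
      by (rule Sum_any.expand_superset) (use 2 in \<open>auto simp: neg_ind_def split: if_splits\<close>)
    also have "\<dots> = (\<Sum>l = 0 .. - r - 1. - (poly f (of_int l * h) * poly g (of_int (l + r) * h)))"
      by (rule sum.cong) (auto simp: neg_ind_def)
    also have "\<dots> = - (\<Sum>l = 0 .. - r - 1. poly f (of_int l * h) * poly g (of_int (l + r) * h))"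
      by (rule sum_negf)
    also have "(\<Sum>l = 0 .. - r - 1. poly f (of_int l * h) * poly g (of_int (l + r) * h))
      = (\<Sum>l = r .. -1. poly g (of_int l * h) * poly f (of_int (l - r) * h))"
      by (rule sum.reindex_bij_witness[of _ "\<lambda>l. l - r" "\<lambda>l. l + r"]) auto
    finally show ?thesis using 2 assms by (simp add: coc_def cocycle_value_def)
  next
    case 3
    then show ?thesis using assms by (simp add: coc_def cocycle_value_def)
  qed
qed

lemma coc_zero: "r + s \<noteq> 0 \<Longrightarrow> coc h r f s g = 0"
  by (auto simp: coc_def cocycle_value_def)

lemma coc_swap: "coc h s g r f = - coc h r f s g"
proof (cases "r + s = 0")
  case True
  then have s: "s = - r" "r = - s" by simp_all
  let ?z = "\<lambda>l. (neg_ind l - neg_ind (l + s)) * (poly g (of_int l * h) * poly f (of_int (l + s) * h))"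
  have "coc h s g r f = Sum_any (\<lambda>l. ?z (l + r))"
    unfolding coc_trace[OF s(2)] Sum_any_shift[of ?z r] ..
  also have "\<dots> = Sum_any (\<lambda>l. - ((neg_ind l - neg_ind (l + r)) *
      (poly f (of_int l * h) * poly g (of_int (l + r) * h))))"
    by (rule arg_cong[of _ _ Sum_any]) (simp add: fun_eq_iff s(1) algebra_simps)
  also have "\<dots> = - coc h r f s g"
    unfolding coc_trace[OF s(1)] Sum_any.expand_set by (simp add: sum_negf)
  finally show ?thesis .
qed (simp add: coc_zero)

text \<open>The three factors \<open>\<theta>(l) - \<theta>(m)\<close>, \<open>\<theta>(m) - \<theta>(n)\<close>, \<open>\<theta>(n) - \<theta>(l)\<close> around a cycle of indices add up to zero.\<close>

lemma coc_cyclic: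
  assumes sum: "r + s + t = 0"
  shows "coc h (r + s) (f * shift (of_int r * h) g) t k
    = coc h r f (s + t) (g * shift (of_int s * h) k) + coc h s g (t + r) (k * shift (of_int t * h) f)"
proof -
  let ?p = "\<lambda>l. poly f (of_int l * h) * (poly g (of_int (l + r) * h) * poly k (of_int (l + (r + s)) * h))"
  let ?d = "\<lambda>a b l. (neg_ind (l + a) - neg_ind (l + b)) * ?p l"
  have t: "t = - r - s" using sum by simp
  have 1: "coc h (r + s) (f * shift (of_int r * h) g) t k = Sum_any (?d 0 (r + s))"
    by (subst coc_trace) (simp_all add: t algebra_simps)
  have 2: "coc h r f (s + t) (g * shift (of_int s * h) k) = Sum_any (?d 0 r)"
    by (subst coc_trace) (simp_all add: t algebra_simps)
  let ?z = "\<lambda>l. (neg_ind l - neg_ind (l + s)) * (poly g (of_int l * h) *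
     poly (k * shift (of_int t * h) f) (of_int (l + s) * h))"
  have "coc h s g (t + r) (k * shift (of_int t * h) f) = Sum_any (\<lambda>l. ?z (l + r))"
    unfolding Sum_any_shift[of ?z r] by (rule coc_trace) (simp add: t)
  also have "\<dots> = Sum_any (?d r (r + s))"
    by (rule arg_cong[of _ _ Sum_any]) (simp add: fun_eq_iff t algebra_simps)
  finally have 3: "coc h s g (t + r) (k * shift (of_int t * h) f) = Sum_any (?d r (r + s))" .
  have "Sum_any (?d 0 r) + Sum_any (?d r (r + s)) = Sum_any (\<lambda>l. ?d 0 r l + ?d r (r + s) l)"
    by (rule Sum_any.distrib[symmetric]) (rule finite_neg_ind)+
  also have "\<dots> = Sum_any (?d 0 (r + s))" by (simp add: algebra_simps)
  finally show ?thesis unfolding 1 2 3 ..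
qed

lemma coc_jacobi:
  "coc h (r + s) (brk h r f s g) t k = coc h r f (s + t) (brk h s g t k) - coc h s g (r + t) (brk h r f t k)"
proof (cases "r + s + t = 0")
  case True
  then have *: "s + r + t = 0" by simp
  show ?thesis
    using coc_cyclic[OF True, of h f g k] coc_cyclic[OF *, of h g f k]
    by (simp add: brk_def coc_linear add.commute)
next
  case False
  then have "r + (s + t) \<noteq> 0" "s + (r + t) \<noteq> 0" by auto
  then show ?thesis using False by (simp add: coc_zero)
qed

text \<open>This identity is the source of the recursion for \<open>W\<close>. It also shows that degree \<open>r + 1\<close> is spanned by
  brackets of the degrees \<open>1\<close> and \<open>r\<close>.\<close>

lemma brk_recursion:
  assumes h: "h \<noteq> 0" and r: "0 < r"
  shows "Polynomial.smult (- 1 / ((of_int r + 1) * h))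
    (brk h 1 ((px - [:of_int r * h:]) * k) r 1 - brk h 1 k r px) = k"
proof (rule polyI)
  fix x
  let ?r = "of_int r :: complex"
  have "?r + 1 \<noteq> 0"
    using r by (metis add_pos_pos of_int_1 of_int_add of_int_eq_0_iff zero_less_one less_irrefl)
  then have c: "- 1 / ((?r + 1) * h) * (- ((?r + 1) * h) * y) = y" for y using h by simp
  have "poly (brk h 1 ((px - [:?r * h:]) * k) r 1 - brk h 1 k r px) x = - ((?r + 1) * h) * poly k x"
    by (simp add: algebra_simps)
  then show "poly (Polynomial.smult (- 1 / ((of_int r + 1) * h))
    (brk h 1 ((px - [:of_int r * h:]) * k) r 1 - brk h 1 k r px)) x = poly k x"
    by (simp only: poly_smult c)
qed

lemma brk_span:
  assumes "h \<noteq> 0" "0 < r"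
  shows "\<exists>f g f' g'. k = brk h 1 f r g + brk h 1 f' r g'"
proof -
  let ?c = "- 1 / ((of_int r + 1) * h)"
  have split: "brk h 1 (Polynomial.smult c f) r 1 + brk h 1 (Polynomial.smult (- c) k) r px
     = Polynomial.smult c (brk h 1 f r 1 - brk h 1 k r px)" for c f
    unfolding brk_linear(3) by (simp add: smult_diff_right)
  have "brk h 1 (Polynomial.smult ?c ((px - [:of_int r * h:]) * k)) r 1 + brk h 1 (Polynomial.smult (- ?c) k) r px = k"
    unfolding split by (rule brk_recursion[OF assms])
  then show ?thesis by metis
qed

lemma brk_span_neg:
  assumes "h \<noteq> 0" "r < 0"
  shows "\<exists>f g f' g'. k = brk h (-1) f r g + brk h (-1) f' r g'"
  using brk_span[of "- h" "- r" k] assms by (simp add: brk_def)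

text \<open>The generator \<open>\<psi>\<^sub>j\<close> is to become \<open>p(x - h) - p(x) - p(- h) c\<close> for \<open>p = x\<^sup>j\<close>, so an element \<open>g(x)\<close> of
  degree zero is hit by the discrete primitive \<open>p\<close> of \<open>g\<close> that vanishes at \<open>- h\<close>. In its construction the products \<open>x (x + h) \<dots> (x + (n - 1) h)\<close> play the role of powers of \<open>x\<close>: their differences are multiples of
  the preceding product.\<close>

lemma discrete_primitive_exists:
  assumes h: "h \<noteq> 0"
  shows "\<exists>p. shift (- h) p - p = g \<and> poly p (- h) = 0"
proof -
  define P where "P n = (\<Prod>i<n. [:of_nat i * h, 1:])" for n
  have P_Suc: "P (Suc n) = P n * [:of_nat n * h, 1:]" for n by (simp add: P_def)
  have P_shift: "shift (- h) (P (Suc n)) = P n * (px - [:h:])" for n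
  proof (induct n)
    case 0
    show ?case by (rule polyI) (simp add: P_def)
  next
    case (Suc n)
    show ?case
    proof (rule polyI)
      fix x
      have "poly (shift (- h) (P (Suc (Suc n)))) x = poly (shift (- h) (P (Suc n))) x * (x + of_nat n * h)"
        by (subst P_Suc) (simp add: algebra_simps)
      also have "poly (shift (- h) (P (Suc n))) x = poly (P n * (px - [:h:])) x" by (simp only: Suc)
      also have "\<dots> * (x + of_nat n * h) = poly (P (Suc n) * (px - [:h:])) x"
        unfolding P_Suc by (simp add: algebra_simps)
      finally show "poly (shift (- h) (P (Suc (Suc n)))) x = poly (P (Suc n) * (px - [:h:])) x" .
    qed
  qed
  have P: "\<exists>p. shift (- h) p - p = P n * g" for n
  proof (induct g arbitrary: n)
    case 0
    show ?case by (intro exI[of _ 0]) (simp add: shift_linear)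
  next
    case (pCons a g)
    obtain p p' where p: "shift (- h) p - p = P (Suc n) * g" "shift (- h) p' - p' = P n * g"
      using pCons(2) by metis
    let ?c = "- a / (of_nat (Suc n) * h)"
    let ?q = "p - Polynomial.smult (of_nat n * h) p' + Polynomial.smult ?c (P (Suc n))"
    have c: "?c * - (of_nat (Suc n) * h) = a" using h by (simp del: of_nat_Suc)
    have "shift (- h) ?q - ?q = (shift (- h) p - p) - Polynomial.smult (of_nat n * h) (shift (- h) p' - p')
       + Polynomial.smult ?c (shift (- h) (P (Suc n)) - P (Suc n))"
      by (rule polyI) (simp add: algebra_simps)
    also have "\<dots> = P n * pCons a g"
    proof (rule polyI)
      fix x
      have "poly (shift (- h) (P (Suc n)) - P (Suc n)) x = poly (P n) x * - (of_nat (Suc n) * h)"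
        unfolding P_shift unfolding P_Suc by (simp add: algebra_simps)
      then have "?c * poly (shift (- h) (P (Suc n)) - P (Suc n)) x = a * poly (P n) x"
        using c by (metis mult.assoc mult.commute)
      then show "poly ((shift (- h) p - p) - Polynomial.smult (of_nat n * h) (shift (- h) p' - p')
          + Polynomial.smult ?c (shift (- h) (P (Suc n)) - P (Suc n))) x = poly (P n * pCons a g) x"
        unfolding p by (simp add: P_Suc algebra_simps)
    qed
    finally show ?case by blast
  qed
  then obtain p where "shift (- h) p - p = P 0 * g" by blast
  then have "shift (- h) (p - [:poly p (- h):]) - (p - [:poly p (- h):]) = g"
    by (simp add: P_def shift_linear) (simp add: shift_def)
  then show ?thesis by (intro exI[of _ "p - [:poly p (- h):]"]) simp
qed

lemma discrete_primitive_unique: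
  assumes h: "h \<noteq> 0" and pq: "shift (- h) p - p = shift (- h) q - q" and at: "poly p (- h) = poly q (- h)"
  shows "p = q"
proof (rule ccontr)
  assume "p \<noteq> q"
  then have fin: "finite {x. poly (p - q) x = 0}" by (intro poly_roots_finite) simp
  have step: "poly (p - q) (x - h) = poly (p - q) x" for x
    using arg_cong[OF pq, of "\<lambda>p. poly p x"] by (simp add: algebra_simps)
  have "poly (p - q) (- h - of_nat n * h) = 0" for n
  proof (induct n)
    case (Suc n)
    then show ?case using step[of "- h - of_nat n * h"] by (simp add: algebra_simps)
  qed (use at in simp)
  then have "finite (range (\<lambda>n. - h - of_nat n * h))" by (intro finite_subset[OF _ fin]) auto
  moreover have "inj (\<lambda>n. - h - of_nat n * h)" using h by (auto simp: inj_def)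
  ultimately show False using finite_imageD infinite_UNIV_nat by blast
qed

definition primitive :: "complex \<Rightarrow> complex poly \<Rightarrow> complex poly" where
  "primitive h g = (THE p. shift (- h) p - p = g \<and> poly p (- h) = 0)"

lemma primitive:
  assumes h: "h \<noteq> 0"
  shows "shift (- h) (primitive h g) - primitive h g = g" "poly (primitive h g) (- h) = 0"
proof -
  have "\<exists>!p. shift (- h) p - p = g \<and> poly p (- h) = 0"
    using discrete_primitive_exists[OF h] discrete_primitive_unique[OF h] by metis
  then have "shift (- h) (primitive h g) - primitive h g = g \<and> poly (primitive h g) (- h) = 0"
    unfolding primitive_def by (rule theI')
  then show "shift (- h) (primitive h g) - primitive h g = g" "poly (primitive h g) (- h) = 0" by auto
qed

lemma primitiveI:
  assumes "h \<noteq> 0" "shift (- h) p - p = g" "poly p (- h) = 0"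
  shows "primitive h g = p"
  using discrete_primitive_unique[OF assms(1)] primitive[OF assms(1)] assms by metis

lemma primitive_linear:
  assumes h: "h \<noteq> 0"
  shows "primitive h (f + g) = primitive h f + primitive h g"
    "primitive h (Polynomial.smult c g) = Polynomial.smult c (primitive h g)"
proof -
  note p = primitive[OF h]
  show "primitive h (f + g) = primitive h f + primitive h g"
    using p(1)[of f] p(1)[of g] p(2)
    by (intro primitiveI h) (simp_all add: shift_linear add_diff_add)
  show "primitive h (Polynomial.smult c g) = Polynomial.smult c (primitive h g)"
    using p(1)[of g] p(2)
    by (intro primitiveI h) (simp_all add: shift_linear flip: smult_diff_right)
qed

section \<open>Extending the bracket rule to all degrees\<close>

text \<open>\<open>H r f\<close> stands for \<open>f(x) \<partial>\<^sup>r\<close> and \<open>C\<close> for the central element.\<close>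

locale graded_family = two_sided I for I :: "'g ncpoly set" +
  fixes H :: "int \<Rightarrow> complex poly \<Rightarrow> 'g ncpoly" and C :: "'g ncpoly" and h :: complex
  assumes h: "h \<noteq> 0" and linear_H: "linear_map (H r)" and central: "comm C (H r f) \<in> I"
begin

definition rule_holds :: "int \<Rightarrow> int \<Rightarrow> bool" where
  "rule_holds r s \<longleftrightarrow> (\<forall>f g. comm (H r f) (H s g) \<approx> H (r + s) (brk h r f s g) + const (coc h r f s g) * C)"

lemma rule_holds_swap: "rule_holds r s \<Longrightarrow> rule_holds s r"
  unfolding rule_holds_def
proof (intro allI)
  fix f g
  assume "\<forall>f g. comm (H r f) (H s g) \<approx> H (r + s) (brk h r f s g) + const (coc h r f s g) * C"
  then have "- comm (H r g) (H s f) \<approx> - (H (r + s) (brk h r g s f) + const (coc h r g s f) * C)"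
    by (intro cong_uminus) blast
  then show "comm (H s f) (H r g) \<approx> H (s + r) (brk h s f r g) + const (coc h s f r g) * C"
    by (simp add: comm_swap[of "H s f"] brk_swap[of h s f] coc_swap[of h s f] const_hom
        linear_map_uminus[OF linear_H] add.commute)
qed

lemma comm_C: "comm (H r f) (z + const c * C) \<approx> comm (H r f) z" "comm (z + const c * C) (H r f) \<approx> comm z (H r f)"
proof -
  have 1: "const c * comm C (H r f) \<in> I" by (intro left central)
  then show "comm (z + const c * C) (H r f) \<approx> comm z (H r f)"
    by (simp add: comm_linear cong_def)
  show "comm (H r f) (z + const c * C) \<approx> comm (H r f) z"
    using uminus[OF 1] by (simp add: comm_linear cong_def comm_swap[of "H r f" C])
qed

text \<open>The Jacobi identity propagates the bracket rule to the degree of a sum.\<close>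

lemma rule_holds_step:
  assumes rr: "rule_holds r r'" and r's: "rule_holds r' s" and rs: "rule_holds r s"
    and r_r's: "rule_holds r (r' + s)" and r'_rs: "rule_holds r' (r + s)"
    and span: "\<And>k. \<exists>f g f' g'. k = brk h r f r' g + brk h r f' r' g'"
  shows "rule_holds (r + r') s"
proof -
  note rule = rule_holds_def[THEN iffD1, rule_format]
  have one: "comm (H (r + r') (brk h r f r' g)) (H s k)
     \<approx> H (r + r' + s) (brk h (r + r') (brk h r f r' g) s k) + const (coc h (r + r') (brk h r f r' g) s k) * C"
    for f g k
  proof -
    have "comm (H (r + r') (brk h r f r' g)) (H s k)
       \<approx> comm (H (r + r') (brk h r f r' g) + const (coc h r f r' g) * C) (H s k)"
      by (rule cong_sym[OF comm_C(2)])
    also have "\<dots> \<approx> comm (comm (H r f) (H r' g)) (H s k)"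
      by (rule cong_comm[OF cong_sym[OF rule[OF rr]] cong_refl])
    also have "\<dots> = comm (H r f) (comm (H r' g) (H s k)) - comm (H r' g) (comm (H r f) (H s k))"
      by (rule comm_jacobi)
    also have "\<dots> \<approx> comm (H r f) (H (r' + s) (brk h r' g s k)) - comm (H r' g) (H (r + s) (brk h r f s k))"
      by (rule cong_diff[OF cong_trans[OF cong_comm[OF cong_refl rule[OF r's]] comm_C(1)]
            cong_trans[OF cong_comm[OF cong_refl rule[OF rs]] comm_C(1)]])
    also have "\<dots> \<approx> (H (r + (r' + s)) (brk h r f (r' + s) (brk h r' g s k))
          + const (coc h r f (r' + s) (brk h r' g s k)) * C)
        - (H (r' + (r + s)) (brk h r' g (r + s) (brk h r f s k))
          + const (coc h r' g (r + s) (brk h r f s k)) * C)"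
      by (rule cong_diff[OF rule[OF r_r's] rule[OF r'_rs]])
    also have "\<dots> = H (r + r' + s) (brk h (r + r') (brk h r f r' g) s k)
        + const (coc h (r + r') (brk h r f r' g) s k) * C"
      by (simp add: brk_jacobi coc_jacobi linear_map_diff[OF linear_H] const_hom algebra_simps)
    finally show ?thesis .
  qed
  show ?thesis
    unfolding rule_holds_def
  proof (intro allI)
    fix k k'
    obtain f g f' g' where k: "k = brk h r f r' g + brk h r f' r' g'" using span by blast
    show "comm (H (r + r') k) (H s k') \<approx> H (r + r' + s) (brk h (r + r') k s k') + const (coc h (r + r') k s k') * C"
      using cong_add[OF one[of f g k'] one[of f' g' k']]
      by (simp add: k linear_map_add[OF linear_H] comm_linear brk_linear coc_linear const_hom algebra_simps)
  qed
qed

text \<open>Elements of degree \<open>\<sigma> n\<close> are sums of brackets of degrees \<open>\<sigma>\<close> and \<open>\<sigma> (n - 1)\<close>. By the Jacobi identity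
  their bracket with an element of degree \<open>- \<sigma>\<close> only involves the brackets of degrees \<open>\<sigma>\<close> and \<open>- \<sigma>\<close> and
  elements of degree closer to zero.\<close>

lemma rule_holds_opposite:
  fixes \<sigma> :: int
  assumes span: "\<And>n k. 0 < n \<Longrightarrow> \<exists>f g f' g'. k = brk h \<sigma> f (\<sigma> * int n) g + brk h \<sigma> f' (\<sigma> * int n) g'"
    and same: "\<And>n. 0 < n \<Longrightarrow> rule_holds \<sigma> (\<sigma> * int n)"
    and opp: "rule_holds \<sigma> (- \<sigma>)" and zero: "rule_holds \<sigma> 0"
  shows "rule_holds (\<sigma> * int (Suc n)) 0" "rule_holds (\<sigma> * int (Suc n)) (- \<sigma>)"
proof -
  have deg: "\<sigma> + \<sigma> * int (Suc n) = \<sigma> * int (Suc (Suc n))" "\<sigma> * int (Suc n) + - \<sigma> = \<sigma> * int n" for n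
    by (simp_all add: algebra_simps)
  show z: "rule_holds (\<sigma> * int (Suc n)) 0" for n
  proof (induct n)
    case (Suc n)
    have "rule_holds (\<sigma> + \<sigma> * int (Suc n)) 0"
      by (rule rule_holds_step)
        (use Suc zero same[of "Suc n"] span[of "Suc n"] rule_holds_swap[OF same[of "Suc n"]] in simp_all)
    then show ?case by (simp only: deg)
  qed (use zero in simp)
  show "rule_holds (\<sigma> * int (Suc n)) (- \<sigma>)"
  proof (induct n)
    case (Suc n)
    have "rule_holds (\<sigma> + \<sigma> * int (Suc n)) (- \<sigma>)"
    proof (rule rule_holds_step)
      show "rule_holds \<sigma> (\<sigma> * int (Suc n) + - \<sigma>)"
        unfolding deg using same[of n] zero by (cases "n = 0") simp_all
      show "rule_holds (\<sigma> * int (Suc n)) (\<sigma> + - \<sigma>)" using z[of n] by simp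
    qed (use Suc opp same[of "Suc n"] span[of "Suc n"] in auto)
    then show ?case by (simp only: deg)
  qed (use opp in simp)
qed

lemma rule_holds_multiple:
  fixes \<sigma> :: int
  assumes span: "\<And>n k. 0 < n \<Longrightarrow> \<exists>f g f' g'. k = brk h \<sigma> f (\<sigma> * int n) g + brk h \<sigma> f' (\<sigma> * int n) g'"
    and all: "\<And>s. rule_holds \<sigma> s"
  shows "rule_holds (\<sigma> * int (Suc n)) s"
proof (induct n arbitrary: s)
  case (Suc n)
  have "rule_holds (\<sigma> + \<sigma> * int (Suc n)) s"
    by (rule rule_holds_step) (use all Suc span[of "Suc n"] in auto)
  moreover have "\<sigma> + \<sigma> * int (Suc n) = \<sigma> * int (Suc (Suc n))" by (simp add: algebra_simps)
  ultimately show ?case by simp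
qed (use all in simp)

lemma rule_holds_all:
  assumes pos: "\<And>s. 1 \<le> s \<Longrightarrow> rule_holds 1 s" and neg: "\<And>s. s \<le> -1 \<Longrightarrow> rule_holds (-1) s"
    and z: "rule_holds 1 (-1)" "rule_holds 1 0" "rule_holds (-1) 0" "rule_holds 0 0"
  shows "rule_holds r s"
proof -
  have span: "\<exists>f g f' g'. k = brk h 1 f (1 * int n) g + brk h 1 f' (1 * int n) g'" if "0 < n" for n k
    using brk_span[OF h, of "int n" k] that by simp
  have span_neg: "\<exists>f g f' g'. k = brk h (-1) f (-1 * int n) g + brk h (-1) f' (-1 * int n) g'" if "0 < n" for n k
    using brk_span_neg[OF h, of "- int n" k] that by simp
  have sign: "s = 0 \<or> (\<exists>n. s = 1 * int (Suc n)) \<or> (\<exists>n. s = -1 * int (Suc n))" for s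
  proof (cases s rule: int_cases3)
    case (pos n)
    then show ?thesis by (cases n) auto
  next
    case (neg n)
    then show ?thesis by (cases n) auto
  qed simp
  have "rule_holds 1 (1 * int n)" "rule_holds (-1) (-1 * int n)" if "0 < n" for n
    using that pos[of "int n"] neg[of "- int n"] by simp_all
  note p = rule_holds_opposite[of 1, OF span this(1) z(1,2)]
    and n = rule_holds_opposite[of "-1", OF span_neg this(2) _ z(3)]
  have n': "rule_holds (-1 * int (Suc k)) 0" "rule_holds (-1 * int (Suc k)) 1" for k
    using n[of k] rule_holds_swap[OF z(1)] by simp_all
  have one: "rule_holds 1 s" for s
    using sign[of s] pos[of s] z(2) rule_holds_swap[OF n'(2)] by auto
  have minus_one: "rule_holds (-1) s" for s
    using sign[of s] neg[of s] z(3) rule_holds_swap[OF p(2)] by auto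
  have zero: "rule_holds 0 s" for s
    using sign[of s] z(4) rule_holds_swap[OF p(1)] rule_holds_swap[OF n'(1)] by auto
  show ?thesis
    using sign[of r] zero rule_holds_multiple[of 1, OF span one] rule_holds_multiple[of "-1", OF span_neg minus_one]
    by auto
qed

end

section \<open>Solutions of the relations of the Yangian\<close>

lemma linear_map_intros:
  assumes f: "linear_map f"
  shows "linear_map g \<Longrightarrow> linear_map (\<lambda>p. f p + g p)" "linear_map g \<Longrightarrow> linear_map (\<lambda>p. f p - g p)"
    "linear_map (\<lambda>p. - f p)" "linear_map (\<lambda>p. const c * f p)" "linear_map (\<lambda>p. numeral n * f p)"
    "linear_map (\<lambda>p. comm (f p) a)" "linear_map (\<lambda>p. comm a (f p))"
    "linear_map (\<lambda>p. f (q * p))" "linear_map (\<lambda>p. f (p * q))" "linear_map (\<lambda>p. f (shift k p))"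
proof -
  note f = linear_map_simps[OF f]
  show c: "linear_map (\<lambda>p. const c * f p)" for c
    by (rule linear_mapI)
      (simp_all add: f distrib_left mult.assoc[symmetric] const_hom(4)[symmetric] mult.commute[of c])
  show "linear_map (\<lambda>p. numeral n * f p)"
    using c[of "numeral n"] by (simp only: const_numeral)
  show "linear_map g \<Longrightarrow> linear_map (\<lambda>p. f p + g p)"
    by (rule linear_mapI) (simp_all add: f linear_map_simps distrib_left)
  show "linear_map g \<Longrightarrow> linear_map (\<lambda>p. f p - g p)"
    by (rule linear_mapI) (simp_all add: f linear_map_simps right_diff_distrib)
  show "linear_map (\<lambda>p. - f p)" "linear_map (\<lambda>p. comm (f p) a)" "linear_map (\<lambda>p. comm a (f p))"
    "linear_map (\<lambda>p. f (q * p))" "linear_map (\<lambda>p. f (p * q))" "linear_map (\<lambda>p. f (shift k p))"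
    by (rule linear_mapI; simp add: f comm_linear distrib_left distrib_right shift_linear)+
qed

lemma px_power: "px ^ k = monom 1 k"
  by (simp add: monom_altdef)

lemma linear_map_eqI:
  assumes "linear_map f" "linear_map g" "\<And>k. f (px ^ k) = g (px ^ k)"
  shows "f p = g p"
  using linear_map_monoms[OF assms(1), of p] linear_map_monoms[OF assms(2), of p] assms(3)
  by (simp add: px_power)

lemma linear_map_mult:
  assumes f: "linear_map f"
  shows "linear_map (\<lambda>p. a * f p)" "linear_map (\<lambda>p. f p * a)"
proof -
  have "a * (const c * b) = const c * (a * b)" for c b
    by (metis const_mult_commute mult.assoc)
  then show "linear_map (\<lambda>p. a * f p)"
    by (intro linear_mapI) (simp_all only: linear_map_simps[OF f] distrib_left)
  show "linear_map (\<lambda>p. f p * a)"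
    by (intro linear_mapI) (simp_all only: linear_map_simps[OF f] distrib_right mult.assoc)
qed

lemma lin_px: "lin a (px ^ k) = a k"
  by (simp add: px_power lin_monom const_hom)

lemma lin_px_mult: "lin a (px ^ n * px ^ k) = a (k + n)" "lin a (px * px ^ k) = a (k + 1)"
  using lin_px[of a "k + n"] lin_px[of a "k + 1"] by (simp_all add: power_add mult.commute)

lemma lin_uminus: "lin (\<lambda>k. - a k) p = - lin a p"
  by (simp add: lin_def sum_negf)

lemma subst_sum: "subst \<phi> (sum g A) = (\<Sum>x\<in>A. subst \<phi> (g x))"
  by (induct A rule: infinite_finite_induct) (simp_all add: subst_simps)

lemma subst_lin: "subst \<phi> (lin a p) = lin (\<lambda>k. subst \<phi> (a k)) p"
  by (simp add: lin_def subst_simps subst_sum)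

context two_sided
begin

lemma sum_mem: "(\<And>x. x \<in> A \<Longrightarrow> f x \<in> I) \<Longrightarrow> sum f A \<in> I"
  by (induct A rule: infinite_finite_induct) (auto intro: zero add)

lemma linear_map_mem:
  assumes f: "linear_map f" and "\<And>k. f (px ^ k) \<in> I"
  shows "f p \<in> I"
  unfolding linear_map_monoms[OF f, of p] using assms(2) by (auto simp: px_power intro!: sum_mem left)

lemma linear_map_cong:
  assumes "linear_map f" "linear_map g" "\<And>k. f (px ^ k) \<approx> g (px ^ k)"
  shows "f p \<approx> g p"
  using linear_map_mem[OF linear_map_intros(2)[OF assms(1,2)]] assms(3) by (simp add: cong_def)

text \<open>The relations between the generators concern monomials; multilinearity extends them to polynomials.\<close>

lemma current_algebraI:
  assumes h: "h \<noteq> 0" and cubic: "\<And>i j. cubic_rel h a a i j \<in> I"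
    and serre: "\<And>i j k. serre_rel a i j k \<in> I"
  shows "current_algebra I (lin a) h"
proof
  note l = linear_lin[of a]
  show "linear_map (lin a)" by (rule l)
  show "h \<noteq> 0" by (rule h)
  show "comm (lin a (px ^ 3 * p)) (lin a q) - 3 * comm (lin a (px ^ 2 * p)) (lin a (px * q))
        + 3 * comm (lin a (px * p)) (lin a (px ^ 2 * q)) - comm (lin a p) (lin a (px ^ 3 * q))
        - const (h\<^sup>2) * (comm (lin a (px * p)) (lin a q) - comm (lin a p) (lin a (px * q))) \<in> I" (is "?T p q \<in> I") for p q
  proof (rule linear_map_mem[where f = "\<lambda>p. ?T p q"])
    fix i
    show "?T (px ^ i) q \<in> I"
    proof (rule linear_map_mem[where f = "?T (px ^ i)"])
      show "?T (px ^ i) (px ^ j) \<in> I" for j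
        unfolding lin_px_mult lin_px using cubic[of i j] by (simp only: cubic_rel_def)
    qed (intro linear_map_intros l)
  qed (intro linear_map_intros l)
  show "comm (lin a p) (comm (lin a q) (lin a (px * s)) + comm (lin a s) (lin a (px * q)))
        + comm (lin a q) (comm (lin a p) (lin a (px * s)) + comm (lin a s) (lin a (px * p)))
        + comm (lin a s) (comm (lin a p) (lin a (px * q)) + comm (lin a q) (lin a (px * p))) \<in> I" (is "?S p q s \<in> I") for p q s
  proof (rule linear_map_mem[where f = "\<lambda>p. ?S p q s"])
    fix i
    show "?S (px ^ i) q s \<in> I"
    proof (rule linear_map_mem[where f = "\<lambda>q. ?S (px ^ i) q s"])
      fix j
      show "?S (px ^ i) (px ^ j) s \<in> I"
      proof (rule linear_map_mem[where f = "\<lambda>s. ?S (px ^ i) (px ^ j) s"])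
        fix k
        show "?S (px ^ i) (px ^ j) (px ^ k) \<in> I"
          unfolding lin_px_mult lin_px using serre[of i j k]
          by (simp add: serre_rel_def Let_def comm_linear algebra_simps)
      qed (intro linear_map_intros l)
    qed (intro linear_map_intros l)
  qed (intro linear_map_intros l)
qed

end

text \<open>The brackets of a family with this rule are known, so the relations of the Yangian for its elements
  become identities between polynomials. Both the Yangian and the enveloping algebra contain such a family.\<close>

locale full_family = graded_family +
  assumes rule: "comm (H r f) (H s g) \<approx> H (r + s) (brk h r f s g) + const (coc h r f s g) * C"
begin

lemma rule0: "r + s \<noteq> 0 \<Longrightarrow> comm (H r f) (H s g) \<approx> H (r + s) (brk h r f s g)"
  using rule[of r f s g] by (simp add: coc_zero const_hom)

lemma cubic_rel_mem:
  assumes K: "linear_map K" and ab: "\<And>i j. comm (a i) (b j) \<approx> K (c i j)"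
    and "c (i + 3) j - Polynomial.smult 3 (c (i + 2) (j + 1)) + Polynomial.smult 3 (c (i + 1) (j + 2)) - c i (j + 3)
      - Polynomial.smult (h\<^sup>2) (c (i + 1) j - c i (j + 1)) = 0"
  shows "cubic_rel h a b i j \<in> I"
proof -
  have "cubic_rel h a b i j \<approx> K (c (i + 3) j) - const 3 * K (c (i + 2) (j + 1)) + const 3 * K (c (i + 1) (j + 2))
     - K (c i (j + 3)) - const (h\<^sup>2) * (K (c (i + 1) j) - K (c i (j + 1)))"
    unfolding cubic_rel_def const_numeral[symmetric] by (intro cong_diff cong_add cong_scale ab)
  also have "\<dots> = K 0" by (simp only: assms(3)[symmetric] linear_map_simps[OF K])
  also have "\<dots> = 0" by (rule linear_map_zero[OF K])
  finally show ?thesis by (simp only: cong_0)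
qed

lemma yangian_rels_hold:
  assumes x_e: "\<And>j. x (E j) \<approx> H 1 (px ^ j)"
    and x_f: "\<And>j. x (F j) \<approx> H (-1) (- ((px - [:h:]) ^ j))"
    and x_psi: "\<And>j. x (Psi j) \<approx> H 0 ((px - [:h:]) ^ j - px ^ j) + const (- ((- h) ^ j)) * C"
    and p: "p \<in> yangian_rels h"
  shows "subst x p \<in> I"
proof -
  let ?f = "\<lambda>j. - ((px - [:h:]) ^ j)" and ?p = "\<lambda>j. (px - [:h:]) ^ j - px ^ j"
  have psi: "comm (x (Psi i)) z \<approx> comm (H 0 (?p i)) z"
    if "z = H r g" for i z r g
    using cong_trans[OF cong_comm[OF x_psi cong_refl] comm_C(2)] that by blast
  have ee: "comm (x (E i)) (x (E j)) \<approx> H 2 (brk h 1 (px ^ i) 1 (px ^ j))" for i j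
    using cong_trans[OF cong_comm[OF x_e x_e] rule0] by simp
  have ff: "comm (x (F i)) (x (F j)) \<approx> H (-2) (brk h (-1) (?f i) (-1) (?f j))" for i j
    using cong_trans[OF cong_comm[OF x_f x_f] rule0] by simp
  have pe: "comm (x (Psi i)) (x (E j)) \<approx> H 1 (brk h 0 (?p i) 1 (px ^ j))" for i j
    using cong_trans[OF cong_trans[OF cong_comm[OF cong_refl x_e] psi[OF refl]] rule0] by simp
  have pf: "comm (x (Psi i)) (x (F j)) \<approx> H (-1) (brk h 0 (?p i) (-1) (?f j))" for i j
    using cong_trans[OF cong_trans[OF cong_comm[OF cong_refl x_f] psi[OF refl]] rule0] by simp
  have pp: "comm (x (Psi i)) (x (Psi j)) \<approx> 0" for i j
  proof -
    have "comm (x (Psi i)) (x (Psi j)) \<approx> comm (x (Psi i)) (H 0 (?p j) + const (- ((- h) ^ j)) * C)"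
      by (rule cong_comm[OF cong_refl x_psi])
    also have "\<dots> \<approx> comm (H 0 (?p i) + const (- ((- h) ^ i)) * C) (H 0 (?p j) + const (- ((- h) ^ j)) * C)"
      by (rule cong_comm[OF x_psi cong_refl])
    also have "\<dots> \<approx> comm (H 0 (?p i) + const (- ((- h) ^ i)) * C) (H 0 (?p j))"
      using comm_C(1)[of 0 "?p i"] left[OF central[of 0 "?p j"]] comm_linear(11)[of C]
      by (simp add: comm_linear cong_def comm_swap[of "H 0 (?p i)" C] uminus left central)
    also have "\<dots> \<approx> comm (H 0 (?p i)) (H 0 (?p j))" by (rule comm_C(2))
    also have "\<dots> \<approx> H (0 + 0) (brk h 0 (?p i) 0 (?p j)) + const (coc h 0 (?p i) 0 (?p j)) * C" by (rule rule)
    also have "\<dots> = 0"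
      by (simp add: brk_def shift_linear coc_def cocycle_value_def const_hom linear_map_zero[OF linear_H])
    finally show ?thesis .
  qed
  have ef: "comm (x (E i)) (x (F j)) \<approx> x (Psi (i + j))" for i j
  proof -
    have "comm (x (E i)) (x (F j)) \<approx> comm (H 1 (px ^ i)) (H (-1) (?f j))" by (rule cong_comm[OF x_e x_f])
    also have "\<dots> \<approx> H (1 + -1) (brk h 1 (px ^ i) (-1) (?f j)) + const (coc h 1 (px ^ i) (-1) (?f j)) * C"
      by (rule rule)
    also have "brk h 1 (px ^ i) (-1) (?f j) = ?p (i + j)"
      by (rule polyI) (simp add: power_add algebra_simps)
    also have "coc h 1 (px ^ i) (-1) (?f j) = - ((- h) ^ (i + j))"
      by (simp add: coc_def cocycle_value_def power_add)
    also have "H (1 + -1) (?p (i + j)) + const (- ((- h) ^ (i + j))) * C \<approx> x (Psi (i + j))"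
      using cong_sym[OF x_psi] by simp
    finally show ?thesis .
  qed
  have cubics: "cubic_rel h (\<lambda>i. x (E i)) (\<lambda>i. x (E i)) i j \<in> I" "cubic_rel h (\<lambda>i. x (F i)) (\<lambda>i. x (F i)) i j \<in> I"
    "cubic_rel h (\<lambda>i. x (Psi i)) (\<lambda>i. x (E i)) i j \<in> I" "cubic_rel h (\<lambda>i. x (Psi i)) (\<lambda>i. x (F i)) i j \<in> I" for i j
    by (rule cubic_rel_mem[OF linear_H ee] cubic_rel_mem[OF linear_H ff]
        cubic_rel_mem[OF linear_H pe] cubic_rel_mem[OF linear_H pf],
      rule polyI, simp add: power_add algebra_simps power2_eq_square power3_eq_cube)+
  have serre: "serre_rel a i j k \<in> I"
    if t: "\<And>i j k. comm (a i) (comm (a j) (a k)) \<approx> H r (c i j k)"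
      and c: "\<And>i j k. c i j (k + 1) + c i k (j + 1) + c j i (k + 1) + c j k (i + 1) + c k i (j + 1) + c k j (i + 1) = 0"
    for a r c i j k
  proof -
    have "serre_rel a i j k \<approx> H r (c i j (k + 1)) + H r (c i k (j + 1)) + H r (c j i (k + 1))
      + H r (c j k (i + 1)) + H r (c k i (j + 1)) + H r (c k j (i + 1))"
      unfolding serre_rel_def Let_def by (intro cong_add t)
    also have "\<dots> = 0"
      using c[of i j k] by (simp only: linear_map_add[OF linear_H, symmetric] linear_map_zero[OF linear_H])
    finally show ?thesis by (simp add: cong_0)
  qed
  have serre_e: "serre_rel (\<lambda>i. x (E i)) i j k \<in> I" for i j k
  proof (rule serre)
    show "comm (x (E i)) (comm (x (E j)) (x (E k))) \<approx> H 3 (brk h 1 (px ^ i) 2 (brk h 1 (px ^ j) 1 (px ^ k)))" for i j k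
      using cong_trans[OF cong_comm[OF x_e ee] rule0] by simp
  qed (rule polyI, simp add: algebra_simps)
  have serre_f: "serre_rel (\<lambda>i. x (F i)) i j k \<in> I" for i j k
  proof (rule serre)
    show "comm (x (F i)) (comm (x (F j)) (x (F k))) \<approx> H (-3) (brk h (-1) (?f i) (-2) (brk h (-1) (?f j) (-1) (?f k)))" for i j k
      using cong_trans[OF cong_comm[OF x_f ff] rule0] by simp
  qed (rule polyI, simp add: algebra_simps)
  have low: "comm (x (Psi 0)) y \<in> I" "comm (x (Psi 1)) y \<in> I"
    "comm (x (Psi 2)) y - const (of_int r * (2 * h\<^sup>2)) * y \<in> I"
    if pa: "\<And>i. comm (x (Psi i)) y \<approx> H r (brk h 0 (?p i) r q)" and y: "y \<approx> H r q" and r: "r = 1 \<or> r = -1" for y r q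
  proof -
    have b: "brk h 0 (?p 0) r q = 0" "brk h 0 (?p 1) r q = 0"
      "brk h 0 (?p 2) r q = Polynomial.smult (of_int r * (2 * h\<^sup>2)) q"
      using r by (auto intro!: polyI simp: algebra_simps power2_eq_square)
    show "comm (x (Psi 0)) y \<in> I" "comm (x (Psi 1)) y \<in> I"
      using pa[of 0] pa[of 1] by (simp_all only: b linear_map_zero[OF linear_H] cong_0)
    have "comm (x (Psi 2)) y \<approx> const (of_int r * (2 * h\<^sup>2)) * H r q"
      using pa[of 2] by (simp only: b linear_map_smult[OF linear_H])
    also have "\<dots> \<approx> const (of_int r * (2 * h\<^sup>2)) * y" by (rule cong_scale[OF cong_sym[OF y]])
    finally show "comm (x (Psi 2)) y - const (of_int r * (2 * h\<^sup>2)) * y \<in> I" by (simp add: cong_def)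
  qed
  have low_e: "comm (x (Psi 0)) (x (E j)) \<in> I" "comm (x (Psi 1)) (x (E j)) \<in> I"
    "comm (x (Psi 2)) (x (E j)) - const (2 * h\<^sup>2) * x (E j) \<in> I" for j
    using low[OF pe x_e] by simp_all
  have low_f: "comm (x (Psi 0)) (x (F j)) \<in> I" "comm (x (Psi 1)) (x (F j)) \<in> I"
    "comm (x (Psi 2)) (x (F j)) + const (2 * h\<^sup>2) * x (F j) \<in> I" for j
    using low[OF pf x_f] by (simp_all add: const_hom)
  have cubic_subst: "subst x (cubic_rel h a b i j) = cubic_rel h (\<lambda>i. subst x (a i)) (\<lambda>i. subst x (b i)) i j" for a b i j
    by (simp add: cubic_rel_def subst_simps)
  have serre_subst: "subst x (serre_rel a i j k) = serre_rel (\<lambda>i. subst x (a i)) i j k" for a i j k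
    by (simp add: serre_rel_def Let_def subst_simps)
  show ?thesis
    using p unfolding yangian_rels_def
    by (auto simp: subst_simps cubic_subst serre_subst cubics serre_e serre_f pp[unfolded cong_0]
        ef[unfolded cong_def] low_e low_f simp del: One_nat_def)
qed

end

section \<open>The bracket rule in the Yangian\<close>

lemma yangian_rels_intros:
  "comm (y_psi i) (y_psi j) \<in> yangian_rels h0" "comm (y_e i) (y_f j) - y_psi (i + j) \<in> yangian_rels h0"
  "cubic_rel h0 y_e y_e i j \<in> yangian_rels h0" "cubic_rel h0 y_f y_f i j \<in> yangian_rels h0"
  "cubic_rel h0 y_psi y_e i j \<in> yangian_rels h0" "cubic_rel h0 y_psi y_f i j \<in> yangian_rels h0"
  "comm (y_psi 0) (y_e j) \<in> yangian_rels h0" "comm (y_psi 1) (y_e j) \<in> yangian_rels h0"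
  "comm (y_psi 2) (y_e j) - const (2 * h0\<^sup>2) * y_e j \<in> yangian_rels h0"
  "comm (y_psi 0) (y_f j) \<in> yangian_rels h0" "comm (y_psi 1) (y_f j) \<in> yangian_rels h0"
  "comm (y_psi 2) (y_f j) + const (2 * h0\<^sup>2) * y_f j \<in> yangian_rels h0"
  "serre_rel y_e i j k \<in> yangian_rels h0" "serre_rel y_f i j k \<in> yangian_rels h0"
  unfolding yangian_rels_def Un_iff mem_Collect_eq by fast+

locale yangian_relations = two_sided I for I :: "ygen ncpoly set" +
  fixes h0 :: complex
  assumes h0: "h0 \<noteq> 0" and I_eq: "I = Idl\<^bsub>free_alg UNIV\<^esub> (yangian_rels h0)"
begin

lemma rels_mem: "p \<in> yangian_rels h0 \<Longrightarrow> p \<in> I"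
  using ring.genideal_self[OF ring_free_alg, of "yangian_rels h0" UNIV] by (auto simp: I_eq)

lemmas relations = yangian_rels_intros[THEN rels_mem]

sublocale pos: current_algebra I "lin y_e" h0
  by (rule current_algebraI) (rule h0 relations)+

sublocale neg: current_algebra I "lin (\<lambda>k. - y_f k)" "- h0"
proof (rule current_algebraI)
  fix i j k
  have "cubic_rel (- h0) (\<lambda>k. - y_f k) (\<lambda>k. - y_f k) i j = cubic_rel h0 y_f y_f i j"
    by (simp add: cubic_rel_def comm_linear)
  then show "cubic_rel (- h0) (\<lambda>k. - y_f k) (\<lambda>k. - y_f k) i j \<in> I" by (simp add: relations)
  have "serre_rel (\<lambda>k. - y_f k) i j k = - serre_rel y_f i j k"
    by (simp add: serre_rel_def comm_linear Let_def)
  then show "serre_rel (\<lambda>k. - y_f k) i j k \<in> I" by (simp add: uminus relations)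
qed (simp add: h0)

text \<open>Since \<open>\<partial>\<^sup>-\<^sup>1 x = (x - h\<^sub>0) \<partial>\<^sup>-\<^sup>1\<close>, the image \<open>- \<partial>\<^sup>-\<^sup>1 x\<^sup>j\<close> of \<open>f\<^sub>j\<close> is \<open>- (x - h\<^sub>0)\<^sup>j \<partial>\<^sup>-\<^sup>1\<close>. In the variable
  \<open>x - h\<^sub>0\<close> the elements \<open>- f\<^sub>j\<close> therefore form a current algebra for \<open>- h\<^sub>0\<close>, and a polynomial in \<open>x\<close> has to be
  shifted by \<open>h\<^sub>0\<close> before it is inserted.\<close>

definition H :: "int \<Rightarrow> complex poly \<Rightarrow> ygen ncpoly" where
  "H r p = (if 0 < r then pos.W (nat r) p else if r < 0 then neg.W (nat (- r)) (shift h0 p)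
     else lin y_psi (primitive h0 p))"

definition C :: "ygen ncpoly" where "C = - y_psi 0"

lemma H_special: "H 1 p = lin y_e p" "H (-1) p = - lin y_f (shift h0 p)" "H 0 p = lin y_psi (primitive h0 p)"
  by (simp_all add: H_def lin_uminus)

lemma linear_H: "linear_map (H r)"
proof -
  have "linear_map (\<lambda>p. lin y_psi (primitive h0 p))"
    by (rule linear_mapI) (simp_all add: primitive_linear[OF h0] linear_map_simps[OF linear_lin])
  then show ?thesis
    unfolding H_def using pos.linear_W linear_map_intros(10)[OF neg.linear_W]
    by (cases "0 < r"; cases "r < 0") simp_all
qed

text \<open>The elements that commute with \<open>\<psi>\<^sub>0\<close> form a subalgebra, which contains the generators.\<close>

lemma C_central: "comm C z \<in> I"
proof -
  have "z \<in> carrier (free_alg UNIV)" by simp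
  then have "comm (y_psi 0) z \<in> I"
  proof (induct z rule: free_alg_induct)
    case (gen g)
    then show ?case by (cases g) (use relations in auto)
  next
    case (mult p q)
    have "comm (y_psi 0) (p * q) = comm (y_psi 0) p * q + p * comm (y_psi 0) q"
      by (simp add: comm_def algebra_simps)
    then show ?case using mult by (simp add: add left right)
  qed (simp_all add: comm_const zero comm_linear add)
  then show ?thesis using uminus by (simp add: C_def comm_linear)
qed

sublocale graded_family I H C h0
  by unfold_locales (rule h0 linear_H C_central)+

text \<open>For \<open>g(x) = p(x - h\<^sub>0) - p(x)\<close> one has \<open>[g, \<partial>] = (g(x) - g(x + h\<^sub>0)) \<partial>\<close>, with this coefficient.\<close>

definition second_difference :: "complex poly \<Rightarrow> complex poly" where
  "second_difference p = shift (- h0) p - Polynomial.smult 2 p + shift h0 p"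

text \<open>The cubic relations between the \<open>\<psi>\<^sub>i\<close> and a current are a recursion in steps of three for their bracket,
  which starts from the three prescribed ones.\<close>

lemma psi_action:
  assumes cub: "\<And>i j. cubic_rel h0 y_psi a i j \<in> I"
    and low: "\<And>j. comm (y_psi 0) (a j) \<in> I" "\<And>j. comm (y_psi 1) (a j) \<in> I"
      "\<And>j. comm (y_psi 2) (a j) - const (\<sigma> * (2 * h0\<^sup>2)) * a j \<in> I"
  shows "comm (lin y_psi p) (lin a q) \<approx> lin a (Polynomial.smult \<sigma> (second_difference p * q))"
proof -
  define c where "c i j = Polynomial.smult \<sigma> (second_difference (px ^ i) * px ^ j)" for i j
  have base: "comm (y_psi i) (a j) \<approx> lin a (c i j)" for i j
  proof (induct i arbitrary: j rule: less_induct)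
    case (less i)
    consider "i = 0" | "i = 1" | "i = 2" | "3 \<le> i" by linarith
    then show ?case
    proof cases
      case 1
      have "c 0 j = 0" unfolding c_def second_difference_def by (rule polyI) simp
      then show ?thesis using low(1)[of j] by (simp add: 1 linear_map_zero[OF linear_lin] cong_0)
    next
      case 2
      have "c 1 j = 0" unfolding c_def second_difference_def by (rule polyI) simp
      then show ?thesis using low(2)[of j] by (simp add: 2 linear_map_zero[OF linear_lin] cong_0)
    next
      case 3
      have "c 2 j = Polynomial.smult (\<sigma> * (2 * h0\<^sup>2)) (px ^ j)"
        unfolding c_def second_difference_def by (rule polyI) (simp add: algebra_simps power2_eq_square)
      then have "lin a (c 2 j) = const (\<sigma> * (2 * h0\<^sup>2)) * a j"
        by (simp only: linear_map_smult[OF linear_lin] lin_px)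
      then show ?thesis using low(3)[of j] by (simp add: 3 cong_def)
    next
      case 4
      then obtain k where k: "i = k + 3" by (metis le_add_diff_inverse2)
      have IH: "comm (y_psi m) (a l) \<approx> lin a (c m l)" if "m < k + 3" for m l
        using less that k by simp
      have rec: "c (k + 3) j = Polynomial.smult 3 (c (k + 2) (j + 1)) - Polynomial.smult 3 (c (k + 1) (j + 2))
         + c k (j + 3) + Polynomial.smult (h0\<^sup>2) (c (k + 1) j - c k (j + 1))"
        unfolding c_def second_difference_def
        by (rule polyI) (simp add: algebra_simps power_add power2_eq_square power3_eq_cube)
      have "comm (y_psi (k + 3)) (a j) - (3 * comm (y_psi (k + 2)) (a (j + 1)) - 3 * comm (y_psi (k + 1)) (a (j + 2))
         + comm (y_psi k) (a (j + 3)) + const (h0\<^sup>2) * (comm (y_psi (k + 1)) (a j) - comm (y_psi k) (a (j + 1)))) \<in> I"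
        using cub[of k j] by (simp add: cubic_rel_def algebra_simps)
      then have "comm (y_psi (k + 3)) (a j) \<approx> const 3 * comm (y_psi (k + 2)) (a (j + 1))
         - const 3 * comm (y_psi (k + 1)) (a (j + 2)) + comm (y_psi k) (a (j + 3))
         + const (h0\<^sup>2) * (comm (y_psi (k + 1)) (a j) - comm (y_psi k) (a (j + 1)))"
        by (simp only: cong_def const_numeral)
      also have "\<dots> \<approx> const 3 * lin a (c (k + 2) (j + 1)) - const 3 * lin a (c (k + 1) (j + 2))
         + lin a (c k (j + 3)) + const (h0\<^sup>2) * (lin a (c (k + 1) j) - lin a (c k (j + 1)))"
        by (intro cong_add cong_diff cong_scale IH) simp_all
      also have "\<dots> = lin a (c (k + 3) j)"
        by (simp only: rec linear_map_simps[OF linear_lin])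
      finally show ?thesis by (simp only: k)
    qed
  qed
  have sd: "linear_map (\<lambda>p. lin a (Polynomial.smult \<sigma> (second_difference p * q)))" for q
    by (rule linear_mapI)
      (simp_all add: second_difference_def shift_linear linear_map_simps[OF linear_lin] algebra_simps
        smult_add_right smult_diff_right flip: const_hom(4) mult.assoc)
  have sd': "linear_map (\<lambda>q. lin a (Polynomial.smult \<sigma> (second_difference p * q)))" for p
    by (rule linear_mapI) (simp_all add: linear_map_simps[OF linear_lin] smult_add_right algebra_simps
        flip: const_hom(4) mult.assoc)
  show ?thesis
    by (rule linear_map_cong[where p = p], intro linear_map_intros linear_lin, rule sd,
        rule linear_map_cong[where p = q], intro linear_map_intros linear_lin, rule sd')
      (simp only: lin_px base[unfolded c_def])
qed

lemma psi_e: "comm (lin y_psi p) (lin y_e q) \<approx> lin y_e (second_difference p * q)"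
  using psi_action[of y_e 1 p q] relations by simp

lemma psi_f: "comm (lin y_psi p) (lin y_f q) \<approx> - lin y_f (second_difference p * q)"
  using psi_action[of y_f "-1" p q] relations by (simp add: const_hom linear_map_uminus[OF linear_lin])

lemma psi_psi: "comm (lin y_psi p) (lin y_psi q) \<in> I"
  by (rule linear_map_mem[where p = p], intro linear_map_intros linear_lin,
      rule linear_map_mem[where p = q], intro linear_map_intros linear_lin)
    (simp only: lin_px relations)

lemma e_f: "comm (lin y_e p) (lin y_f q) \<approx> lin y_psi (p * q)"
proof (rule linear_map_cong[where p = p])
  fix i
  show "comm (lin y_e (px ^ i)) (lin y_f q) \<approx> lin y_psi (px ^ i * q)"
    by (rule linear_map_cong[where p = q], intro linear_map_intros linear_lin, intro linear_map_intros linear_lin)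
      (use relations(2) in \<open>simp only: lin_px cong_def flip: power_add\<close>)
qed (intro linear_map_intros linear_lin)+

lemma second_difference_primitive: "second_difference (primitive h0 g) = g - shift h0 g"
proof (rule polyI)
  fix x
  have p: "poly (primitive h0 g) (x - h0) - poly (primitive h0 g) x = poly g x" for x
    using arg_cong[OF primitive(1)[OF h0, of g], of "\<lambda>p. poly p x"] by simp
  show "poly (second_difference (primitive h0 g)) x = poly (g - shift h0 g) x"
    using p[of x] p[of "x + h0"] by (simp add: second_difference_def algebra_simps)
qed

lemma rule_1_pos: "1 \<le> s \<Longrightarrow> rule_holds 1 s"
proof -
  assume s: "1 \<le> s"
  then have "twist (nat s) h0 f g = brk h0 1 f s g" for f g
    by (simp add: twist_def brk_def)
  moreover have "nat (1 + s) = Suc (nat s)" using s by simp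
  ultimately show ?thesis
    using pos.bracket_e_W[of "nat s"] s
    by (simp add: rule_holds_def H_special coc_zero const_hom) (simp add: H_def)
qed

lemma rule_neg_1: "s \<le> -1 \<Longrightarrow> rule_holds (-1) s"
proof -
  assume s: "s \<le> -1"
  then have "twist (nat (- s)) (- h0) (shift h0 f) (shift h0 g) = shift h0 (brk h0 (-1) f s g)" for f g
    by (intro polyI) (simp add: algebra_simps)
  moreover have "nat (- (- 1 + s)) = Suc (nat (- s))" using s by simp
  ultimately show ?thesis
    using neg.bracket_e_W[of "nat (- s)" "shift h0 f" "shift h0 g" for f g] s
    by (simp add: rule_holds_def H_special coc_zero const_hom lin_uminus) (simp add: H_def)
qed

text \<open>With \<open>k = f(x) g(x + h\<^sub>0)\<close> the bracket is \<open>- \<psi>(k)\<close>. The primitive that represents its part in degree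
  zero is \<open>- k + k(- h\<^sub>0)\<close>, and the constant accounts for the cocycle, since \<open>\<psi>\<^sub>0 = - c\<close>.\<close>

lemma rule_1_neg_1: "rule_holds 1 (-1)"
  unfolding rule_holds_def
proof (intro allI)
  fix f g
  let ?k = "f * shift h0 g"
  have prim: "primitive h0 (brk h0 1 f (-1) g) = - ?k + [:poly ?k (- h0):]"
    by (rule primitiveI[OF h0], rule polyI) simp_all
  have C: "lin y_psi [:c:] = - (const c * C)" for c
    using lin_monom[of y_psi c 0] by (simp add: C_def monom_0)
  have coc: "coc h0 1 f (-1) g = poly ?k (- h0)"
    by (simp add: coc_def cocycle_value_def)
  have "comm (H 1 f) (H (-1) g) = - comm (lin y_e f) (lin y_f (shift h0 g))"
    by (simp add: H_special comm_linear)
  also have "\<dots> \<approx> - lin y_psi ?k" by (rule cong_uminus[OF e_f])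
  also have "\<dots> = H (1 + -1) (brk h0 1 f (-1) g) + const (coc h0 1 f (-1) g) * C"
    by (simp only: coc) (simp add: H_special prim linear_map_simps[OF linear_lin] C del: poly_mult)
  finally show "comm (H 1 f) (H (-1) g) \<approx> \<dots>" .
qed

lemma rule_1_0: "rule_holds 1 0"
  unfolding rule_holds_def
proof (intro allI)
  fix f g
  have "comm (H 1 f) (H 0 g) = - comm (lin y_psi (primitive h0 g)) (lin y_e f)"
    by (simp add: H_special comm_swap[of "lin y_e f"])
  also have "\<dots> \<approx> - lin y_e (second_difference (primitive h0 g) * f)" by (rule cong_uminus[OF psi_e])
  also have "\<dots> = H (1 + 0) (brk h0 1 f 0 g) + const (coc h0 1 f 0 g) * C"
    by (simp add: H_special coc_zero const_hom second_difference_primitive brk_def shift_linear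
        linear_map_simps[OF linear_lin] algebra_simps)
  finally show "comm (H 1 f) (H 0 g) \<approx> \<dots>" .
qed

lemma rule_neg_1_0: "rule_holds (-1) 0"
  unfolding rule_holds_def
proof (intro allI)
  fix f g
  have k: "shift h0 (brk h0 (-1) f 0 g) = second_difference (primitive h0 g) * shift h0 f"
    unfolding second_difference_primitive by (rule polyI) (simp add: algebra_simps)
  have "comm (H (-1) f) (H 0 g) = comm (lin y_psi (primitive h0 g)) (lin y_f (shift h0 f))"
    by (simp add: H_special comm_linear comm_swap[of "lin y_f _"])
  also have "\<dots> \<approx> - lin y_f (second_difference (primitive h0 g) * shift h0 f)" by (rule psi_f)
  also have "\<dots> = H (-1 + 0) (brk h0 (-1) f 0 g) + const (coc h0 (-1) f 0 g) * C"
    by (simp add: H_special coc_zero const_hom k)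
  finally show "comm (H (-1) f) (H 0 g) \<approx> \<dots>" .
qed

lemma rule_0_0: "rule_holds 0 0"
  using psi_psi
  by (simp add: rule_holds_def H_special brk_def shift_linear coc_def cocycle_value_def const_hom
      linear_map_zero[OF linear_lin] primitiveI[OF h0, of 0 0] cong_0)

sublocale full_family I H C h0
proof
  fix r f s g
  have "rule_holds r s"
    by (rule rule_holds_all[OF rule_1_pos rule_neg_1 rule_1_neg_1 rule_1_0 rule_neg_1_0 rule_0_0])
  then show "comm (H r f) (H s g) \<approx> H (r + s) (brk h0 r f s g) + const (coc h0 r f s g) * C"
    by (simp add: rule_holds_def)
qed

end

section \<open>Normal forms of difference operators\<close>

abbreviation poly_x :: "complex poly \<Rightarrow> dgen ncpoly" where "poly_x \<equiv> lin (\<lambda>k. d_x ^ k)"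

definition del_power :: "int \<Rightarrow> dgen ncpoly" where
  "del_power r = (if 0 \<le> r then d_del ^ nat r else d_delinv ^ nat (- r))"

lemma poly_del_eq: "poly_del f r = poly_x f * del_power r"
  by (simp add: poly_del_def lin_def del_power_def)

lemma linear_poly_del: "linear_map (\<lambda>f. poly_del f r)"
  unfolding poly_del_eq by (intro linear_map_mult linear_lin)

lemma poly_x_px: "poly_x (px * f) = d_x * poly_x f"
  by (rule linear_map_eqI[where p = f]; (intro linear_map_intros linear_map_mult linear_lin)?)
    (simp only: lin_px_mult lin_px power_add power_one_right mult.commute power_commutes power_Suc add_0 Suc_eq_plus1[symmetric])

lemma poly_x_pCons: "poly_x (pCons a f) = const a + d_x * poly_x f"
proof -
  have "pCons a f = monom a 0 + px * f" by (simp add: monom_0)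
  then show ?thesis by (simp only: linear_map_add[OF linear_lin] lin_monom poly_x_px) simp
qed

lemma act_poly_x: "act h0 (poly_x f) v = (\<lambda>r. f * v r)"
proof
  fix r
  have "act h0 (poly_x f) v r = (\<Sum>k\<le>degree f. monom (coeff f k) k * v r)"
    by (simp add: lin_def act_sum act_mult act_const act_xpow monom_altdef)
  then show "act h0 (poly_x f) v r = f * v r"
    by (simp add: poly_as_sum_of_monoms flip: sum_distrib_right)
qed

lemma shift_shift: "shift a (shift b p) = shift (a + b) p"
  by (rule polyI) (simp add: add_ac)

lemma act_del_power: "act h0 (del_power r) v = (\<lambda>s. shift (of_int r * h0) (v (s - r)))"
proof -
  have del: "act_letter h0 Del v = (\<lambda>s. shift h0 (v (s - 1)))"
    and delinv: "act_letter h0 DelInv v = (\<lambda>s. shift (- h0) (v (s + 1)))" for v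
    by (simp_all add: shift_def)
  have "act h0 (d_del ^ k) v = (\<lambda>s. shift (of_nat k * h0) (v (s - int k)))" for k
    by (induct k) (simp_all add: act_one act_mult act_gen del shift_linear shift_shift algebra_simps del: act_letter.simps)
  moreover have "act h0 (d_delinv ^ k) v = (\<lambda>s. shift (- (of_nat k * h0)) (v (s + int k)))" for k
    by (induct k) (simp_all add: act_one act_mult act_gen delinv shift_linear shift_shift algebra_simps del: act_letter.simps)
  ultimately show ?thesis by (simp add: del_power_def)
qed

lemma act_poly_del_general: "act h0 (poly_del f r) v = (\<lambda>s. f * shift (of_int r * h0) (v (s - r)))"
  by (simp add: poly_del_eq act_mult act_poly_x act_del_power)

locale difference_algebra = two_sided I for I :: "dgen ncpoly set" +
  fixes h0 :: complex
  assumes D_eq: "I = Idl\<^bsub>free_alg UNIV\<^esub> (diff_rels h0)"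
begin

lemma diff_class_iff: "diff_class h0 p = diff_class h0 q \<longleftrightarrow> p \<approx> q"
  using pres_class_eq_iff[of "diff_rels h0" UNIV p q] by (simp add: diff_class_def cong_def D_eq[symmetric])

lemma diff_relations: "d_del * d_delinv \<approx> 1" "d_delinv * d_del \<approx> 1" "d_del * d_x \<approx> (d_x + const h0) * d_del"
proof -
  have "diff_rels h0 \<subseteq> I" using ring.genideal_self[OF ring_free_alg, of "diff_rels h0" UNIV] by (simp add: D_eq)
  then show "d_del * d_delinv \<approx> 1" "d_delinv * d_del \<approx> 1" "d_del * d_x \<approx> (d_x + const h0) * d_del"
    by (simp_all add: cong_def diff_rels_def)
qed

lemma del_poly_x: "d_del * poly_x f \<approx> poly_x (shift h0 f) * d_del"
proof (induct f)
  case 0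
  show ?case by (simp add: linear_map_zero[OF linear_lin] shift_linear)
next
  case (pCons a f)
  have s: "shift h0 (pCons a f) = monom a 0 + px * shift h0 f + Polynomial.smult h0 (shift h0 f)"
    by (rule polyI) (simp add: monom_0 algebra_simps)
  have "d_del * poly_x (pCons a f) = const a * d_del + (d_del * d_x) * poly_x f"
    by (simp add: poly_x_pCons distrib_left mult.assoc const_mult_commute)
  also have "\<dots> \<approx> const a * d_del + ((d_x + const h0) * d_del) * poly_x f"
    by (intro cong_add cong_refl cong_mult diff_relations)
  also have "\<dots> = const a * d_del + (d_x + const h0) * (d_del * poly_x f)" by (simp add: mult.assoc)
  also have "\<dots> \<approx> const a * d_del + (d_x + const h0) * (poly_x (shift h0 f) * d_del)"
    by (intro cong_add cong_refl cong_mult pCons)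
  also have "\<dots> = poly_x (shift h0 (pCons a f)) * d_del"
    unfolding s by (simp only: linear_map_simps[OF linear_lin] lin_monom poly_x_px) (simp add: algebra_simps)
  finally show ?case .
qed

lemma delinv_poly_x: "d_delinv * poly_x f \<approx> poly_x (shift (- h0) f) * d_delinv"
proof -
  let ?g = "shift (- h0) f"
  have g: "shift h0 ?g = f" by (simp add: shift_shift shift_linear)
  have "d_delinv * poly_x f = d_delinv * poly_x f * 1" by simp
  also have "\<dots> \<approx> d_delinv * poly_x f * (d_del * d_delinv)"
    by (rule cong_mult[OF cong_refl cong_sym[OF diff_relations(1)]])
  also have "\<dots> = d_delinv * (poly_x (shift h0 ?g) * d_del) * d_delinv" by (simp add: g mult.assoc)
  also have "\<dots> \<approx> d_delinv * (d_del * poly_x ?g) * d_delinv"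
    by (rule cong_mult[OF cong_mult[OF cong_refl cong_sym[OF del_poly_x]] cong_refl])
  also have "\<dots> = (d_delinv * d_del) * (poly_x ?g * d_delinv)" by (simp add: mult.assoc)
  also have "\<dots> \<approx> 1 * (poly_x ?g * d_delinv)" by (rule cong_mult[OF diff_relations(2) cong_refl])
  finally show ?thesis by simp
qed

lemma del_del_power: "d_del * del_power r \<approx> del_power (r + 1)"
proof (cases "0 \<le> r")
  case True
  then have "nat (r + 1) = Suc (nat r)" by simp
  then show ?thesis using True by (simp add: del_power_def)
next
  case False
  then have r: "nat (- r) = Suc (nat (- (r + 1)))" by simp
  have "d_del * del_power r = (d_del * d_delinv) * d_delinv ^ nat (- (r + 1))"
    using False by (simp add: del_power_def r mult.assoc)
  also have "\<dots> \<approx> 1 * d_delinv ^ nat (- (r + 1))" by (rule cong_mult[OF diff_relations(1) cong_refl])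
  also have "\<dots> = del_power (r + 1)" using False by (cases "r = -1") (auto simp: del_power_def)
  finally show ?thesis .
qed

lemma delinv_del_power: "d_delinv * del_power r \<approx> del_power (r - 1)"
proof (cases "0 < r")
  case True
  then have r: "nat r = Suc (nat (r - 1))" by simp
  have "d_delinv * del_power r = (d_delinv * d_del) * d_del ^ nat (r - 1)"
    using True by (simp add: del_power_def r mult.assoc)
  also have "\<dots> \<approx> 1 * d_del ^ nat (r - 1)" by (rule cong_mult[OF diff_relations(2) cong_refl])
  finally show ?thesis using True by (simp add: del_power_def)
next
  case False
  then have "nat (- (r - 1)) = Suc (nat (- r))" by simp
  then show ?thesis using False by (cases "r = 0") (simp_all add: del_power_def)
qed

text \<open>Multiplication by a generator on the left keeps the form \<open>f(x) \<partial>\<^sup>r\<close>.\<close>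

lemma word_homogeneous: "\<exists>f r. Poly_Mapping.single (Word gs) 1 \<approx> poly_del f r"
proof (induct gs)
  case Nil
  have "poly_del 1 0 = 1"
    using lin_px[of "\<lambda>k. d_x ^ k" 0] by (simp add: poly_del_eq del_power_def)
  then show ?case
    by (intro exI[of _ 1] exI[of _ 0]) (simp add: single_word_Nil const_hom)
next
  case (Cons g gs)
  then obtain f r where IH: "Poly_Mapping.single (Word gs) 1 \<approx> poly_del f r" by blast
  have *: "Poly_Mapping.single (Word (g # gs)) 1 \<approx> gen g * (poly_x f * del_power r)"
    unfolding single_word_Cons poly_del_eq[symmetric] by (rule cong_mult[OF cong_refl IH])
  show ?case
  proof (cases g)
    case X
    have "gen g * (poly_x f * del_power r) = poly_del (px * f) r"
      by (simp only: X poly_del_eq poly_x_px mult.assoc)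
    then show ?thesis using * by metis
  next
    case Del
    have "gen g * (poly_x f * del_power r) = (d_del * poly_x f) * del_power r" by (simp add: Del mult.assoc)
    also have "\<dots> \<approx> (poly_x (shift h0 f) * d_del) * del_power r" by (rule cong_mult[OF del_poly_x cong_refl])
    also have "\<dots> = poly_x (shift h0 f) * (d_del * del_power r)" by (simp add: mult.assoc)
    also have "\<dots> \<approx> poly_x (shift h0 f) * del_power (r + 1)" by (rule cong_mult[OF cong_refl del_del_power])
    also have "\<dots> = poly_del (shift h0 f) (r + 1)" by (simp add: poly_del_eq)
    finally show ?thesis using cong_trans[OF *] by blast
  next
    case DelInv
    have "gen g * (poly_x f * del_power r) = (d_delinv * poly_x f) * del_power r" by (simp add: DelInv mult.assoc)
    also have "\<dots> \<approx> (poly_x (shift (- h0) f) * d_delinv) * del_power r" by (rule cong_mult[OF delinv_poly_x cong_refl])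
    also have "\<dots> = poly_x (shift (- h0) f) * (d_delinv * del_power r)" by (simp add: mult.assoc)
    also have "\<dots> \<approx> poly_x (shift (- h0) f) * del_power (r - 1)" by (rule cong_mult[OF cong_refl delinv_del_power])
    also have "\<dots> = poly_del (shift (- h0) f) (r - 1)" by (simp add: poly_del_eq)
    finally show ?thesis using cong_trans[OF *] by blast
  qed
qed

lemma cong_act: "p \<approx> q \<Longrightarrow> act h0 p v = act h0 q v"
  using diff_ideal_act[of "p - q" h0 v, folded D_eq] by (simp add: cong_def act_diff fun_eq_iff)

text \<open>All large enough index sets are admitted, so that two operators can be expanded over the same set.\<close>

lemma normal_form:
  "\<exists>S. finite S \<and> (\<forall>T. finite T \<longrightarrow> S \<subseteq> T \<longrightarrow> p \<approx> (\<Sum>r\<in>T. poly_del (act h0 p vac r) r))"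
proof (induct p rule: pm_induct)
  case (single w c)
  obtain f r where f: "Poly_Mapping.single w 1 \<approx> poly_del f r"
    using word_homogeneous[of "letters w"] by auto
  have "Poly_Mapping.single w c = const c * Poly_Mapping.single w 1"
    by (simp add: const_def mult_single)
  also have "\<dots> \<approx> const c * poly_del f r" by (rule cong_scale[OF f])
  also have "\<dots> = poly_del (Polynomial.smult c f) r" by (simp add: linear_map_smult[OF linear_poly_del])
  finally have c: "Poly_Mapping.single w c \<approx> poly_del (Polynomial.smult c f) r" .
  have "(\<Sum>s\<in>T. poly_del (act h0 (Poly_Mapping.single w c) vac s) s) = poly_del (Polynomial.smult c f) r"
    if T: "finite T" "{r} \<subseteq> T" for T
  proof -
    have "(\<Sum>s\<in>T. poly_del (act h0 (Poly_Mapping.single w c) vac s) s)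
      = (\<Sum>s\<in>{r}. poly_del (act h0 (Poly_Mapping.single w c) vac s) s)"
      by (rule sum.mono_neutral_right) (use T in \<open>auto simp: cong_act[OF c] act_poly_del linear_map_zero[OF linear_poly_del]\<close>)
    then show ?thesis by (simp add: cong_act[OF c] act_poly_del)
  qed
  then show ?case using c by (intro exI[of _ "{r}"]) simp
next
  case (add p q)
  from add(1) obtain S
    where S: "finite S" "\<forall>T. finite T \<longrightarrow> S \<subseteq> T \<longrightarrow> p \<approx> (\<Sum>r\<in>T. poly_del (act h0 p vac r) r)"
    by blast
  from add(2) obtain S'
    where S': "finite S'" "\<forall>T. finite T \<longrightarrow> S' \<subseteq> T \<longrightarrow> q \<approx> (\<Sum>r\<in>T. poly_del (act h0 q vac r) r)"
    by blast
  have "p + q \<approx> (\<Sum>r\<in>T. poly_del (act h0 (p + q) vac r) r)" if "finite T" "S \<union> S' \<subseteq> T" for T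
    using cong_add[OF S(2)[rule_format, of T] S'(2)[rule_format, of T]] that
    by (simp add: act_add linear_map_add[OF linear_poly_del] sum.distrib)
  then show ?case using S(1) S'(1) by (intro exI[of _ "S \<union> S'"]) simp
qed

lemma cong_iff_act: "p \<approx> q \<longleftrightarrow> act h0 p vac = act h0 q vac"
proof
  assume eq: "act h0 p vac = act h0 q vac"
  obtain S where S: "finite S \<and> (\<forall>T. finite T \<longrightarrow> S \<subseteq> T \<longrightarrow> p \<approx> (\<Sum>r\<in>T. poly_del (act h0 p vac r) r))"
    using normal_form[of p] by (rule exE)
  obtain S' where S': "finite S' \<and> (\<forall>T. finite T \<longrightarrow> S' \<subseteq> T \<longrightarrow> q \<approx> (\<Sum>r\<in>T. poly_del (act h0 q vac r) r))"
    using normal_form[of q] by (rule exE)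
  have "p \<approx> (\<Sum>r\<in>S \<union> S'. poly_del (act h0 q vac r) r)"
    using S[THEN conjunct2, rule_format, of "S \<union> S'"] S S' by (simp add: eq)
  moreover have "q \<approx> (\<Sum>r\<in>S \<union> S'. poly_del (act h0 q vac r) r)" 
    using S'[THEN conjunct2, rule_format, of "S \<union> S'"] S S' by simp
  ultimately show "p \<approx> q" using cong_trans cong_sym by blast
qed (rule cong_act)

end

text \<open>Equalities between classes of difference operators thus reduce to a computation of polynomials.\<close>

lemma diff_class_eq_iff_act: "diff_class h0 p = diff_class h0 q \<longleftrightarrow> act h0 p vac = act h0 q vac"
proof -
  interpret difference_algebra "Idl\<^bsub>free_alg UNIV\<^esub> (diff_rels h0)" h0
    by (intro difference_algebra.intro two_sided_Idl) (simp add: difference_algebra_axioms_def)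
  show ?thesis by (simp only: diff_class_iff cong_iff_act)
qed

lemma diff_class_comm:
  "diff_class h0 (comm (poly_del f r) (poly_del g s)) = diff_class h0 (poly_del (brk h0 r f s g) (r + s))"
  unfolding diff_class_eq_iff_act comm_def act_diff act_mult act_poly_del
  unfolding act_poly_del_general by (rule ext) (auto simp: brk_def shift_linear)

lemma diff_class_expand:
  assumes "finite T" "{r. act h0 p vac r \<noteq> 0} \<subseteq> T"
  shows "diff_class h0 p = diff_class h0 (\<Sum>r\<in>T. poly_del (act h0 p vac r) r)"
  unfolding diff_class_eq_iff_act
proof
  fix s
  have "act h0 (\<Sum>r\<in>T. poly_del (act h0 p vac r) r) vac s = (\<Sum>r\<in>T. if s = r then act h0 p vac r else 0)"
    unfolding act_sum by (rule sum.cong) (simp_all add: act_poly_del)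
  also have "\<dots> = act h0 p vac s" using assms by (auto simp: sum.delta)
  finally show "act h0 p vac s = act h0 (\<Sum>r\<in>T. poly_del (act h0 p vac r) r) vac s" ..
qed

lemma diff_class_induct:
  assumes "\<And>f r. P (poly_del f r)" "\<And>p q. P p \<Longrightarrow> P q \<Longrightarrow> P (p + q)"
    and cls: "\<And>p q. diff_class h0 p = diff_class h0 q \<Longrightarrow> P p \<Longrightarrow> P q"
  shows "P p"
proof -
  let ?T = "{r. act h0 p vac r \<noteq> 0}"
  have "poly_del 0 0 = 0" by (rule linear_map_zero[OF linear_poly_del])
  then have z: "P 0" using assms(1)[of 0 0] by simp
  have "finite T \<Longrightarrow> P (\<Sum>r\<in>T. poly_del (act h0 p vac r) r)" for T
    by (induct T rule: finite_induct) (simp_all add: z assms(1,2))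
  then show ?thesis
    using cls[OF diff_class_expand[symmetric, of ?T h0 p]] finite_nf[of h0 p] by simp
qed

section \<open>The enveloping algebra\<close>

lemma diff_class_minus:
  "diff_class h0 p \<ominus>\<^bsub>diff_alg h0\<^esub> diff_class h0 q = diff_class h0 (p - q)"
proof -
  interpret I: ideal "Idl\<^bsub>free_alg UNIV\<^esub> (diff_rels h0)" "free_alg UNIV" by (rule diff_ideal)
  let ?Q = "free_alg UNIV Quot (Idl\<^bsub>free_alg UNIV\<^esub> (diff_rels h0))"
  interpret Q: ring ?Q by (rule I.quotient_is_ring)
  have fields: "carrier (diff_alg h0) = carrier ?Q" "add (diff_alg h0) = add ?Q" "zero (diff_alg h0) = zero ?Q"
    by (simp_all add: diff_alg_def pres_alg_def quot_alg_def ring.extend_def module.fields_def)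
  have inv: "\<ominus>\<^bsub>diff_alg h0\<^esub> x = \<ominus>\<^bsub>?Q\<^esub> x" for x
    by (simp add: a_inv_def m_inv_def fields)
  have cl: "diff_class h0 x \<in> carrier ?Q" for x
    unfolding fields(1)[symmetric] carrier_diff by blast
  have "diff_class h0 (- q) \<oplus>\<^bsub>?Q\<^esub> diff_class h0 q = \<zero>\<^bsub>?Q\<^esub>"
    using add_diff[of h0 "- q" q] I.a_coset_add_zero[OF I.a_subset]
    by (simp add: fields(2) FactRing_def diff_class_def pres_class_def)
  then have "\<ominus>\<^bsub>?Q\<^esub> diff_class h0 q = diff_class h0 (- q)"
    by (intro Q.minus_equality cl)
  then show ?thesis using add_diff[of h0 p "- q"] by (simp add: a_minus_def inv)
qed

lemma diff_class_mult: "diff_class h0 p \<otimes>\<^bsub>diff_alg h0\<^esub> diff_class h0 q = diff_class h0 (p * q)"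
  using pres_class_ops(1)[of "diff_rels h0" UNIV p q] by (simp add: diff_alg_def diff_class_def)

lemma diff_lie_simps:
  "(diff_class h0 p, z) \<in> carrier (diff_lie h0)"
  "lie_add (diff_lie h0) (diff_class h0 p, z) (diff_class h0 q, w) = (diff_class h0 (p + q), z + w)"
  "lie_smult (diff_lie h0) c (diff_class h0 p, z) = (diff_class h0 (const c * p), c * z)"
  "lie_bracket (diff_lie h0) (diff_class h0 p, z) (diff_class h0 q, w)
    = (diff_class h0 (comm p q), diff_cocycle h0 (diff_class h0 p) (diff_class h0 q))"
proof -
  show "(diff_class h0 p, z) \<in> carrier (diff_lie h0)"
    unfolding diff_lie_def Let_def using carrier_diff by auto
qed (simp_all add: diff_lie_def Let_def add_diff smult_diff diff_class_mult diff_class_minus comm_def)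

lemma carrier_diff_lie: "a \<in> carrier (diff_lie h0) \<longleftrightarrow> (\<exists>p z. a = (diff_class h0 p, z))"
  by (cases a) (auto simp: diff_lie_def Let_def carrier_diff)

lemma diff_cocycle_linear:
  "diff_cocycle h0 (diff_class h0 (p + q)) (diff_class h0 k)
     = diff_cocycle h0 (diff_class h0 p) (diff_class h0 k) + diff_cocycle h0 (diff_class h0 q) (diff_class h0 k)"
  "diff_cocycle h0 (diff_class h0 k) (diff_class h0 (p + q))
     = diff_cocycle h0 (diff_class h0 k) (diff_class h0 p) + diff_cocycle h0 (diff_class h0 k) (diff_class h0 q)"
  "diff_cocycle h0 (diff_class h0 (poly_del f r)) (diff_class h0 (poly_del g s)) = coc h0 r f s g"
proof -
  note c = is_diff_cocycle_diff_cocycle[of h0, unfolded is_diff_cocycle_def Let_def]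
  have car: "diff_class h0 x \<in> carrier (diff_alg h0)" for x unfolding carrier_diff by blast
  show "diff_cocycle h0 (diff_class h0 (p + q)) (diff_class h0 k)
     = diff_cocycle h0 (diff_class h0 p) (diff_class h0 k) + diff_cocycle h0 (diff_class h0 q) (diff_class h0 k)"
    "diff_cocycle h0 (diff_class h0 k) (diff_class h0 (p + q))
     = diff_cocycle h0 (diff_class h0 k) (diff_class h0 p) + diff_cocycle h0 (diff_class h0 k) (diff_class h0 q)"
    using c car unfolding add_diff[symmetric] by blast+
  have "diff_cocycle h0 (diff_class h0 (poly_del f r)) (diff_class h0 (poly_del g (- (- s)))) = cocycle_value h0 f r g (- s)"
    using c by blast
  then show "diff_cocycle h0 (diff_class h0 (poly_del f r)) (diff_class h0 (poly_del g s)) = coc h0 r f s g"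
    by (simp add: coc_def)
qed

lemma free_alg_diff_closed:
  assumes "p \<in> carrier (free_alg S)" "q \<in> carrier (free_alg S)"
  shows "p - q \<in> carrier (free_alg S)"
proof -
  interpret A: ring "free_alg S" by (rule ring_free_alg)
  show ?thesis using A.minus_closed[OF assms] by (simp add: a_minus_def uminus_free_alg assms)
qed

lemma env_rels_carrier: "env_rels (diff_lie h0) \<subseteq> carrier (free_alg (carrier (diff_lie h0)))"
proof -
  interpret A: ring "free_alg (carrier (diff_lie h0))" by (rule ring_free_alg)
  let ?A = "carrier (free_alg (carrier (diff_lie h0)))"
  have cl: "x + y \<in> ?A" "x * y \<in> ?A" "x - y \<in> ?A" "const c * x \<in> ?A" if "x \<in> ?A" "y \<in> ?A" for x y c
    using that A.a_closed[of x y] A.m_closed[of x y] free_alg_diff_closed[of x _ y] A.m_closed[OF const_closed, of x c]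
    by simp_all
  have lie: "lie_add (diff_lie h0) a b \<in> carrier (diff_lie h0)" "lie_smult (diff_lie h0) c a \<in> carrier (diff_lie h0)"
    "lie_bracket (diff_lie h0) a b \<in> carrier (diff_lie h0)"
    if "a \<in> carrier (diff_lie h0)" "b \<in> carrier (diff_lie h0)" for a b c
    using that unfolding carrier_diff_lie by (auto simp: diff_lie_simps)
  show ?thesis
    unfolding env_rels_def comm_def by (auto intro!: cl gen_closed lie)
qed

text \<open>The substitution that kills the generators outside \<open>S\<close>.\<close>

definition restrict_gens :: "'g set \<Rightarrow> 'g \<Rightarrow> 'g ncpoly" where
  "restrict_gens S g = (if g \<in> S then gen g else 0)"

lemma restrict_gens_closed: "restrict_gens S g \<in> carrier (free_alg S)"
  by (auto simp: restrict_gens_def gen_closed) (simp add: carrier_free_alg)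

lemma subst_restrict_gens: "p \<in> carrier (free_alg S) \<Longrightarrow> subst (restrict_gens S) p = p"
  by (induct p rule: free_alg_induct) (simp_all add: subst_simps restrict_gens_def)

text \<open>The ideal of the enveloping algebra, extended to all generators.\<close>

locale enveloping = two_sided I for I :: "(dgen ncpoly set \<times> complex) ncpoly set" +
  fixes h0 :: complex
  assumes h0: "h0 \<noteq> 0"
    and I_eq: "I = {p. subst (restrict_gens (carrier (diff_lie h0))) p
      \<in> Idl\<^bsub>free_alg (carrier (diff_lie h0))\<^esub> (env_rels (diff_lie h0))}"
begin

lemma mem_iff:
  "p \<in> carrier (free_alg (carrier (diff_lie h0))) \<Longrightarrow>
    p \<in> I \<longleftrightarrow> p \<in> Idl\<^bsub>free_alg (carrier (diff_lie h0))\<^esub> (env_rels (diff_lie h0))"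
  by (simp add: I_eq subst_restrict_gens)

lemma env_rels_mem: "p \<in> env_rels (diff_lie h0) \<Longrightarrow> p \<in> I"
  using mem_iff ring.genideal_self[OF ring_free_alg env_rels_carrier] env_rels_carrier by blast

definition u :: "dgen ncpoly \<Rightarrow> complex \<Rightarrow> (dgen ncpoly set \<times> complex) ncpoly" where
  "u p z = gen (diff_class h0 p, z)"

lemma u_class: "diff_class h0 p = diff_class h0 q \<Longrightarrow> u p z = u q z"
  by (simp add: u_def)

lemma u_add: "u (p + q) (z + w) \<approx> u p z + u q w"
  unfolding cong_def u_def diff_lie_simps(2)[symmetric]
  by (rule env_rels_mem) (use diff_lie_simps(1) in \<open>unfold env_rels_def, blast\<close>)

lemma u_smult: "u (const c * p) (c * z) \<approx> const c * u p z"
  unfolding cong_def u_def diff_lie_simps(3)[symmetric]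
  by (rule env_rels_mem) (use diff_lie_simps(1) in \<open>unfold env_rels_def, blast\<close>)

lemma u_comm: "comm (u p z) (u q w) \<approx> u (comm p q) (diff_cocycle h0 (diff_class h0 p) (diff_class h0 q))"
  unfolding cong_def u_def diff_lie_simps(4)[symmetric, where z = z and w = w]
  by (rule env_rels_mem) (use diff_lie_simps(1) in \<open>unfold env_rels_def, blast\<close>)

definition C :: "(dgen ncpoly set \<times> complex) ncpoly" where "C = u 0 1"

lemma u_0: "u 0 0 \<approx> 0"
  using u_smult[of 0 0 0] by (simp add: const_hom)

lemma u_split: "u p z \<approx> u p 0 + const z * C"
proof -
  have "u p z \<approx> u p 0 + u 0 z" using u_add[of p 0 0 z] by simp
  also have "\<dots> \<approx> u p 0 + const z * C"
    using u_smult[of z 0 1] by (intro cong_add cong_refl) (simp add: C_def)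
  finally show ?thesis .
qed

lemma u_sum: "finite A \<Longrightarrow> u (\<Sum>x\<in>A. p x) 0 \<approx> (\<Sum>x\<in>A. u (p x) 0)"
proof (induct A rule: finite_induct)
  case (insert x A)
  have "u (p x + (\<Sum>x\<in>A. p x)) 0 \<approx> u (p x) 0 + (\<Sum>x\<in>A. u (p x) 0)"
    using cong_trans[OF u_add[of "p x" "\<Sum>x\<in>A. p x" 0 0] cong_add[OF cong_refl insert(3)]] by simp
  then show ?case using insert by simp
qed (simp add: u_0)

text \<open>Defined on monomials so that it is linear, not only linear modulo the relations.\<close>

definition G :: "int \<Rightarrow> complex poly \<Rightarrow> (dgen ncpoly set \<times> complex) ncpoly" where
  "G r = lin (\<lambda>k. u (poly_del (px ^ k) r) 0)"

lemma G_u: "G r f \<approx> u (poly_del f r) 0"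
proof -
  have "poly_del f r = (\<Sum>k\<le>degree f. const (coeff f k) * poly_del (px ^ k) r)"
    using linear_map_monoms[OF linear_poly_del, of f r] by (simp only: px_power)
  then have "u (poly_del f r) 0 \<approx> (\<Sum>k\<le>degree f. u (const (coeff f k) * poly_del (px ^ k) r) 0)"
    using u_sum[of "{..degree f}" "\<lambda>k. const (coeff f k) * poly_del (px ^ k) r"] by simp
  also have "\<dots> \<approx> (\<Sum>k\<le>degree f. const (coeff f k) * u (poly_del (px ^ k) r) 0)"
    using u_smult[of _ _ 0] by (intro cong_sum) simp
  also have "\<dots> = G r f" by (simp add: G_def lin_def)
  finally show ?thesis by (rule cong_sym)
qed

sublocale full_family I G C h0
proof
  show "h0 \<noteq> 0" by (rule h0)
  show "linear_map (G r)" for r unfolding G_def by (rule linear_lin)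
  have z: "poly_del 0 0 = 0" by (rule linear_map_zero[OF linear_poly_del])
  have "coc h0 0 0 r f = 0" for r f by (simp add: coc_def cocycle_value_lin)
  then have coc0: "diff_cocycle h0 (diff_class h0 0) (diff_class h0 (poly_del f r)) = 0" for f r
    using diff_cocycle_linear(3)[of h0 0 0 f r] by (simp add: z)
  show "comm C (G r f) \<in> I" for r f
  proof -
    have "comm C (G r f) \<approx> comm (u 0 1) (u (poly_del f r) 0)"
      unfolding C_def by (rule cong_comm[OF cong_refl G_u])
    also have "\<dots> \<approx> u (comm 0 (poly_del f r)) (diff_cocycle h0 (diff_class h0 0) (diff_class h0 (poly_del f r)))"
      by (rule u_comm)
    also have "\<dots> \<approx> 0" by (simp add: coc0 comm_linear u_0)
    finally show ?thesis by (simp only: cong_0)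
  qed
  show "comm (G r f) (G s g) \<approx> G (r + s) (brk h0 r f s g) + const (coc h0 r f s g) * C" for r f s g
  proof -
    have "comm (G r f) (G s g) \<approx> comm (u (poly_del f r) 0) (u (poly_del g s) 0)"
      by (rule cong_comm[OF G_u G_u])
    also have "\<dots> \<approx> u (comm (poly_del f r) (poly_del g s)) (coc h0 r f s g)"
      using u_comm[of "poly_del f r" 0 "poly_del g s" 0] by (simp add: diff_cocycle_linear(3))
    also have "\<dots> = u (poly_del (brk h0 r f s g) (r + s)) (coc h0 r f s g)"
      by (rule u_class[OF diff_class_comm])
    also have "\<dots> \<approx> u (poly_del (brk h0 r f s g) (r + s)) 0 + const (coc h0 r f s g) * C" by (rule u_split)
    also have "\<dots> \<approx> G (r + s) (brk h0 r f s g) + const (coc h0 r f s g) * C"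
      by (rule cong_add[OF cong_sym[OF G_u] cong_refl])
    finally show ?thesis .
  qed
qed

end

section \<open>The isomorphism\<close>

text \<open>The recursion for \<open>W\<close> holds for every family with the same bracket rule, so a map that is right in
  degree one is right in all degrees.\<close>

lemma (in two_sided) subst_W:
  assumes ca: "current_algebra I' e h" and K: "\<And>n. linear_map (K n)"
    and base: "\<And>p. subst x (e p) \<approx> K 1 p"
    and step: "\<And>n p q. 0 < n \<Longrightarrow> comm (K 1 p) (K n q) \<approx> K (Suc n) (twist n h p q)"
    and n: "0 < n"
  shows "subst x (current_algebra.W e h n p) \<approx> K n p"
proof -
  have "subst x (current_algebra.W e h (Suc m) p) \<approx> K (Suc m) p" for m
  proof (induct m arbitrary: p)
    case 0
    show ?case using base by (simp add: current_algebra.W.simps[OF ca])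
  next
    case (Suc m)
    let ?n = "Suc m" and ?c = "- 1 / (of_nat (Suc (Suc m)) * h)"
    let ?q = "(px - [:of_nat (Suc m) * h:]) * p"
    have "subst x (current_algebra.W e h (Suc (Suc m)) p) = const ?c *
        (comm (subst x (e ?q)) (subst x (current_algebra.W e h ?n 1))
         - comm (subst x (e p)) (subst x (current_algebra.W e h ?n px)))"
      by (simp only: current_algebra.W.simps[OF ca] subst_simps)
    also have "\<dots> \<approx> const ?c * (comm (K 1 ?q) (K ?n 1) - comm (K 1 p) (K ?n px))"
      by (intro cong_scale cong_diff cong_comm base Suc)
    also have "\<dots> \<approx> const ?c * (K (Suc ?n) (twist ?n h ?q 1) - K (Suc ?n) (twist ?n h p px))"
      by (intro cong_scale cong_diff step) simp_all
    also have "\<dots> = K (Suc ?n) (Polynomial.smult ?c (twist ?n h ?q 1 - twist ?n h p px))"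
      by (simp only: linear_map_smult[OF K] linear_map_diff[OF K])
    also have "Polynomial.smult ?c (twist ?n h ?q 1 - twist ?n h p px) = p"
      using brk_recursion[OF current_algebra.h[OF ca], of "int ?n" p]
      by (simp add: twist_def brk_def add.commute)
    finally show ?case .
  qed
  then show ?thesis using n by (cases n) auto
qed

definition yangian_image :: "complex \<Rightarrow> ygen \<Rightarrow> (dgen ncpoly set \<times> complex) ncpoly" where
  "yangian_image h0 g = (case g of
     E j \<Rightarrow> gen (diff_class h0 (d_x ^ j * d_del), 0)
   | F j \<Rightarrow> gen (diff_class h0 (- (d_delinv * d_x ^ j)), 0)
   | Psi j \<Rightarrow> gen (diff_class h0 ((d_x - const h0) ^ j - d_x ^ j), - ((- h0) ^ j)))"

lemma current_classes:
  "diff_class h0 (d_x ^ j * d_del) = diff_class h0 (poly_del (px ^ j) 1)"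
  "diff_class h0 (- (d_delinv * d_x ^ j)) = diff_class h0 (poly_del (- ((px - [:h0:]) ^ j)) (-1))"
  "diff_class h0 ((d_x - const h0) ^ j - d_x ^ j) = diff_class h0 (poly_del ((px - [:h0:]) ^ j - px ^ j) 0)"
proof -
  have del: "d_del = del_power 1" "d_delinv = del_power (-1)" by (simp_all add: del_power_def)
  have s: "shift (- h0) (px ^ j) = (px - [:h0:]) ^ j" by (rule polyI) simp
  have "act h0 ((d_x - const h0) ^ j) v = (\<lambda>r. (px - [:h0:]) ^ j * v r)" for v
    by (induct j arbitrary: v)
      (auto simp: act_one act_mult act_diff act_gen act_const fun_eq_iff algebra_simps)
  then show "diff_class h0 ((d_x - const h0) ^ j - d_x ^ j) = diff_class h0 (poly_del ((px - [:h0:]) ^ j - px ^ j) 0)"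
    unfolding diff_class_eq_iff_act by (simp only: act_diff act_xpow act_poly_del) (auto simp: vac_def)
  show "diff_class h0 (d_x ^ j * d_del) = diff_class h0 (poly_del (px ^ j) 1)"
    by (simp only: del poly_del_eq lin_px)
  show "diff_class h0 (- (d_delinv * d_x ^ j)) = diff_class h0 (poly_del (- ((px - [:h0:]) ^ j)) (-1))"
    unfolding diff_class_eq_iff_act
    by (simp only: del act_uminus act_mult act_xpow act_poly_del act_del_power)
      (auto simp: vac_def s shift_linear)
qed

context yangian_relations
begin

text \<open>The inverse map on \<open>p + z c\<close>, computed from the normal form of \<open>p\<close>.\<close>

definition eta :: "dgen ncpoly \<Rightarrow> complex \<Rightarrow> ygen ncpoly" where
  "eta p z = (\<Sum>r | act h0 p vac r \<noteq> 0. H r (act h0 p vac r)) + const z * C"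

lemma eta_eq:
  assumes "finite T" "{r. act h0 p vac r \<noteq> 0} \<subseteq> T"
  shows "eta p z = (\<Sum>r\<in>T. H r (act h0 p vac r)) + const z * C"
  unfolding eta_def using assms
  by (intro arg_cong2[of _ _ _ _ "(+)"] sum.mono_neutral_left refl) (auto simp: linear_map_zero[OF linear_H])

lemma eta_class: "diff_class h0 p = diff_class h0 q \<Longrightarrow> eta p z = eta q z"
  by (simp add: eta_def diff_class_eq_iff_act)

lemma eta_add: "eta (p + q) (z + w) = eta p z + eta q w"
proof -
  let ?T = "{r. act h0 p vac r \<noteq> 0} \<union> {r. act h0 q vac r \<noteq> 0}"
  have T: "finite ?T" by (simp add: finite_nf)
  have sub: "{r. act h0 (p + q) vac r \<noteq> 0} \<subseteq> ?T" by (auto simp: act_add)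
  show ?thesis
    by (simp add: eta_eq[OF T sub] eta_eq[OF T Un_upper1] eta_eq[OF T Un_upper2])
      (simp add: act_add linear_map_add[OF linear_H] sum.distrib const_hom algebra_simps)
qed

lemma eta_smult: "eta (const c * p) (c * z) = const c * eta p z"
proof -
  let ?T = "{r. act h0 p vac r \<noteq> 0}"
  have T: "finite ?T" by (simp add: finite_nf)
  have sub: "{r. act h0 (const c * p) vac r \<noteq> 0} \<subseteq> ?T" by (auto simp: act_mult act_const)
  show ?thesis
    by (simp add: eta_eq[OF T sub] eta_eq[OF T subset_refl])
      (simp add: act_mult act_const linear_map_smult[OF linear_H] sum_distrib_left const_hom algebra_simps)
qed

lemma eta_homogeneous: "eta (poly_del f r) z = H r f + const z * C"
  by (subst eta_eq[of "{r}"]) (auto simp: act_poly_del)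

lemma eta_split: "eta p z = eta p 0 + const z * C"
  by (simp add: eta_def const_hom)

lemma diff_class_comm_cong:
  "diff_class h0 p = diff_class h0 p' \<Longrightarrow> diff_class h0 (comm p q) = diff_class h0 (comm p' q)"
  "diff_class h0 p = diff_class h0 p' \<Longrightarrow> diff_class h0 (comm q p) = diff_class h0 (comm q p')"
  by (simp_all add: comm_def flip: diff_class_minus diff_class_mult)

text \<open>By bilinearity the bracket rule for homogeneous elements gives the one for all elements.\<close>

lemma eta_comm:
  "comm (eta p z) (eta q w) \<approx> eta (comm p q) (diff_cocycle h0 (diff_class h0 p) (diff_class h0 q))"
proof -
  have c: "comm (a + const z * C) (b + const w * C) \<approx> comm a b" for a b z w
  proof -
    have "comm (a + const z * C) (b + const w * C) - comm a b
      = const z * comm C (b + const w * C) - const w * comm C a"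
      by (simp add: comm_linear comm_swap[of a C])
    then show ?thesis by (simp add: cong_def diff left C_central)
  qed
  have "comm (eta p 0) (eta q 0) \<approx> eta (comm p q) (diff_cocycle h0 (diff_class h0 p) (diff_class h0 q))"
  proof (induct p rule: diff_class_induct[of _ h0])
    case (1 f r)
    show ?case
    proof (induct q rule: diff_class_induct[of _ h0])
      case (1 g s)
      have "comm (eta (poly_del f r) 0) (eta (poly_del g s) 0) = comm (H r f) (H s g)"
        by (simp add: eta_homogeneous const_hom)
      also have "\<dots> \<approx> H (r + s) (brk h0 r f s g) + const (coc h0 r f s g) * C" by (rule rule)
      also have "\<dots> = eta (poly_del (brk h0 r f s g) (r + s)) (coc h0 r f s g)" by (simp add: eta_homogeneous)
      also have "\<dots> = eta (comm (poly_del f r) (poly_del g s))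
          (diff_cocycle h0 (diff_class h0 (poly_del f r)) (diff_class h0 (poly_del g s)))"
        unfolding diff_cocycle_linear(3) by (rule eta_class[OF diff_class_comm[symmetric]])
      finally show ?case .
    next
      case (2 q q')
      then show ?case
        using cong_add[OF 2] eta_add[of q q' 0 0]
        by (simp add: comm_linear eta_add diff_cocycle_linear)
    next
      case (3 q q')
      then show ?case using eta_class[OF 3(1)] eta_class[OF diff_class_comm_cong(2)[OF 3(1)]] by simp
    qed
  next
    case (2 p p')
    then show ?case
      using cong_add[OF 2] eta_add[of p p' 0 0]
      by (simp add: comm_linear eta_add diff_cocycle_linear)
  next
    case (3 p p')
    then show ?case using eta_class[OF 3(1)] eta_class[OF diff_class_comm_cong(1)[OF 3(1)]] by simp
  qed
  then show ?thesis unfolding eta_split[of p z] eta_split[of q w] using cong_trans[OF c] by blast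
qed

definition env_image :: "dgen ncpoly set \<times> complex \<Rightarrow> ygen ncpoly" where
  "env_image a = eta (SOME p. fst a = diff_class h0 p) (snd a)"

lemma env_image: "env_image (diff_class h0 p, z) = eta p z"
proof -
  have "diff_class h0 p = diff_class h0 (SOME q. diff_class h0 p = diff_class h0 q)"
    by (rule someI[of "\<lambda>q. diff_class h0 p = diff_class h0 q"]) (rule refl)
  then show ?thesis unfolding env_image_def fst_conv snd_conv by (rule eta_class[symmetric])
qed

lemma env_rels_hold:
  assumes "p \<in> env_rels (diff_lie h0)"
  shows "subst env_image p \<in> I"
proof -
  have "subst env_image (gen (lie_add (diff_lie h0) a b) - (gen a + gen b)) \<in> I"
    "subst env_image (gen (lie_smult (diff_lie h0) c a) - const c * gen a) \<in> I"
    "subst env_image (comm (gen a) (gen b) - gen (lie_bracket (diff_lie h0) a b)) \<in> I"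
    if a: "a \<in> carrier (diff_lie h0)" and b: "b \<in> carrier (diff_lie h0)" for a b c
  proof -
    obtain p z q w where ab: "a = (diff_class h0 p, z)" "b = (diff_class h0 q, w)"
      using a b unfolding carrier_diff_lie by blast
    show "subst env_image (gen (lie_add (diff_lie h0) a b) - (gen a + gen b)) \<in> I"
      "subst env_image (gen (lie_smult (diff_lie h0) c a) - const c * gen a) \<in> I"
      by (simp_all add: ab diff_lie_simps subst_simps env_image eta_add eta_smult zero)
    show "subst env_image (comm (gen a) (gen b) - gen (lie_bracket (diff_lie h0) a b)) \<in> I"
      using eta_comm[of p z q w] by (simp add: ab diff_lie_simps subst_simps env_image cong_def)
  qed
  then show ?thesis using assms unfolding env_rels_def by blast
qed

lemma env_image_yangian_image: "subst env_image (yangian_image h0 g) = gen g"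
proof (cases g)
  case (E j)
  then show ?thesis
    by (simp add: yangian_image_def subst_simps env_image eta_class[OF current_classes(1)]
        eta_homogeneous H_special lin_px const_hom)
next
  case (F j)
  have "shift h0 (- ((px - [:h0:]) ^ j)) = - (px ^ j)" by (rule polyI) simp
  then show ?thesis using F
    by (simp add: yangian_image_def subst_simps env_image eta_class[OF current_classes(2)]
        eta_homogeneous H_special linear_map_uminus[OF linear_lin] lin_px const_hom)
next
  case (Psi j)
  have prim: "primitive h0 ((px - [:h0:]) ^ j - px ^ j) = px ^ j - monom ((- h0) ^ j) 0"
    by (rule primitiveI[OF h0], rule polyI) (simp_all add: monom_0)
  have "subst env_image (yangian_image h0 g) = eta (poly_del ((px - [:h0:]) ^ j - px ^ j) 0) (- ((- h0) ^ j))"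
    using Psi eta_class[OF current_classes(3)] by (simp only: yangian_image_def subst_gen env_image ygen.case)
  also have "\<dots> = lin y_psi (px ^ j - monom ((- h0) ^ j) 0) + const (- ((- h0) ^ j)) * C"
    by (simp only: eta_homogeneous H_special prim)
  also have "\<dots> = gen g"
    by (simp only: linear_map_diff[OF linear_lin] lin_px lin_monom) (simp add: Psi C_def const_hom)
  finally show ?thesis .
qed

end

context enveloping
begin

interpretation Y: yangian_relations "Idl\<^bsub>free_alg UNIV\<^esub> (yangian_rels h0)" h0
  by (intro yangian_relations.intro two_sided_Idl) (simp add: yangian_relations_axioms_def h0)

lemma yangian_image_currents:
  "yangian_image h0 (E j) \<approx> G 1 (px ^ j)"
  "yangian_image h0 (F j) \<approx> G (-1) (- ((px - [:h0:]) ^ j))"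
  "yangian_image h0 (Psi j) \<approx> G 0 ((px - [:h0:]) ^ j - px ^ j) + const (- ((- h0) ^ j)) * C"
proof -
  show "yangian_image h0 (E j) \<approx> G 1 (px ^ j)"
    using cong_sym[OF G_u[of 1 "px ^ j"]] by (simp add: yangian_image_def u_def current_classes)
  show "yangian_image h0 (F j) \<approx> G (-1) (- ((px - [:h0:]) ^ j))"
    using cong_sym[OF G_u[of "-1" "- ((px - [:h0:]) ^ j)"]] by (simp add: yangian_image_def u_def current_classes)
  have "yangian_image h0 (Psi j) = u (poly_del ((px - [:h0:]) ^ j - px ^ j) 0) (- ((- h0) ^ j))"
    by (simp add: yangian_image_def u_def current_classes)
  also have "\<dots> \<approx> u (poly_del ((px - [:h0:]) ^ j - px ^ j) 0) 0 + const (- ((- h0) ^ j)) * C" by (rule u_split)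
  also have "\<dots> \<approx> G 0 ((px - [:h0:]) ^ j - px ^ j) + const (- ((- h0) ^ j)) * C"
    by (rule cong_add[OF cong_sym[OF G_u] cong_refl])
  finally show "yangian_image h0 (Psi j) \<approx> G 0 ((px - [:h0:]) ^ j - px ^ j) + const (- ((- h0) ^ j)) * C" .
qed

lemma yangian_rels_image: "p \<in> yangian_rels h0 \<Longrightarrow> subst (yangian_image h0) p \<in> I"
  by (rule yangian_rels_hold) (rule yangian_image_currents)+

lemma subst_C: "subst (yangian_image h0) Y.C \<approx> C"
proof -
  have "subst (yangian_image h0) Y.C = - yangian_image h0 (Psi 0)" by (simp add: Y.C_def subst_simps)
  also have "\<dots> \<approx> - (G 0 ((px - [:h0:]) ^ 0 - px ^ 0) + const (- ((- h0) ^ 0)) * C)"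
    by (rule cong_uminus[OF yangian_image_currents(3)])
  also have "\<dots> = C" by (simp add: linear_map_zero[OF linear_H] const_hom)
  finally show ?thesis .
qed

lemma subst_e: "subst (yangian_image h0) (lin y_e p) \<approx> G 1 p"
  unfolding subst_lin
  by (rule linear_map_cong[OF linear_lin linear_H]) (simp only: lin_px subst_gen yangian_image_currents)

lemma subst_f: "subst (yangian_image h0) (lin y_f p) \<approx> G (-1) (- shift (- h0) p)"
  unfolding subst_lin
proof (rule linear_map_cong[OF linear_lin])
  show "linear_map (\<lambda>p. G (-1) (- shift (- h0) p))"
    using linear_map_intros(3)[OF linear_map_intros(10)[OF linear_H, of "-1" "- h0"]]
    by (simp add: linear_map_uminus[OF linear_H])
  have "shift (- h0) (px ^ k) = (px - [:h0:]) ^ k" for k by (rule polyI) simp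
  then show "lin (\<lambda>k. subst (yangian_image h0) (y_f k)) (px ^ k) \<approx> G (-1) (- shift (- h0) (px ^ k))" for k
    by (simp only: lin_px subst_gen yangian_image_currents)
qed

lemma subst_psi:
  "subst (yangian_image h0) (lin y_psi p) \<approx> G 0 (shift (- h0) p - p) + const (- poly p (- h0)) * C"
  unfolding subst_lin
proof (rule linear_map_cong[OF linear_lin])
  show "linear_map (\<lambda>p. G 0 (shift (- h0) p - p) + const (- poly p (- h0)) * C)"
    by (rule linear_mapI)
      (simp_all add: shift_linear linear_map_simps[OF linear_H] const_hom algebra_simps)
  have "shift (- h0) (px ^ k) = (px - [:h0:]) ^ k" for k by (rule polyI) simp
  then show "lin (\<lambda>k. subst (yangian_image h0) (y_psi k)) (px ^ k)
     \<approx> G 0 (shift (- h0) (px ^ k) - px ^ k) + const (- poly (px ^ k) (- h0)) * C" for k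
    using yangian_image_currents(3)[of k] by (simp only: lin_px subst_gen) (simp add: poly_power)
qed

lemma subst_H: "subst (yangian_image h0) (Y.H r f) \<approx> G r f"
proof -
  consider "0 < r" | "r < 0" | "r = 0" by linarith
  then show ?thesis
  proof cases
    case 1
    have "subst (yangian_image h0) (Y.pos.W (nat r) f) \<approx> G (int (nat r)) f"
    proof (rule subst_W[OF Y.pos.current_algebra_axioms, where K = "\<lambda>n. G (int n)"])
      fix n p q assume n: "0 < (n :: nat)"
      have "twist n h0 p q = brk h0 1 p (int n) q" by (simp add: twist_def brk_def)
      then show "comm (G (int 1) p) (G (int n) q) \<approx> G (int (Suc n)) (twist n h0 p q)"
        using rule0[of 1 "int n" p q] n by simp
    qed (use 1 in \<open>simp_all add: linear_H subst_e\<close>)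
    then show ?thesis using 1 by (simp add: Y.H_def)
  next
    case 2
    have "subst (yangian_image h0) (Y.neg.W (nat (- r)) (shift h0 f)) \<approx> G (- int (nat (- r))) (shift (- h0) (shift h0 f))"
    proof (rule subst_W[OF Y.neg.current_algebra_axioms, where K = "\<lambda>n p. G (- int n) (shift (- h0) p)"])
      show "linear_map (\<lambda>p. G (- int n) (shift (- h0) p))" for n
        by (rule linear_map_intros(10)[OF linear_H])
      show "subst (yangian_image h0) (lin (\<lambda>k. - y_f k) p) \<approx> G (- int 1) (shift (- h0) p)" for p
        using cong_uminus[OF subst_f[of p]]
        by (simp add: lin_uminus subst_simps linear_map_uminus[OF linear_H])
      fix n p q assume n: "0 < (n :: nat)"
      have "shift (- h0) (twist n (- h0) p q) = brk h0 (-1) (shift (- h0) p) (- int n) (shift (- h0) q)"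
        by (rule polyI) (simp add: algebra_simps)
      then show "comm (G (- int 1) (shift (- h0) p)) (G (- int n) (shift (- h0) q))
          \<approx> G (- int (Suc n)) (shift (- h0) (twist n (- h0) p q))"
        using rule0[of "-1" "- int n" "shift (- h0) p" "shift (- h0) q"] n by simp
    qed (use 2 in simp)
    then show ?thesis using 2 by (simp add: Y.H_def shift_shift shift_linear)
  next
    case 3
    have "subst (yangian_image h0) (Y.H r f) = subst (yangian_image h0) (lin y_psi (primitive h0 f))"
      by (simp add: 3 Y.H_special)
    also have "\<dots> \<approx> G 0 (shift (- h0) (primitive h0 f) - primitive h0 f) + const (- poly (primitive h0 f) (- h0)) * C"
      by (rule subst_psi)
    also have "\<dots> = G r f" by (simp add: 3 primitive[OF h0] const_hom)
    finally show ?thesis .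
  qed
qed

lemma subst_eta: "subst (yangian_image h0) (Y.eta p z) \<approx> u p z"
proof -
  have "subst (yangian_image h0) (Y.eta p 0) \<approx> u p 0"
  proof (induct p rule: diff_class_induct[of _ h0])
    case (1 f r)
    show ?case using cong_trans[OF subst_H G_u] by (simp add: Y.eta_homogeneous const_hom)
  next
    case (2 p q)
    have "subst (yangian_image h0) (Y.eta (p + q) 0) = subst (yangian_image h0) (Y.eta p 0) + subst (yangian_image h0) (Y.eta q 0)"
      using Y.eta_add[of p q 0 0] by (simp add: subst_simps)
    also have "\<dots> \<approx> u p 0 + u q 0" by (rule cong_add[OF 2])
    also have "\<dots> \<approx> u (p + q) 0" using cong_sym[OF u_add[of p q 0 0]] by simp
    finally show ?case .
  next
    case (3 p q)
    then show ?case using Y.eta_class[OF 3(1), of 0] u_class[OF 3(1), of 0] by simp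
  qed
  then have "subst (yangian_image h0) (Y.eta p 0) + const z * subst (yangian_image h0) Y.C \<approx> u p 0 + const z * C"
    by (intro cong_add cong_scale subst_C)
  also have "\<dots> \<approx> u p z" by (rule cong_sym[OF u_split])
  finally show ?thesis unfolding Y.eta_split[of p z] by (simp add: subst_simps)
qed

end

theorem theorem5p9:
  fixes h0 :: complex
  assumes "h0 \<noteq> 0"
  shows "\<exists>\<theta> \<in> alg_iso (yangian h0) (env_alg (diff_lie h0)).
    \<forall>j. \<theta> (yangian_class h0 (y_e j))
          = env_incl (diff_lie h0) (diff_class h0 (d_x ^ j * d_del), 0)
      \<and> \<theta> (yangian_class h0 (y_f j))
          = env_incl (diff_lie h0) (diff_class h0 (- (d_delinv * d_x ^ j)), 0)
      \<and> \<theta> (yangian_class h0 (y_psi j))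
          = env_incl (diff_lie h0)
              (diff_class h0 ((d_x - const h0) ^ j - d_x ^ j), - ((- h0) ^ j))"
proof -
  let ?L = "carrier (diff_lie h0)"
  let ?J = "{p. subst (restrict_gens ?L) p \<in> Idl\<^bsub>free_alg ?L\<^esub> (env_rels (diff_lie h0))}"
  interpret Y: yangian_relations "Idl\<^bsub>free_alg UNIV\<^esub> (yangian_rels h0)" h0
    by (intro yangian_relations.intro two_sided_Idl) (simp add: yangian_relations_axioms_def assms)
  interpret U: enveloping ?J h0
    by (rule enveloping.intro[OF two_sided_preimage[OF rels_ideal[OF env_rels_carrier] restrict_gens_closed]])
      (simp add: enveloping_axioms_def assms)
  have closed: "yangian_image h0 g \<in> carrier (free_alg ?L)" for g
    by (cases g) (simp_all add: yangian_image_def gen_closed diff_lie_simps)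
  have closed': "subst (yangian_image h0) p \<in> carrier (free_alg ?L)" for p
    by (rule subst_closed[of _ UNIV]) (simp_all add: closed)
  have "\<exists>\<theta>\<in>alg_iso (pres_alg UNIV (yangian_rels h0)) (pres_alg ?L (env_rels (diff_lie h0))).
    \<forall>p\<in>carrier (free_alg UNIV). \<theta> (pres_class UNIV (yangian_rels h0) p)
      = pres_class ?L (env_rels (diff_lie h0)) (subst (yangian_image h0) p)"
  proof (rule pres_alg_iso[where \<psi> = Y.env_image])
    show "subst (yangian_image h0) p \<in> Idl\<^bsub>free_alg ?L\<^esub> (env_rels (diff_lie h0))" if "p \<in> yangian_rels h0" for p
      using U.mem_iff[OF closed'] U.yangian_rels_image[OF that] by blast
    show "subst (yangian_image h0) (Y.env_image k) - gen k \<in> Idl\<^bsub>free_alg ?L\<^esub> (env_rels (diff_lie h0))"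
      if k: "k \<in> ?L" for k
    proof -
      obtain p z where pz: "k = (diff_class h0 p, z)" using k carrier_diff_lie by blast
      have "subst (yangian_image h0) (Y.env_image k) - gen k \<in> ?J"
        using U.subst_eta[of p z] by (simp only: pz Y.env_image U.cong_def U.u_def)
      moreover have "subst (yangian_image h0) (Y.env_image k) - gen k \<in> carrier (free_alg ?L)"
        by (rule free_alg_diff_closed[OF closed' gen_closed[OF k]])
      ultimately show ?thesis using U.mem_iff by blast
    qed
  qed (simp_all add: env_rels_carrier closed Y.env_rels_hold Y.env_image_yangian_image Y.zero)
  then obtain \<theta> where \<theta>: "\<theta> \<in> alg_iso (yangian h0) (env_alg (diff_lie h0))"
    "\<And>p. \<theta> (yangian_class h0 p) = pres_class ?L (env_rels (diff_lie h0)) (subst (yangian_image h0) p)"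
    by (auto simp: yangian_def env_alg_def yangian_class_def)
  show ?thesis
    by (rule bexI[OF _ \<theta>(1)]) (simp add: \<theta>(2) subst_gen yangian_image_def env_incl_def)
qed

end
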